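(* Let $p\in(0,1)$. Then $$\frac{(1+p)^2\pi}{4p}\le A_p\le\tilde A_p\le\inf_{q\in(1,\infty)}N_p(q),$$ where $$N_p(q)=\frac{(1+p^2)\log q}{2p}\,\cot^2\left(\frac14\cot^{-1}\left(\frac{q+1}{q-1}+\frac{(1-p^2)^2(1+q^2)}{2p(q-1)\bigl(4p\sqrt q+(1+q)(1+p^2)\bigr)}\right)\right).$$
   Context: Let $\mathbb D=\{\zeta\in\mathbb C:|\zeta|<1\}$, let $\mathbb T^-=\{\zeta\in\mathbb C:|\zeta|=1,\ \operatorname{Re}\zeta<0\}$ be the open left half of the unit circle, and let $\mathbb I_1=\{iv:-1<v<1\}$ be the vertical diameter of $\mathbb D$. For a curve $\gamma$ in $\mathbb C$, $\ell(\gamma)\in[0,+\infty]$ denotes its Euclidean length (equal to $\int_a^b|\gamma'(t)|\,dt$ when $\gamma:(a,b)\to\mathbb C$ is piecewise $C^1$); $\ell(f(\mathbb T^-))$ and $\ell(f(\mathbb I_1))$ denote the lengths of the image curves of $\mathbb T^-$ and $\mathbb I_1$ under $f$. For $x>0$, $\cot^{-1}x\in(0,\pi/2)$ is the principal inverse cotangent. For $p\in(0,1)$ put $\alpha=\frac{2p}{1+p^2}$ and $\overline{\Delta}_p=\{\zeta\in\mathbb C:|\zeta-\alpha^{-1}|\le\sqrt{\alpha^{-2}-1}\}$. $\mathcal M_p$ is the class of meromorphic univalent (injective) functions on $\mathbb D$ with a simple pole at $p$ that extend continuously to $\mathbb T^-$, and $\mathcal M_p^0=\{f\in\mathcal M_p:\ell(f(\mathbb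 T^-))<+\infty\}$. $\tilde{\mathcal M}_p$ is the class of analytic univalent functions on the domain $\mathbb D\setminus\overline{\Delta}_p$ that extend continuously to $\mathbb T^-$, and $\tilde{\mathcal M}_p^0=\{f\in\tilde{\mathcal M}_p:\ell(f(\mathbb T^-))<+\infty\}$. Define $$A_p=\sup_{f\in\mathcal M_p^0}\frac{\ell(f(\mathbb I_1))}{\ell(f(\mathbb T^-))},\qquad \tilde A_p=\sup_{f\in\tilde{\mathcal M}_p^0}\frac{\ell(f(\mathbb I_1))}{\ell(f(\mathbb T^-))}.$$ *)

theory Defs
  imports "HOL-Complex_Analysis.Complex_Analysis"
begin

definition left_arc :: "complex set" where
  "left_arc = {z. norm z = 1 \<and> Re z < 0}"

(* Euclidean length of a curve, as the supremum of the lengths of inscribed polygons.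
   The parameter domain S may be an open interval; the value may be infinite. *)
definition curve_length :: "real set \<Rightarrow> (real \<Rightarrow> complex) \<Rightarrow> ennreal" where
  "curve_length S \<gamma> =
     (SUP ts \<in> {ts. sorted ts \<and> set ts \<subseteq> S}.
        \<Sum>i < length ts - 1. ennreal (dist (\<gamma> (ts ! i)) (\<gamma> (ts ! Suc i))))"

(* The arc left_arc is parametrized injectively by cis on the open interval (pi/2, 3*pi/2). *)
definition arc_image_length :: "(complex \<Rightarrow> complex) \<Rightarrow> ennreal" where
  "arc_image_length f = curve_length {pi / 2 <..< 3 * pi / 2} (\<lambda>t. f (cis t))"

definition diameter_image_length :: "(complex \<Rightarrow> complex) \<Rightarrow> ennreal" where
  "diameter_image_length f = curve_length {-1 <..< 1} (\<lambda>v. f (\<i> * of_real v))"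

definition alpha :: "real \<Rightarrow> real" where
  "alpha p = 2 * p / (1 + p\<^sup>2)"

definition Delta_closed :: "real \<Rightarrow> complex set" where
  "Delta_closed p = cball (of_real (inverse (alpha p))) (sqrt ((inverse (alpha p))\<^sup>2 - 1))"

(* Functions are total on the complex plane. A function that extends continuously to left_arc
   is identified with its extension, which is unique because left_arc lies in the closure of
   the domain; all other values, including the one at the pole, are irrelevant.
   Injectivity of the meromorphic function as a map into the Riemann sphere, with value
   infinity at p, amounts to having no other pole in the disc and being injective off p. *)
definition M_class :: "real \<Rightarrow> (complex \<Rightarrow> complex) set" where
  "M_class p = {f. f holomorphic_on ball 0 1 - {of_real p} \<and>
                   is_pole f (of_real p) \<and> zorder f (of_real p) = -1 \<and>
                   inj_on f (ball 0 1 - {of_real p}) \<and>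
                   continuous_on (ball 0 1 - {of_real p} \<union> left_arc) f}"

definition M0_class :: "real \<Rightarrow> (complex \<Rightarrow> complex) set" where
  "M0_class p = {f \<in> M_class p. arc_image_length f < \<infinity>}"

definition M_tilde_class :: "real \<Rightarrow> (complex \<Rightarrow> complex) set" where
  "M_tilde_class p = {f. f holomorphic_on ball 0 1 - Delta_closed p \<and>
                         inj_on f (ball 0 1 - Delta_closed p) \<and>
                         continuous_on (ball 0 1 - Delta_closed p \<union> left_arc) f}"

definition M0_tilde_class :: "real \<Rightarrow> (complex \<Rightarrow> complex) set" where
  "M0_tilde_class p = {f \<in> M_tilde_class p. arc_image_length f < \<infinity>}"

(* The denominators are positive and finite: a function in either class is nonconstant on
   left_arc, so no junk value of division in ennreal occurs. *)
definition A_const :: "real \<Rightarrow> ennreal" where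
  "A_const p = (SUP f \<in> M0_class p. diameter_image_length f / arc_image_length f)"

definition A_tilde_const :: "real \<Rightarrow> ennreal" where
  "A_tilde_const p = (SUP f \<in> M0_tilde_class p. diameter_image_length f / arc_image_length f)"

(* Principal inverse cotangent, meaningful for x > 0. *)
definition arccot :: "real \<Rightarrow> real" where
  "arccot x = (THE y. 0 < y \<and> y < pi / 2 \<and> cot y = x)"

definition N_bound :: "real \<Rightarrow> real \<Rightarrow> real" where
  "N_bound p q =
     (1 + p\<^sup>2) * ln q / (2 * p) *
     (cot (1 / 4 * arccot ((q + 1) / (q - 1) +
        (1 - p\<^sup>2)\<^sup>2 * (1 + q\<^sup>2) /
          (2 * p * (q - 1) * (4 * p * sqrt q + (1 + q) * (1 + p\<^sup>2))))))\<^sup>2"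

end

theory Submission
  imports Defs "HOL-Real_Asymp.Real_Asymp"
begin

text \<open>\<^emph>\<open>Lower bound.\<close> Composing \<open>z + 1/z\<close> with a Moebius transformation gives the function
\<open>(1 + z)\<^sup>2 / ((p - z) (1 - p z))\<close> (\<open>slit_map\<close>), which maps the disc onto the Riemann sphere cut along a
real segment. The left half circle runs twice through a segment. On the vertical diameter \<open>z + 1/z\<close> is
purely imaginary, so the image is a full circle without one point. The quotient of these two lengths is
\<open>(1 + p)\<^sup>2 \<pi> / (4 p)\<close>. The middle inequality holds because \<open>p\<close> lies in the disc \<open>\<Delta>\<close> that
is removed from the domain of the larger class.

\<^emph>\<open>Upper bound.\<close> This is a Gehring--Hayman argument in the unit disc without \<open>\<Delta>\<close>, a lens between two
orthogonal circles. A Cayley transformation turns it into the part of the upper half plane where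
\<open>|z + c|\<^sup>2 > c\<^sup>2 - 1\<close>, with \<open>c = 1/\<alpha>\<close>; the left half circle becomes the positive real
axis and the diameter becomes the positive imaginary axis. Cut both into pieces with endpoints \<open>x\<close> and
\<open>q x\<close>. The explicit conformal map \<open>z + c + (c\<^sup>2 - 1)/(z + c)\<close> of the lens onto the half plane
shows two things for \<open>x \<le> y \<le> q x\<close>. The hyperbolic density of the lens at \<open>i y\<close> is at most \<open>c\<close>
times that of the half plane (\<open>lens_map_speed\<close>), and \<open>\<pi>\<close> times the harmonic measure of the real interval
from \<open>x\<close> to \<open>q x\<close> at \<open>i y\<close> has a cotangent no larger than the argument of the inverse
cotangent in \<open>N\<^sub>p(q)\<close> (\<open>lens_cotangent_bound\<close>).

What remains is a statement on a univalent function \<open>h\<close> in the unit disc: if \<open>h\<close> maps the boundary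
arc \<open>|\<theta>| < \<phi>\<close>, \<open>\<phi> \<le> \<pi>/2\<close>, onto a curve of length \<open>l\<close>, then
\<open>|h'(0)| tan\<^sup>2(\<phi>/2) \<le> 8 l\<close> (\<open>arc_length_bound\<close>). As \<open>tan(\<phi>/2) \<ge> 2 tan(\<phi>/4)\<close>, it
follows that \<open>|h'(0)| \<le> 2 l cot\<^sup>2(\<phi>/4)\<close>. Hence on each piece of the imaginary axis the
derivative along \<open>log y\<close> is at most \<open>c cot\<^sup>2(\<phi>/4)\<close> times the length of the image of the
corresponding boundary piece, and integration over a piece, which has logarithmic length \<open>log q\<close>, gives the
factor \<open>N\<^sub>p(q)\<close>.

The arc estimate has two ingredients, both consequences of Bieberbach's \<open>|h''(0)| \<le> 4 |h'(0)|\<close>. The distortion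
theorem allows the base point to be moved towards the arc until the arc is seen as a half circle, at the cost of
the factor \<open>cot\<^sup>2(\<phi>/2)\<close>. For a half circle (\<open>half_circle_derivative_bound\<close>) the harmonic function
\<open>log |h'|\<close> is compared at 0 with its mean over the half circle: the difference is controlled by the normal
derivative on the diameter, which the invariant form of Bieberbach's inequality bounds, and Jensen's inequality
turns the mean of \<open>log |h'|\<close> into the logarithm of the length. Since \<open>h\<close> is only continuous on the arc,
this is applied on slightly smaller circles, on which the length of the image is asymptotically no larger
(\<open>interior_arc_length\<close>).

Bieberbach's inequality itself is deduced from Koebe's quarter theorem, applied to \<open>h\<close> composed with a conformal map
onto the disc slit along a radius (\<open>koebe_slit\<close>). Koebe's theorem becomes, after a square root, the bound
\<open>|k'(0)| \<le> 2 |k(0)|\<close> for univalent \<open>k\<close> with \<open>k(z) + k(w) \<noteq> 0\<close> (\<open>koebe_antipodal\<close>).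
That bound is the limit, as \<open>N\<close> grows, of the maximum principle for a product over pairs of \<open>N\<close>-th roots
of unity, which is estimated by the crude bound \<open>N! C\<^sup>N\<close> for an \<open>N\<close> by \<open>N\<close> Cauchy determinant.\<close>

section \<open>A product inequality of Cauchy determinant type\<close>
lemma lagrange_interpolation_identity:
  fixes y :: "'b \<Rightarrow> complex" and x :: "'a \<Rightarrow> complex"
  assumes "finite A" "finite B" "inj_on y B" "card A < card B"
  shows "(\<Prod>i\<in>A. t - x i) =
           (\<Sum>b\<in>B. (\<Prod>i\<in>A. y b - x i) * (\<Prod>m\<in>B - {b}. (t - y m) / (y b - y m)))"
proof -
  define P where "P = (\<Prod>i\<in>A. [:- x i, 1:])"
  define Q where "Q = (\<Sum>b\<in>B. smult (\<Prod>i\<in>A. y b - x i) 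
        (\<Prod>m\<in>B - {b}. smult (1 / (y b - y m)) [:- y m, 1:]))"
  have degP: "degree P < card B"
  proof -
    have "degree P \<le> sum (degree \<circ> (\<lambda>i. [:- x i, 1:])) A"
      unfolding P_def by (rule degree_prod_sum_le) (use assms in auto)
    also have "\<dots> \<le> card A" by simp
    finally show ?thesis using assms by simp
  qed
  have degQ: "degree Q < card B"
  proof -
    have "degree Q \<le> card B - 1"
      unfolding Q_def
    proof (rule degree_sum_le)
      fix b assume b: "b \<in> B"
      have "degree (\<Prod>m\<in>B - {b}. smult (1 / (y b - y m)) [:- y m, 1:])
           \<le> sum (degree \<circ> (\<lambda>m. smult (1 / (y b - y m)) [:- y m, 1:])) (B - {b})"
        by (rule degree_prod_sum_le) (use assms in auto)
      also have "\<dots> \<le> (\<Sum>m\<in>B - {b}. 1)" by (rule sum_mono) (simp add: degree_smult_eq)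
      also have "\<dots> = card B - 1" using b assms by simp
      finally show "degree (smult (\<Prod>i\<in>A. y b - x i) 
        (\<Prod>m\<in>B - {b}. smult (1 / (y b - y m)) [:- y m, 1:])) \<le> card B - 1"
        by (meson degree_smult_le order_trans)
    qed (use assms in auto)
    then show ?thesis using assms(4) by linarith
  qed
  have pQ: "poly Q u = (\<Sum>b\<in>B. (\<Prod>i\<in>A. y b - x i) * (\<Prod>m\<in>B - {b}. (u - y m) / (y b - y m)))" for u
    unfolding Q_def by (simp add: poly_sum poly_prod diff_divide_distrib)
  have pP: "poly P u = (\<Prod>i\<in>A. u - x i)" for u
    unfolding P_def by (simp add: poly_prod)
  have "P = Q"
  proof (rule poly_eqI_degree[of "y ` B"])
    fix u assume "u \<in> y ` B"
    then obtain b where b: "b \<in> B" "u = y b" by auto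
    have z: "(\<Prod>m\<in>B - {b'}. (u - y m) / (y b' - y m)) = (if b' = b then 1 else 0)" if "b' \<in> B" for b'
    proof (cases "b' = b")
      case True
      then have "(u - y m) / (y b' - y m) = 1" if "m \<in> B - {b'}" for m
        using b assms(3) that by (auto simp: inj_on_def)
      then show ?thesis using True by (simp add: prod.neutral)
    next
      case False
      then show ?thesis using b assms(2) by (auto intro!: prod_zero)
    qed
    have "poly Q u = (\<Sum>b'\<in>B. (\<Prod>i\<in>A. y b' - x i) * (if b' = b then 1 else 0))"
      unfolding pQ by (rule sum.cong) (auto simp: z)
    also have "\<dots> = poly P u"
      using b assms(2) by (simp add: pP if_distrib cong: if_cong)
    finally show "poly P u = poly Q u" by simp
  qed (use degP degQ assms in \<open>auto simp: card_image\<close>)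
  then show ?thesis using pP pQ by metis
qed

text \<open>The square of the modulus of a Vandermonde determinant: every unordered pair occurs twice, which avoids an
ordering of the index set.\<close>
definition pair_prod :: "('a \<Rightarrow> complex) \<Rightarrow> 'a set \<Rightarrow> real" where
  "pair_prod x A = (\<Prod>i\<in>A. \<Prod>j\<in>A - {i}. norm (x i - x j))"

lemma pair_prod_remove:
  assumes "finite A" "a \<in> A"
  shows "pair_prod x A = pair_prod x (A - {a}) * (\<Prod>i\<in>A - {a}. norm (x a - x i))\<^sup>2"
proof -
  let ?A = "A - {a}"
  have "pair_prod x A = (\<Prod>j\<in>?A. norm (x a - x j)) * (\<Prod>i\<in>?A. \<Prod>j\<in>A - {i}. norm (x i - x j))"
    unfolding pair_prod_def by (simp add: prod.remove[OF assms])
  also have "(\<Prod>i\<in>?A. \<Prod>j\<in>A - {i}. norm (x i - x j)) =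
     (\<Prod>i\<in>?A. norm (x i - x a) * (\<Prod>j\<in>?A - {i}. norm (x i - x j)))"
  proof (rule prod.cong)
    fix i assume i: "i \<in> ?A"
    have "(\<Prod>j\<in>A - {i}. norm (x i - x j)) = norm (x i - x a) * (\<Prod>j\<in>A - {i} - {a}. norm (x i - x j))"
      by (rule prod.remove) (use assms i in auto)
    moreover have "A - {i} - {a} = ?A - {i}" by auto
    ultimately show "(\<Prod>j\<in>A - {i}. norm (x i - x j)) = norm (x i - x a) * (\<Prod>j\<in>?A - {i}. norm (x i - x j))"
      by simp
  qed simp
  also have "\<dots> = (\<Prod>i\<in>?A. norm (x a - x i)) * pair_prod x ?A"
    unfolding pair_prod_def by (simp add: prod.distrib norm_minus_commute)
  finally show ?thesis by (simp add: power2_eq_square algebra_simps)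
qed

text \<open>Up to squares, the quotient of the two sides without the factorial is the Cauchy determinant of the matrix with
entries \<open>1/(x\<^sub>i - y\<^sub>j)\<close>, and the bound is the Leibniz formula with \<open>n!\<close> terms of size at most
\<open>C\<^sup>n\<close>. The determinant is avoided: expansion along the row of a point \<open>a\<close> is Lagrange interpolation
at the nodes \<open>y\<^sub>j\<close>, and one of the \<open>n + 1\<close> terms is at least the average.\<close>
lemma cauchy_product_bound:
  fixes x :: "'a \<Rightarrow> complex" and y :: "'b \<Rightarrow> complex"
  assumes "finite A" "finite B" "card A = n" "card B = n" "inj_on y B"
    and C: "C \<ge> 0" "\<And>i j. i \<in> A \<Longrightarrow> j \<in> B \<Longrightarrow> 1 \<le> C * norm (x i - y j)"
  shows "pair_prod x A * pair_prod y B \<le> (fact n * C ^ n)\<^sup>2 * (\<Prod>i\<in>A. \<Prod>j\<in>B. norm (x i - y j))\<^sup>2"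
  using assms
proof (induction n arbitrary: A B)
  case 0
  then show ?case by (simp add: pair_prod_def)
next
  case (Suc n)
  obtain a where a: "a \<in> A" using Suc.prems by (metis card.empty nat.distinct(1) ex_in_conv)
  define A' where "A' = A - {a}"
  define T where "T b = (\<Prod>i\<in>A'. y b - x i) * (\<Prod>m\<in>B - {b}. (x a - y m) / (y b - y m))" for b
  have fin: "finite A'" "finite B" "card A' = n" using Suc.prems a by (auto simp: A'_def)
  have L: "(\<Prod>i\<in>A'. x a - x i) = (\<Sum>b\<in>B. T b)"
    unfolding T_def by (rule lagrange_interpolation_identity) (use Suc.prems fin in auto)
  have "\<exists>b\<in>B. norm (\<Prod>i\<in>A'. x a - x i) \<le> (n + 1) * norm (T b)"
  proof (rule ccontr)
    assume "\<not> ?thesis"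
    then have *: "(n + 1) * norm (T b) < norm (\<Prod>i\<in>A'. x a - x i)" if "b \<in> B" for b
      using that by force
    have "(n + 1) * norm (\<Prod>i\<in>A'. x a - x i) \<le> (n + 1) * (\<Sum>b\<in>B. norm (T b))"
      unfolding L by (intro mult_left_mono norm_sum) auto
    also have "\<dots> = (\<Sum>b\<in>B. (n + 1) * norm (T b))" by (simp add: sum_distrib_left)
    also have "\<dots> < (\<Sum>b\<in>B. norm (\<Prod>i\<in>A'. x a - x i))"
      by (rule sum_strict_mono) (use * Suc.prems in auto)
    also have "\<dots> = (n + 1) * norm (\<Prod>i\<in>A'. x a - x i)" using Suc.prems by simp
    finally show False by simp
  qed
  then obtain b where b: "b \<in> B" "norm (\<Prod>i\<in>A'. x a - x i) \<le> (n + 1) * norm (T b)" by auto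
  define B' where "B' = B - {b}"
  have fin': "finite B'" "card B' = n" using Suc.prems b by (auto simp: B'_def)
  define U where "U = (\<Prod>i\<in>A'. norm (x a - x i))"
  define V where "V = (\<Prod>m\<in>B'. norm (y b - y m))"
  define R where "R = (\<Prod>i\<in>A'. norm (x i - y b))"
  define S where "S = (\<Prod>m\<in>B'. norm (x a - y m))"
  define D where "D = (\<Prod>i\<in>A'. \<Prod>j\<in>B'. norm (x i - y j))"
  have nn: "U \<ge> 0" "V \<ge> 0" "R \<ge> 0" "S \<ge> 0" "D \<ge> 0"
    unfolding U_def V_def R_def S_def D_def by (intro prod_nonneg; simp)+
  have "V > 0" unfolding V_def
    by (intro prod_pos) (use Suc.prems b in \<open>auto simp: B'_def inj_on_def\<close>)
  have "norm (T b) = R * (S / V)"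
    unfolding T_def R_def S_def V_def B'_def[symmetric]
    by (simp add: norm_mult prod_norm[symmetric] norm_divide prod_dividef norm_minus_commute)
  then have "U \<le> (n + 1) * (R * (S / V))"
    using b(2) by (simp add: U_def prod_norm)
  then have UV: "U * V \<le> (n + 1) * (R * S)"
    using \<open>V > 0\<close> by (simp add: field_simps)
  have IH: "pair_prod x A' * pair_prod y B' \<le> (fact n * C ^ n)\<^sup>2 * D\<^sup>2"
    unfolding D_def
    by (rule Suc.IH) (use Suc.prems fin fin' in \<open>auto simp: A'_def B'_def inj_on_def\<close>)
  have big: "(\<Prod>i\<in>A. \<Prod>j\<in>B. norm (x i - y j)) = norm (x a - y b) * S * (R * D)"
  proof -
    have "(\<Prod>i\<in>A. \<Prod>j\<in>B. norm (x i - y j)) = (\<Prod>i\<in>A. norm (x i - y b) * (\<Prod>j\<in>B'. norm (x i - y j)))"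
      unfolding B'_def using b Suc.prems by (intro prod.cong refl prod.remove) auto
    also have "\<dots> = (norm (x a - y b) * S) * (\<Prod>i\<in>A'. norm (x i - y b) * (\<Prod>j\<in>B'. norm (x i - y j)))"
      unfolding A'_def S_def using a Suc.prems by (intro prod.remove) auto
    also have "\<dots> = norm (x a - y b) * S * (R * D)"
      by (simp add: R_def D_def prod.distrib)
    finally show ?thesis .
  qed
  have "pair_prod x A * pair_prod y B = (pair_prod x A' * pair_prod y B') * (U * V)\<^sup>2"
    unfolding U_def V_def A'_def B'_def using a b Suc.prems
    by (simp add: pair_prod_remove power_mult_distrib algebra_simps)
  also have "\<dots> \<le> ((fact n * C ^ n)\<^sup>2 * D\<^sup>2) * ((n + 1) * (R * S))\<^sup>2"
    by (intro mult_mono IH power_mono UV) (use nn in auto)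
  also have "\<dots> \<le> ((fact n * C ^ n)\<^sup>2 * D\<^sup>2) * ((n + 1) * (R * S))\<^sup>2 * (C * norm (x a - y b))\<^sup>2"
  proof -
    have "1 \<le> (C * norm (x a - y b))\<^sup>2" using Suc.prems(7)[OF a b(1)] by (simp add: one_le_power)
    then have "X * 1 \<le> X * (C * norm (x a - y b))\<^sup>2" if "X \<ge> 0" for X :: real
      using that by (intro mult_left_mono)
    from this[of "((fact n * C ^ n)\<^sup>2 * D\<^sup>2) * ((n + 1) * (R * S))\<^sup>2"]
    show ?thesis by (simp only: mult_1_right) (auto intro!: mult_nonneg_nonneg)
  qed
  also have "\<dots> = (fact (Suc n) * C ^ Suc n)\<^sup>2 * (\<Prod>i\<in>A. \<Prod>j\<in>B. norm (x i - y j))\<^sup>2"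
    unfolding big by (simp add: power_mult_distrib power2_eq_square algebra_simps)
  finally show ?case .
qed

text \<open>The product is the derivative of \<open>X\<^sup>N - 1\<close> at its root \<open>a\<close>.\<close>
lemma roots_of_unity_differences:
  assumes N: "N > 0" and a: "(a::complex) ^ N = 1"
  shows "(\<Prod>b\<in>{z. z ^ N = 1} - {a}. a - b) = of_nat N * a ^ (N - 1)"
proof -
  let ?Z = "{z::complex. z ^ N = 1}"
  have fin: "finite ?Z" and card: "card ?Z = N" using N by (auto simp: finite_roots_unity card_complex_roots_unity)
  define Q where "Q = (\<Prod>b\<in>?Z - {a}. [:- b, 1:])"
  have lc: "lead_coeff (\<Prod>b\<in>?Z. [:- b, 1:]) = 1" by (subst lead_coeff_prod) simp
  have deg: "degree (\<Prod>b\<in>?Z. [:- b, 1:]) = N"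
    by (subst degree_prod_eq_sum_degree) (auto simp: card)
  have degm: "degree (monom 1 N - 1 :: complex poly) = N"
    using N degree_add_eq_left[of "- 1" "monom 1 N :: complex poly"] by (simp add: degree_monom_eq)
  have "(\<Prod>b\<in>?Z. [:- b, 1:]) = monom 1 N - 1"
  proof (rule poly_eqI_degree_lead_coeff[where A = ?Z and n = N])
    show "coeff (\<Prod>b\<in>?Z. [:- b, 1:]) N = coeff (monom 1 N - 1) N"
      using lc deg N by simp
    fix z assume "z \<in> ?Z"
    then show "poly (\<Prod>b\<in>?Z. [:- b, 1:]) z = poly (monom 1 N - 1) z"
      using fin by (auto simp: poly_prod poly_monom intro!: prod_zero)
  qed (use card deg degm in auto)
  moreover have "(\<Prod>b\<in>?Z. [:- b, 1:]) = [:- a, 1:] * Q"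
    unfolding Q_def by (rule prod.remove) (use fin a in auto)
  ultimately have "poly (pderiv ([:- a, 1:] * Q)) a = poly (pderiv (monom 1 N - 1)) a" by simp
  then have "poly Q a = of_nat N * a ^ (N - 1)"
    by (simp add: pderiv_mult pderiv_pCons pderiv_diff pderiv_monom poly_monom pderiv_smult)
  then show ?thesis unfolding Q_def by (simp add: poly_prod)
qed

section \<open>The Koebe and Bieberbach inequalities\<close>
text \<open>The extremal function \<open>(1 + z)/(1 - z)\<close> maps onto a half plane. For the roots of unity \<open>a\<close> of order
\<open>N\<close>, the product of \<open>(k(z a) - k(z b)) / (k(z a) + k(z b))\<close> over all pairs \<open>a \<noteq> b\<close>, divided by the product
of \<open>z (a - b)\<close>, is holomorphic and takes a power of \<open>k'(0) / (2 k(0))\<close> at 0. Cauchy's determinant with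
the nodes \<open>k(z a)\<close> and \<open>-k(z a)\<close> bounds the product on circles by \<open>e\<close> to the power
\<open>O(N log N)\<close>, which is negligible against its \<open>N (N - 1)\<close> factors as \<open>N\<close> tends to infinity.\<close>
lemma koebe_antipodal:
  assumes holo: "k holomorphic_on ball 0 1" and inj: "inj_on k (ball 0 1)"
    and disj: "\<And>z w. z \<in> ball 0 1 \<Longrightarrow> w \<in> ball 0 1 \<Longrightarrow> k z + k w \<noteq> 0"
  shows "norm (deriv k 0) \<le> 2 * norm (k 0)"
proof -
  define t where "t = norm (deriv k 0) / (2 * norm (k 0))"
  have k0: "k 0 \<noteq> 0" using disj[of 0 0] by simp
  have t0: "t \<ge> 0" by (simp add: t_def)
  have main: "t * r \<le> 1" if r: "0 < r" "r < 1" for r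
  proof -
    have sub: "cball 0 r \<subseteq> ball (0::complex) 1" using r by auto
    have contk: "continuous_on (cball 0 r) k"
      using holo sub holomorphic_on_imp_continuous_on continuous_on_subset by blast
    obtain M where M: "\<And>z. z \<in> cball 0 r \<Longrightarrow> norm (k z) \<le> M" "M > 0"
    proof -
      have "compact (k ` cball 0 r)" using contk by (intro compact_continuous_image) auto
      then obtain M where "\<forall>x\<in>k ` cball 0 r. norm x \<le> M" "M > 0"
        using compact_imp_bounded bounded_pos by blast
      then show ?thesis using that[of M] by auto
    qed
    obtain m where m: "m > 0" "\<And>z w. z \<in> cball 0 r \<Longrightarrow> w \<in> cball 0 r \<Longrightarrow> m \<le> norm (k z + k w)"
    proof -
      let ?g = "\<lambda>p. norm (k (fst p) + k (snd p))"
      have c: "continuous_on (cball 0 r \<times> cball 0 r) ?g"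
        by (intro continuous_intros continuous_on_compose2[OF contk]) auto
      have "compact (cball (0::complex) r \<times> cball (0::complex) r)" by (intro compact_Times) auto
      moreover have "cball (0::complex) r \<times> cball (0::complex) r \<noteq> {}" using r by auto
      ultimately obtain p where p: "p \<in> cball 0 r \<times> cball 0 r"
        "\<And>q. q \<in> cball 0 r \<times> cball 0 r \<Longrightarrow> ?g p \<le> ?g q"
        using continuous_attains_inf[OF _ _ c] by blast
      have "?g p > 0" using disj[of "fst p" "snd p"] p(1) r by auto
      then show ?thesis using p(2) that[of "?g p"] by auto
    qed
    define C where "C = 1 / m"
    define B where "B = 2 * M * C"
    have CB: "C > 0" "B > 0" using m M by (auto simp: C_def B_def)
    \<comment> \<open>Only the linear growth in \<open>N\<close> of the right-hand side matters.\<close>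
    have bd: "(t * r) ^ (N - 1) \<le> real N * B" if N: "N > 0" for N
    proof -
      define Z where "Z = {z::complex. z ^ N = 1}"
      have fin: "finite Z" and card: "card Z = N" using N by (auto simp: Z_def finite_roots_unity card_complex_roots_unity)
      have nZ: "norm a = 1" if "a \<in> Z" for a
      proof -
        have "norm a ^ N = 1 ^ N" using that by (simp add: Z_def flip: norm_power)
        then show ?thesis using N power_eq_imp_eq_base[of "norm a" N 1] by simp
      qed
      define F where "F a b z = (if z = 0 then deriv (\<lambda>z. (k (z * a) - k (z * b)) / (a - b)) 0
          else ((k (z * a) - k (z * b)) / (a - b) - (k (0 * a) - k (0 * b)) / (a - b)) / (z - 0))" for a b z
      \<comment> \<open>A zero-free combination of difference quotients: its value at 0 is a power of the wanted quotient, and on a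
circle it is the product bounded by the Cauchy determinant estimate.\<close>
      define P where "P z = (\<Prod>a\<in>Z. \<Prod>b\<in>Z - {a}. F a b z / (k (z * a) + k (z * b)))" for z
      have inb: "z * a \<in> ball 0 1" if "a \<in> Z" "z \<in> ball 0 1" for a z
        using that nZ by (auto simp: norm_mult)
      have kh: "(\<lambda>z. k (z * a)) holomorphic_on ball 0 1" if "a \<in> Z" for a
        by (rule holomorphic_on_compose_gen[OF _ holo, unfolded o_def])
           (use inb that in \<open>auto intro!: holomorphic_intros\<close>)
      have Fh: "F a b holomorphic_on ball 0 1" if "a \<in> Z" "b \<in> Z" for a b
        unfolding F_def
      proof (rule pole_lemma)
        show "(\<lambda>z. (k (z * a) - k (z * b)) / (a - b)) holomorphic_on ball 0 1"
        proof (cases "a = b")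
          case False
          then show ?thesis by (intro holomorphic_intros kh that) auto
        qed auto
      qed auto
      have Ph: "P holomorphic_on ball 0 1"
        unfolding P_def by (intro holomorphic_intros Fh kh disj inb) auto
      have F0: "F a b 0 = deriv k 0" if "a \<in> Z" "b \<in> Z" "a \<noteq> b" for a b
      proof -
        have k': "(k has_field_derivative deriv k 0) (at 0)"
          by (rule holomorphic_derivI[OF holo]) auto
        have kd: "((\<lambda>z. k (z * c)) has_field_derivative deriv k 0 * c) (at 0)" for c
          by (rule DERIV_chain2[of k "deriv k 0" "\<lambda>z. z * c" 0 c UNIV, OF _ _])
             (use k' in \<open>auto intro!: derivative_eq_intros\<close>)
        have "((\<lambda>z. (k (z * a) - k (z * b)) / (a - b)) has_field_derivative 
              (deriv k 0 * a - deriv k 0 * b) / (a - b)) (at 0)"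
          by (intro DERIV_cdivide DERIV_diff kd)
        then show ?thesis using that by (simp add: F_def DERIV_imp_deriv diff_divide_distrib[symmetric] right_diff_distrib[symmetric])
      qed
      have "norm (P 0) = (\<Prod>a\<in>Z. \<Prod>b\<in>Z - {a}. t)"
      proof -
        have "norm (P 0) = (\<Prod>a\<in>Z. \<Prod>b\<in>Z - {a}. norm (F a b 0 / (k (0 * a) + k (0 * b))))"
          by (simp only: P_def prod_norm)
        also have "\<dots> = (\<Prod>a\<in>Z. \<Prod>b\<in>Z - {a}. t)"
          by (intro prod.cong refl) (auto simp: F0 t_def norm_divide norm_mult simp flip: mult_2)
        finally show ?thesis .
      qed
      also have "\<dots> = t ^ (N * (N - 1))"
        by (simp add: fin card power_mult[symmetric] mult.commute)
      finally have P0: "norm (P 0) = t ^ (N * (N - 1))" .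
      have Pbd: "norm (P z) \<le> fact N * B ^ N / r ^ (N * (N - 1))" if z: "norm z = r" for z
      proof -
        define w where "w a = k (z * a)" for a
        define D where "D = (\<Prod>a\<in>Z. \<Prod>b\<in>Z - {a}. norm (w a + w b))"
        have zin: "z * a \<in> cball 0 r" if "a \<in> Z" for a
          using that nZ z by (auto simp: norm_mult)
        have wm: "m \<le> norm (w a + w b)" if "a \<in> Z" "b \<in> Z" for a b
          using m(2) zin that by (auto simp: w_def)
        have wM: "norm (w a) \<le> M" if "a \<in> Z" for a
          using M(1) zin that by (auto simp: w_def)
        have winj: "inj_on w Z"
        proof (rule inj_onI)
          fix a b assume ab: "a \<in> Z" "b \<in> Z" "w a = w b"
          have "z * a \<in> ball 0 1" "z * b \<in> ball 0 1" using zin[OF ab(1)] zin[OF ab(2)] r by auto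
          then have "z * a = z * b" using inj_onD[OF inj, of "z * a" "z * b"] ab(3) by (simp add: w_def)
          then show "a = b" using z r by auto
        qed
        have D0: "D > 0" unfolding D_def
          by (intro prod_pos) (metis DiffD1 m(1) order_less_le_trans wm)
        have "pair_prod w Z * pair_prod (\<lambda>a. - w a) Z 
            \<le> (fact N * C ^ N)\<^sup>2 * (\<Prod>a\<in>Z. \<Prod>b\<in>Z. norm (w a - (- w b)))\<^sup>2"
        proof (rule cauchy_product_bound)
          show "inj_on (\<lambda>a. - w a) Z" using winj by (auto simp: inj_on_def)
          show "1 \<le> C * norm (w a - (- w b))" if "a \<in> Z" "b \<in> Z" for a b
            using wm[OF that] m by (simp add: C_def)
        qed (use fin card CB in auto)
        moreover have "pair_prod (\<lambda>a. - w a) Z = pair_prod w Z"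
          unfolding pair_prod_def by (intro prod.cong refl) (metis minus_diff_minus norm_minus_cancel)
        ultimately have "(pair_prod w Z)\<^sup>2 \<le> (fact N * C ^ N * (\<Prod>a\<in>Z. \<Prod>b\<in>Z. norm (w a + w b)))\<^sup>2"
          by (simp add: power2_eq_square algebra_simps)
        then have "pair_prod w Z \<le> fact N * C ^ N * (\<Prod>a\<in>Z. \<Prod>b\<in>Z. norm (w a + w b))"
          by (rule power2_le_imp_le) (use CB in \<open>auto intro!: mult_nonneg_nonneg prod_nonneg\<close>)
        also have "(\<Prod>a\<in>Z. \<Prod>b\<in>Z. norm (w a + w b)) = (\<Prod>a\<in>Z. norm (w a + w a)) * D"
          unfolding D_def prod.distrib[symmetric] by (intro prod.cong refl prod.remove fin)
        also have "(\<Prod>a\<in>Z. norm (w a + w a)) \<le> (\<Prod>a\<in>Z. 2 * M)"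
          by (intro prod_mono) (use wM in \<open>auto simp: norm_mult simp flip: mult_2\<close>)
        also have "\<dots> = (2 * M) ^ N" by (simp add: card)
        finally have pp: "pair_prod w Z \<le> fact N * B ^ N * D"
          using D0 CB by (simp add: B_def power_mult_distrib mult_ac)
        have zz: "z \<noteq> 0" using z r by auto
        have "norm (P z) = (\<Prod>a\<in>Z. \<Prod>b\<in>Z - {a}. norm (w a - w b) / (norm (a - b) * r) / norm (w a + w b))"
          unfolding P_def F_def w_def using zz z
          by (simp add: prod_norm[symmetric] norm_divide norm_mult)
        also have "\<dots> = pair_prod w Z / ((\<Prod>a\<in>Z. \<Prod>b\<in>Z - {a}. norm (a - b)) * (\<Prod>a\<in>Z. \<Prod>b\<in>Z - {a}. r)) / D"
          unfolding pair_prod_def D_def by (simp only: prod_dividef prod.distrib)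
        also have "(\<Prod>a\<in>Z. \<Prod>b\<in>Z - {a}. r) = r ^ (N * (N - 1))"
          by (simp add: fin card power_mult[symmetric] mult.commute)
        also have "(\<Prod>a\<in>Z. \<Prod>b\<in>Z - {a}. norm (a - b)) = (\<Prod>a\<in>Z. real N)"
        proof (rule prod.cong[OF refl])
          fix a assume a: "a \<in> Z"
          have "(\<Prod>b\<in>Z - {a}. norm (a - b)) = norm (\<Prod>b\<in>Z - {a}. a - b)" by (simp add: prod_norm)
          also have "\<dots> = real N"
            unfolding Z_def using roots_of_unity_differences[OF N, of a] a nZ[OF a]
            by (simp add: Z_def norm_mult norm_power)
          finally show "(\<Prod>b\<in>Z - {a}. norm (a - b)) = real N" .
        qed
        also have "(\<Prod>a\<in>Z. real N) = real N ^ N" by (simp add: card)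
        finally have "norm (P z) = pair_prod w Z / D / real N ^ N / r ^ (N * (N - 1))"
          by (simp add: field_simps)
        also have "\<dots> \<le> fact N * B ^ N / 1 / r ^ (N * (N - 1))"
        proof (intro divide_right_mono frac_le)
          show "pair_prod w Z / D \<le> fact N * B ^ N" using pp D0 by (simp add: divide_le_eq)
          show "0 \<le> fact N * B ^ N" using CB by simp
          show "1 \<le> real N ^ N" using N by (intro one_le_power) simp
        qed (use r CB in auto)
        finally show ?thesis by simp
      qed
      have "norm (P 0) \<le> fact N * B ^ N / r ^ (N * (N - 1))"
      proof (rule maximum_modulus_frontier[of P "ball 0 r"])
        show "P holomorphic_on interior (ball 0 r)"
          using Ph r by (auto intro: holomorphic_on_subset)
        show "continuous_on (closure (ball 0 r)) P"
          using holomorphic_on_imp_continuous_on[OF Ph] sub r by (auto intro: continuous_on_subset)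
        show "norm (P z) \<le> fact N * B ^ N / r ^ (N * (N - 1))" if "z \<in> frontier (ball 0 r)" for z
          using that r by (intro Pbd) (simp add: frontier_ball)
      qed (use r in auto)
      then have "(t * r) ^ (N * (N - 1)) \<le> fact N * B ^ N"
        using r unfolding P0 by (simp add: field_simps power_mult_distrib)
      also have "\<dots> \<le> real N ^ N * B ^ N"
      proof (rule mult_right_mono)
        show "fact N \<le> real N ^ N" using fact_le_power[of N, where 'a = real] by simp
      qed (use CB in auto)
      also have "\<dots> = (real N * B) ^ N" by (rule power_mult_distrib[symmetric])
      also have "(t * r) ^ (N * (N - 1)) = ((t * r) ^ (N - 1)) ^ N"
        by (metis power_mult mult.commute)
      finally show ?thesis
        using N CB power_mono_iff[of "(t * r) ^ (N - 1)" "real N * B" N] t0 r by simp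
    qed
    show "t * r \<le> 1"
    proof (rule ccontr)
      assume "\<not> ?thesis"
      then have x: "t * r > 1" by simp
      define x where "x = t * r"
      have "x > 1" using x x_def by simp
      then have "((\<lambda>n. (real n + 1) * B / x ^ n) \<longlongrightarrow> 0) sequentially" by real_asymp
      then have "eventually (\<lambda>n. (real n + 1) * B / x ^ n < 1) sequentially"
        by (rule order_tendstoD) simp
      then obtain n where "(real n + 1) * B / x ^ n < 1" by (auto simp: eventually_sequentially)
      then have "(real n + 1) * B < x ^ n" using \<open>x > 1\<close> by (simp add: field_simps)
      with bd[of "Suc n"] show False by (simp add: x_def algebra_simps)
    qed
  qed
  have "t \<le> 1"
  proof (rule tendsto_upperbound)
    show "((\<lambda>r. t * r) \<longlongrightarrow> t) (at_left 1)" by (auto intro!: tendsto_eq_intros)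
    show "\<forall>\<^sub>F r in at_left 1. t * r \<le> 1"
      by (rule eventually_mono[OF eventually_at_left_real[of 0 "1::real"]]) (use main in auto)
  qed auto
  then show ?thesis using k0 by (simp add: t_def divide_le_eq)
qed

lemma koebe_nonvanishing:
  assumes holo: "h holomorphic_on ball 0 1" and inj: "inj_on h (ball 0 1)"
    and nz: "\<And>z. z \<in> ball 0 1 \<Longrightarrow> h z \<noteq> 0"
  shows "norm (deriv h 0) \<le> 4 * norm (h 0)"
proof -
  obtain k where k: "k holomorphic_on ball 0 1" "\<And>z. z \<in> ball 0 1 \<Longrightarrow> h z = (k z)\<^sup>2"
    using contractible_imp_holomorphic_sqrt[OF holo _ nz] by (metis convex_ball convex_imp_contractible)
  have kinj: "inj_on k (ball 0 1)"
    using inj k(2) by (metis (no_types, lifting) inj_on_def)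
  have kk: "k z + k w \<noteq> 0" if z: "z \<in> ball 0 1" and w: "w \<in> ball 0 1" for z w
  proof
    assume "k z + k w = 0"
    then have *: "k z = - k w" by (simp add: eq_neg_iff_add_eq_0)
    then have "h z = h w" using k(2) z w by simp
    then have "z = w" using inj_onD[OF inj _ z w] by simp
    then have "k z = 0" using * by simp
    then show False using nz[OF z] k(2)[OF z] by simp
  qed
  have "norm (deriv k 0) \<le> 2 * norm (k 0)"
    by (rule koebe_antipodal[OF k(1) kinj kk])
  moreover have "deriv h 0 = 2 * k 0 * deriv k 0"
  proof -
    have "(k has_field_derivative deriv k 0) (at 0)" by (rule holomorphic_derivI[OF k(1)]) auto
    then have "((\<lambda>z. (k z)\<^sup>2) has_field_derivative 2 * k 0 * deriv k 0) (at 0)"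
      by (auto intro!: derivative_eq_intros)
    then have "(h has_field_derivative 2 * k 0 * deriv k 0) (at 0)"
      by (rule has_field_derivative_transform_within_open[where S = "ball 0 1"]) (use k(2) in auto)
    then show ?thesis by (rule DERIV_imp_deriv)
  qed
  moreover have "h 0 = (k 0)\<^sup>2" using k(2)[of 0] by simp
  ultimately show ?thesis
    using mult_left_mono[of "norm (deriv k 0)" "2 * norm (k 0)" "norm (k 0)"]
    by (simp add: norm_mult power2_eq_square mult_ac)
qed

lemma univalent_compose:
  assumes "h holomorphic_on S" "inj_on h S" "T holomorphic_on D" "inj_on T D" "\<And>z. z \<in> D \<Longrightarrow> T z \<in> S"
  shows "(\<lambda>z. h (T z)) holomorphic_on D" "inj_on (\<lambda>z. h (T z)) D"
proof -
  show "(\<lambda>z. h (T z)) holomorphic_on D"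
    by (rule holomorphic_on_compose_gen[OF assms(3,1), unfolded o_def]) (use assms(5) in auto)
  show "inj_on (\<lambda>z. h (T z)) D"
    by (rule comp_inj_on[OF assms(4), unfolded o_def]) (use assms(2,5) in \<open>auto intro: inj_on_subset\<close>)
qed

text \<open>Koebe's theorem needs a function without zeros, so \<open>h - h(0)\<close> is restricted to the disc slit along the
radius opposite to the direction of \<open>u\<close>. The conformal map \<open>q\<close> onto this slit disc turns the Koebe
function into another extremal function of the quarter theorem, so that nothing is lost.\<close>
lemma koebe_slit:
  assumes holo: "h holomorphic_on ball 0 1" and inj: "inj_on h (ball 0 1)"
    and x: "0 < x" "x < 1" and u: "norm u = 1"
  shows "norm (deriv h (u * of_real x)) * (x * (1 - x)) \<le> norm (h (u * of_real x) - h 0) * (1 + x)"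
proof -
  \<comment> \<open>With the Koebe function \<open>K(z) = z/(1 - z)\<^sup>2\<close> the map is given by \<open>K(q) = K(x) v\<^sup>2\<close>, where \<open>v\<close> maps the
disc onto the right half plane; \<open>s\<close> is the square root that solves this quadratic equation for \<open>q\<close>.\<close>
  define c where "c = x / (1 - x)\<^sup>2"
  have c: "c > 0" using x by (simp add: c_def)
  define v where "v z = (1 + z) / (1 - z)" for z :: complex
  define s where "s z = csqrt (1 + 4 * of_real c * (v z)\<^sup>2)" for z
  define q where "q z = (s z - 1) / (s z + 1)" for z
  have n1: "1 - z \<noteq> 0" if "z \<in> ball 0 1" for z :: complex using that by auto
  have Rev: "Re (v z) > 0" if "z \<in> ball 0 1" for z
  proof -
    have "Re (v z) = (1 - (norm z)\<^sup>2) / (norm (1 - z))\<^sup>2"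
      unfolding v_def Re_divide cmod_power2 by (simp add: power2_eq_square algebra_simps)
    moreover have "(norm z)\<^sup>2 < 1" using that by (simp add: power_less_one_iff abs_square_less_1)
    ultimately show ?thesis using n1[OF that] by simp
  qed
  have np: "1 + 4 * of_real c * (v z)\<^sup>2 \<notin> \<real>\<^sub>\<le>\<^sub>0" if z: "z \<in> ball 0 1" for z
  proof
    assume "1 + 4 * of_real c * (v z)\<^sup>2 \<in> \<real>\<^sub>\<le>\<^sub>0"
    then have *: "Im (1 + 4 * of_real c * (v z)\<^sup>2) = 0" "Re (1 + 4 * of_real c * (v z)\<^sup>2) \<le> 0"
      by (auto simp: complex_nonpos_Reals_iff)
    then have "Im (v z) = 0" using c Rev[OF z] by (simp add: power2_eq_square)
    moreover have "Re (1 + 4 * of_real c * (v z)\<^sup>2) = 1 + 4 * c * ((Re (v z))\<^sup>2 - (Im (v z))\<^sup>2)"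
      by (simp add: power2_eq_square)
    ultimately have "1 + 4 * c * (Re (v z))\<^sup>2 \<le> 0" using * by simp
    moreover have "4 * c * (Re (v z))\<^sup>2 \<ge> 0" using c by simp
    ultimately show False by linarith
  qed
  have Res: "Re (s z) > 0" if "z \<in> ball 0 1" for z
  proof -
    have "Re (s z) \<noteq> 0"
    proof
      assume "Re (s z) = 0"
      then have "Im ((s z)\<^sup>2) = 0" "Re ((s z)\<^sup>2) \<le> 0" by (auto simp: power2_eq_square)
      then have "(s z)\<^sup>2 \<in> \<real>\<^sub>\<le>\<^sub>0" by (simp add: complex_nonpos_Reals_iff)
      then show False using np[OF that] by (simp add: s_def)
    qed
    then show ?thesis using Re_csqrt[of "1 + 4 * of_real c * (v z)\<^sup>2"] by (simp add: s_def)
  qed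
  have s1: "s z + 1 \<noteq> 0" if "z \<in> ball 0 1" for z
    using Res[OF that] by (auto simp: complex_eq_iff)
  have s2: "(s z)\<^sup>2 = 1 + 4 * of_real c * (v z)\<^sup>2" for z by (simp add: s_def)
  have q0: "q z \<noteq> 0" if z: "z \<in> ball 0 1" for z
  proof
    assume "q z = 0"
    then have "s z = 1" using s1[OF z] by (simp add: q_def)
    then have "v z = 0" using s2[of z] c by simp
    then show False using Rev[OF z] by simp
  qed
  have qb: "q z \<in> ball 0 1" if z: "z \<in> ball 0 1" for z
  proof -
    have "(norm (s z - 1))\<^sup>2 < (norm (s z + 1))\<^sup>2"
      unfolding cmod_power2 using Res[OF z] by (simp add: power2_eq_square algebra_simps)
    then have "norm (s z - 1) < norm (s z + 1)" by (rule power2_less_imp_less) simp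
    then show ?thesis using s1[OF z] by (simp add: q_def norm_divide divide_less_eq)
  qed
  have vinj: "inj_on v (ball 0 1)"
  proof (rule inj_onI)
    fix z w assume "z \<in> ball 0 1" "w \<in> ball 0 1" "v z = v w"
    then show "z = w" using n1[of z] n1[of w] by (simp add: v_def field_simps)
  qed
  have qinj: "inj_on q (ball 0 1)"
  proof (rule inj_onI)
    fix z w assume z: "z \<in> ball 0 1" and w: "w \<in> ball 0 1" and e: "q z = q w"
    have "s z = s w" using e s1[OF z] s1[OF w] by (simp add: q_def field_simps)
    then have "(v z)\<^sup>2 = (v w)\<^sup>2" using s2[of z] s2[of w] c by simp
    then have "v z = v w \<or> v z = - v w" by (simp add: power2_eq_iff)
    moreover have "v z \<noteq> - v w" using Rev[OF z] Rev[OF w] by (metis add.inverse_neutral less_asym neg_less_iff_less uminus_complex.sel(1))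
    ultimately show "z = w" using inj_onD[OF vinj _ z w] by simp
  qed
  have qh: "q holomorphic_on ball 0 1"
    unfolding q_def s_def
    by (intro holomorphic_intros) (use n1 np s1 in \<open>auto simp: v_def s_def intro!: holomorphic_intros\<close>)
  have S: "s 0 = of_real ((1 + x) / (1 - x))"
  proof -
    have "1 + 4 * c = ((1 - x)\<^sup>2 + 4 * x) / (1 - x)\<^sup>2"
      using x by (simp add: c_def add_divide_distrib)
    also have "(1 - x)\<^sup>2 + 4 * x = (1 + x)\<^sup>2" by (simp add: power2_eq_square algebra_simps)
    finally have "1 + 4 * c = ((1 + x) / (1 - x))\<^sup>2" by (simp add: power_divide)
    moreover have "1 + 4 * of_real c * (v 0)\<^sup>2 = of_real (1 + 4 * c)" by (simp add: v_def)
    ultimately have "1 + 4 * of_real c * (v 0)\<^sup>2 = of_real (((1 + x) / (1 - x))\<^sup>2)" by (simp only:)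
    then have "s 0 = csqrt (of_real (((1 + x) / (1 - x))\<^sup>2))" by (simp only: s_def)
    also have "\<dots> = of_real (sqrt (((1 + x) / (1 - x))\<^sup>2))" by (rule csqrt_of_real) simp
    also have "sqrt (((1 + x) / (1 - x))\<^sup>2) = (1 + x) / (1 - x)"
      using x by (intro real_sqrt_unique) auto
    finally show ?thesis .
  qed
  have qx: "q 0 = of_real x"
  proof -
    have "q 0 = of_real (((1 + x) / (1 - x) - 1) / ((1 + x) / (1 - x) + 1))"
      unfolding q_def S by simp
    also have "((1 + x) / (1 - x) - 1) / ((1 + x) / (1 - x) + 1) = x"
      using x by (simp add: field_simps)
    finally show ?thesis .
  qed
  have q': "deriv q 0 = of_real (4 * x * (1 - x) / (1 + x))"
  proof -
    have dv: "(v has_field_derivative 2) (at 0)"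
      unfolding v_def by (auto intro!: derivative_eq_intros)
    have ds: "(s has_field_derivative (4 * of_real c * (2 * v 0 * 2)) / (2 * s 0)) (at 0)"
      unfolding s_def using np[of 0]
      by (auto intro!: derivative_eq_intros dv)
    have "(q has_field_derivative ((4 * of_real c * (2 * v 0 * 2)) / (2 * s 0) * (s 0 + 1) - (s 0 - 1) * ((4 * of_real c * (2 * v 0 * 2)) / (2 * s 0))) / (s 0 + 1)\<^sup>2) (at 0)"
      unfolding q_def using s1[of 0] by (auto intro!: derivative_eq_intros ds simp: power2_eq_square)
    also have "((4 * of_real c * (2 * v 0 * 2)) / (2 * s 0) * (s 0 + 1) - (s 0 - 1) * ((4 * of_real c * (2 * v 0 * 2)) / (2 * s 0))) / (s 0 + 1)\<^sup>2 = 
       complex_of_real (((4 * c * (2 * 1 * 2)) / (2 * ((1 + x) / (1 - x))) * ((1 + x) / (1 - x) + 1) - ((1 + x) / (1 - x) - 1) * ((4 * c * (2 * 1 * 2)) / (2 * ((1 + x) / (1 - x))))) / ((1 + x) / (1 - x) + 1)\<^sup>2)"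
      unfolding S by (simp add: v_def)
    also have "((4 * c * (2 * 1 * 2)) / (2 * ((1 + x) / (1 - x))) * ((1 + x) / (1 - x) + 1) - ((1 + x) / (1 - x) - 1) * ((4 * c * (2 * 1 * 2)) / (2 * ((1 + x) / (1 - x))))) / ((1 + x) / (1 - x) + 1)\<^sup>2 = 4 * x * (1 - x) / (1 + x)"
    proof -
      have e: "(1 + x) / (1 - x) + 1 = 2 / (1 - x)" "(1 + x) / (1 - x) - 1 = 2 * x / (1 - x)"
        using x by (simp_all add: field_simps)
      show ?thesis unfolding e c_def using x
        by (simp add: divide_simps power2_eq_square) (simp add: algebra_simps)
    qed
    finally show ?thesis by (rule DERIV_imp_deriv)
  qed
  have uq: "u * q z \<in> ball 0 1" if "z \<in> ball 0 1" for z using qb[OF that] u by (simp add: norm_mult)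
  define k where "k z = h (u * q z) - h 0" for z
  have uqi: "inj_on (\<lambda>z. u * q z) (ball 0 1)" using qinj u by (auto simp: inj_on_def)
  note hq = univalent_compose[OF holo inj holomorphic_on_mult[OF holomorphic_on_const qh] uqi uq]
  have "norm (deriv k 0) \<le> 4 * norm (k 0)"
  proof (rule koebe_nonvanishing)
    show "k holomorphic_on ball 0 1" unfolding k_def by (intro holomorphic_intros hq)
    show "inj_on k (ball 0 1)" using hq(2) by (simp add: k_def inj_on_def)
    show "k z \<noteq> 0" if z: "z \<in> ball 0 1" for z
    proof
      assume "k z = 0"
      then have "u * q z = 0" using inj_onD[OF inj _ uq[OF z], of 0] by (simp add: k_def)
      then show False using u q0[OF z] by auto
    qed
  qed
  moreover have "deriv k 0 = deriv h (u * of_real x) * (u * of_real (4 * x * (1 - x) / (1 + x)))"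
  proof -
    have dh: "(h has_field_derivative deriv h (u * q 0)) (at (u * q 0))"
      by (rule holomorphic_derivI[OF holo]) (use uq[of 0] in auto)
    have dq: "(q has_field_derivative deriv q 0) (at 0)"
      by (rule holomorphic_derivI[OF qh]) auto
    have "((\<lambda>z. h (u * q z)) has_field_derivative deriv h (u * q 0) * (u * deriv q 0)) (at 0)"
      by (rule DERIV_chain2[where f = h and g = "\<lambda>z. u * q z", OF dh]) (auto intro!: derivative_eq_intros dq)
    then have "(k has_field_derivative deriv h (u * q 0) * (u * deriv q 0)) (at 0)"
      unfolding k_def by (auto intro!: derivative_eq_intros)
    then show ?thesis by (simp add: DERIV_imp_deriv qx q')
  qed
  ultimately have "norm (deriv h (u * of_real x)) * (4 * x * (1 - x) / (1 + x)) \<le> 4 * norm (h (u * of_real x) - h 0)"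
    using u x by (simp add: norm_mult k_def qx norm_divide del: of_real_mult of_real_divide)
  then show ?thesis using x by (simp add: field_simps)
qed

text \<open>To first order in \<open>x\<close> the inequality of the preceding lemma says that the real part of \<open>u h''(0)/(2 h'(0))\<close>
is at most 2, and \<open>u\<close> can be chosen to make this number positive.\<close>
lemma bieberbach_second_coefficient:
  assumes holo: "h holomorphic_on ball 0 1" and inj: "inj_on h (ball 0 1)"
  shows "norm (deriv (deriv h) 0) \<le> 4 * norm (deriv h 0)"
proof -
  let ?B = "ball (0::complex) 1"
  define a where "a = deriv h 0"
  define b where "b = deriv (deriv h) 0"
  have a0: "a \<noteq> 0" unfolding a_def
    by (rule holomorphic_injective_imp_regular[OF holo _ inj]) auto
  define k where "k z = (if z = 0 then deriv h 0 else (h z - h 0) / (z - 0))" for z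
  have kh: "k holomorphic_on ?B" unfolding k_def by (rule pole_lemma[OF holo]) auto
  have hk: "h z = h 0 + z * k z" for z by (simp add: k_def)
  have dk: "(k has_field_derivative deriv k z) (at z)" if "z \<in> ?B" for z
    by (rule holomorphic_derivI[OF kh]) (use that in auto)
  have dh: "deriv h z = k z + z * deriv k z" if "z \<in> ?B" for z
  proof -
    have "((\<lambda>z. h 0 + z * k z) has_field_derivative k z + z * deriv k z) (at z)"
      by (auto intro!: derivative_eq_intros dk that)
    then show ?thesis using hk by (metis DERIV_imp_deriv ext)
  qed
  have k'h: "deriv k holomorphic_on ?B" by (intro holomorphic_deriv kh) auto
  have d2: "(deriv h has_field_derivative 2 * deriv k 0) (at 0)"
  proof -
    have "(deriv k has_field_derivative deriv (deriv k) 0) (at 0)"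
      by (rule holomorphic_derivI[OF k'h]) auto
    then have "((\<lambda>z. k z + z * deriv k z) has_field_derivative 2 * deriv k 0) (at 0)"
      by (auto intro!: derivative_eq_intros dk)
    then show ?thesis
      by (rule has_field_derivative_transform_within_open[where S = ?B]) (use dh in auto)
  qed
  then have bk: "b = 2 * deriv k 0" unfolding b_def by (rule DERIV_imp_deriv)
  have k0: "k 0 = a" by (simp add: k_def a_def)
  have knz: "k z \<noteq> 0" if "z \<in> ?B" for z
    using inj_onD[OF inj _ that, of 0] a0 by (auto simp: k_def a_def)
  show ?thesis
  proof (cases "b = 0")
    case True
    then show ?thesis by (simp add: b_def)
  next
    case False
    define m where "m = norm (b / a)"
    have m: "m > 0" using False a0 by (simp add: m_def)
    define u where "u = of_real m / (b / a)"
    have u: "norm u = 1" using False a0 by (simp add: u_def m_def norm_divide norm_mult)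
    have um: "u * (b / a) = of_real m" using False a0 by (simp add: u_def)
    define \<psi> where "\<psi> t = Re (deriv h (u * of_real t) / k (u * of_real t)) - (1 + t) / (1 - t)" for t :: real
    have R: "((\<lambda>z. deriv h (u * z) / k (u * z)) has_field_derivative of_real (m / 2)) (at 0)"
    proof -
      have A: "((\<lambda>z. deriv h (u * z)) has_field_derivative b * u) (at 0)"
        using DERIV_chain2[of "deriv h" b "\<lambda>z. u * z" 0 u UNIV] d2 bk
        by (auto intro!: derivative_eq_intros)
      have B: "((\<lambda>z. k (u * z)) has_field_derivative deriv k 0 * u) (at 0)"
        using DERIV_chain2[of k "deriv k 0" "\<lambda>z. u * z" 0 u UNIV] dk[of 0]
        by (auto intro!: derivative_eq_intros)
      have "((\<lambda>z. deriv h (u * z) / k (u * z)) has_field_derivative (b * u * k (u * 0) - deriv h (u * 0) * (deriv k 0 * u)) / (k (u * 0) * k (u * 0))) (at 0)"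
        by (rule DERIV_divide[OF A B]) (use k0 a0 in simp)
      also have "(b * u * k (u * 0) - deriv h (u * 0) * (deriv k 0 * u)) / (k (u * 0) * k (u * 0)) = of_real (m / 2)"
        using um a0 by (simp add: k0 flip: a_def) (simp add: bk field_simps)
      finally show ?thesis .
    qed
    have D: "(\<psi> has_field_derivative (m / 2 - 2)) (at 0)"
    proof -
      have "((\<lambda>t. deriv h (u * of_real t) / k (u * of_real t)) has_vector_derivative of_real (m / 2)) (at 0)"
        using has_vector_derivative_real_field[of "\<lambda>z. deriv h (u * z) / k (u * z)" "of_real (m/2)" 0] R by simp
      then have "((\<lambda>t. Re (deriv h (u * of_real t) / k (u * of_real t))) has_real_derivative m / 2) (at 0)"
        using has_vector_derivative_complex_iff by (auto simp: has_real_derivative_iff_has_vector_derivative)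
      then have "(\<psi> has_real_derivative m / 2 - ((0 + 1) * (1 - 0) - (1 + 0) * (0 - 1)) / ((1 - 0) * (1 - 0))) (at 0)"
        unfolding \<psi>_def by (intro DERIV_diff DERIV_divide DERIV_add DERIV_const DERIV_ident) auto
      then show ?thesis by simp
    qed
    have "m / 2 - 2 \<le> 0"
    proof (rule ccontr)
      assume "\<not> ?thesis"
      then obtain d where d: "d > 0" "\<And>t. 0 < t \<Longrightarrow> t < d \<Longrightarrow> \<psi> 0 < \<psi> (0 + t)"
        using DERIV_pos_inc_right[OF D] by (meson not_le)
      define t where "t = min (d / 2) (1 / 2)"
      have t: "0 < t" "t < d" "t < 1" using d by (auto simp: t_def min_def)
      have "norm (u * of_real t) < 1" using u t by (simp add: norm_mult)
      then have ub: "u * of_real t \<in> ?B" by simp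
      have "h (u * of_real t) - h 0 = u * of_real t * k (u * of_real t)" using hk[of "u * of_real t"] by simp
      then have "norm (deriv h (u * of_real t)) * (t * (1 - t)) \<le> t * norm (k (u * of_real t)) * (1 + t)"
        using koebe_slit[OF holo inj t(1) t(3) u] u t by (simp add: norm_mult)
      then have "t * (norm (deriv h (u * of_real t)) * (1 - t)) \<le> t * (norm (k (u * of_real t)) * (1 + t))"
        by (simp only: mult_ac)
      then have "norm (deriv h (u * of_real t)) * (1 - t) \<le> norm (k (u * of_real t)) * (1 + t)"
        using t by (simp only: mult_le_cancel_left_pos)
      then have "norm (deriv h (u * of_real t) / k (u * of_real t)) \<le> (1 + t) / (1 - t)"
        using t knz[OF ub] by (simp add: norm_divide field_simps)
      then have "\<psi> t \<le> 0" unfolding \<psi>_def using complex_Re_le_cmod order_trans by fastforce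
      moreover have "\<psi> 0 = 0" using a0 by (simp add: \<psi>_def k0 flip: a_def)
      ultimately show False using d(2)[OF t(1,2)] by simp
    qed
    then show ?thesis using a0 by (simp add: m_def norm_divide field_simps a_def b_def)
  qed
qed

section \<open>Distortion of univalent functions\<close>
definition disc_shift :: "complex \<Rightarrow> complex \<Rightarrow> complex" where
  "disc_shift a z = (z + a) / (1 + cnj a * z)"

lemma disc_shift_denominator:
  assumes "norm a < 1" "norm z \<le> 1"
  shows "1 + cnj a * z \<noteq> 0"
proof
  assume "1 + cnj a * z = 0"
  then have "cnj a * z = - 1" by (simp only: add_eq_0_iff)
  then have "norm (cnj a * z) = 1" by (simp only: norm_minus_cancel norm_one)
  moreover have "norm a * norm z \<le> norm a * 1" using assms by (intro mult_left_mono) auto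
  ultimately show False using assms by (simp add: norm_mult)
qed

lemma disc_shift_moebius: "disc_shift a z = Moebius_function 0 (- a) z"
  by (simp add: disc_shift_def Moebius_function_simple)

lemma disc_shift_univalent:
  assumes a: "norm a < 1"
  shows "disc_shift a holomorphic_on ball 0 1" "inj_on (disc_shift a) (ball 0 1)"
    and "\<And>z. z \<in> ball 0 1 \<Longrightarrow> disc_shift a z \<in> ball 0 1"
proof -
  show "disc_shift a holomorphic_on ball 0 1"
    unfolding disc_shift_def by (intro holomorphic_intros disc_shift_denominator) (use a in auto)
  show "inj_on (disc_shift a) (ball 0 1)"
    by (rule inj_on_inverseI[where g = "Moebius_function 0 a"])
       (use a Moebius_function_compose[of a "- a"] in \<open>auto simp: disc_shift_moebius\<close>)
  show "disc_shift a z \<in> ball 0 1" if "z \<in> ball 0 1" for z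
    using Moebius_function_norm_lt_1[of "- a" z 0] a that by (simp add: disc_shift_moebius)
qed

text \<open>Bieberbach's inequality transported from 0 to \<open>z\<close> by a Moebius automorphism. In terms of a logarithm
\<open>L\<close> of the derivative it becomes a bound for \<open>L'\<close>, which integrates to the distortion theorem and
to bounds for the rotation.\<close>
lemma univalent_log_deriv:
  assumes holo: "h holomorphic_on ball 0 1" and inj: "inj_on h (ball 0 1)"
  obtains L :: "complex \<Rightarrow> complex" where "L holomorphic_on ball 0 1"
    and "\<And>z. z \<in> ball 0 1 \<Longrightarrow> deriv h z = exp (L z)"
    and "\<And>z. z \<in> ball 0 1 \<Longrightarrow> norm (of_real (1 - (norm z)\<^sup>2) * deriv L z - 2 * cnj z) \<le> 4"
proof -
  let ?B = "ball (0::complex) 1"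
  have h'h: "deriv h holomorphic_on ?B" by (intro holomorphic_deriv holo) auto
  have nz: "deriv h z \<noteq> 0" if "z \<in> ?B" for z
    by (rule holomorphic_injective_imp_regular[OF holo _ inj that]) auto
  obtain L where L: "L holomorphic_on ?B" "\<And>z. z \<in> ?B \<Longrightarrow> deriv h z = exp (L z)"
    using contractible_imp_holomorphic_log[OF h'h _ nz] by (metis convex_ball convex_imp_contractible)
  show ?thesis
  proof (rule that[OF L])
    fix a assume a: "a \<in> ?B"
    have na: "norm a < 1" using a by simp
    define T where "T = disc_shift a"
    have den: "1 + cnj a * z \<noteq> 0" if "z \<in> ?B" for z
      using disc_shift_denominator[OF na, of z] that by simp
    note T = disc_shift_univalent[OF na, folded T_def]
    have Tb: "T z \<in> ?B" if "z \<in> ?B" for z by (rule T(3)[OF that])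
    define k where "k z = h (T z)" for z
    note k = univalent_compose[OF holo inj T, folded k_def]
    define \<delta> where "\<delta> = complex_of_real (1 - (norm a)\<^sup>2)"
    have \<delta>: "\<delta> = 1 - cnj a * a" by (simp add: \<delta>_def complex_norm_square mult.commute flip: of_real_power)
    have \<delta>0: "\<delta> \<noteq> 0" 
    proof -
      have "(norm a)\<^sup>2 < 1" using na by (simp add: power_less_one_iff abs_square_less_1)
      then show ?thesis unfolding \<delta>_def of_real_eq_0_iff by simp
    qed
    have dT: "(T has_field_derivative \<delta> / (1 + cnj a * z)\<^sup>2) (at z)" if "z \<in> ?B" for z
      unfolding T_def disc_shift_def[abs_def] \<delta> using den[OF that]
      by (auto intro!: derivative_eq_intros simp: power2_eq_square field_simps)
    have dh: "(h has_field_derivative deriv h z) (at z)" if "z \<in> ?B" for z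
      by (rule holomorphic_derivI[OF holo]) (use that in auto)
    have dh': "(deriv h has_field_derivative deriv (deriv h) z) (at z)" if "z \<in> ?B" for z
      by (rule holomorphic_derivI[OF h'h]) (use that in auto)
    have dk: "deriv k z = deriv h (T z) * (\<delta> / (1 + cnj a * z)\<^sup>2)" if "z \<in> ?B" for z
      unfolding k_def using DERIV_chain2[where f = h and g = T, OF dh[OF Tb[OF that]] dT[OF that]] by (rule DERIV_imp_deriv)
    have T0: "T 0 = a" by (simp add: T_def disc_shift_def)
    have 00: "(0::complex) \<in> ?B" by simp
    have dk2: "deriv (deriv k) 0 = deriv (deriv h) a * \<delta>\<^sup>2 - 2 * cnj a * \<delta> * deriv h a"
    proof -
      have A: "((\<lambda>z. deriv h (T z)) has_field_derivative deriv (deriv h) a * \<delta>) (at 0)"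
        using DERIV_chain2[where f = "deriv h" and g = T, OF dh'[OF Tb[OF 00]] dT[OF 00]] by (simp add: T0)
      have "((\<lambda>z. \<delta> / (1 + cnj a * z)\<^sup>2) has_field_derivative - 2 * cnj a * \<delta>) (at 0)"
        by (auto intro!: derivative_eq_intros)
      from DERIV_mult[OF A this] have "((\<lambda>z. deriv h (T z) * (\<delta> / (1 + cnj a * z)\<^sup>2)) has_field_derivative
          deriv (deriv h) a * \<delta>\<^sup>2 - 2 * cnj a * \<delta> * deriv h a) (at 0)"
        by (simp add: T0 power2_eq_square algebra_simps)
      then have "(deriv k has_field_derivative deriv (deriv h) a * \<delta>\<^sup>2 - 2 * cnj a * \<delta> * deriv h a) (at 0)"
        by (rule has_field_derivative_transform_within_open[where S = ?B]) (use dk in auto)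
      then show ?thesis by (rule DERIV_imp_deriv)
    qed
    have dk1: "deriv k 0 = deriv h a * \<delta>" using dk[OF 00] by (simp add: T0)
    have d2L: "deriv (deriv h) a = deriv L a * deriv h a"
    proof -
      have "(L has_field_derivative deriv L a) (at a)" by (rule holomorphic_derivI[OF L(1)]) (use a in auto)
      then have "((\<lambda>z. exp (L z)) has_field_derivative exp (L a) * deriv L a) (at a)"
        by (auto intro!: derivative_eq_intros)
      then have "(deriv h has_field_derivative exp (L a) * deriv L a) (at a)"
        by (rule has_field_derivative_transform_within_open[where S = ?B]) (use L(2) a in auto)
      then show ?thesis using L(2)[OF a] by (simp add: DERIV_imp_deriv mult.commute)
    qed
    have "norm (deriv (deriv k) 0) \<le> 4 * norm (deriv k 0)"
      by (rule bieberbach_second_coefficient[OF k])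
    moreover have "deriv (deriv k) 0 = (\<delta> * deriv L a - 2 * cnj a) * (\<delta> * deriv h a)"
      unfolding dk2 d2L by (simp add: algebra_simps power2_eq_square)
    ultimately have "norm (\<delta> * deriv L a - 2 * cnj a) * norm (\<delta> * deriv h a) \<le> 4 * norm (\<delta> * deriv h a)"
      by (simp add: dk1 norm_mult mult_ac)
    moreover have "norm (\<delta> * deriv h a) > 0" using nz[OF a] \<delta>0 by simp
    ultimately have "norm (\<delta> * deriv L a - 2 * cnj a) \<le> 4"
      using mult_le_cancel_right_pos by blast
    then show "norm (of_real (1 - (norm a)\<^sup>2) * deriv L a - 2 * cnj a) \<le> 4"
      by (simp add: \<delta>_def)
  qed
qed

lemma complex_real_line_derivative:
  assumes "(f has_field_derivative D) (at (of_real t))"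
  shows "((\<lambda>t. Re (f (of_real t))) has_real_derivative Re D) (at t)"
  using has_vector_derivative_real_field[OF assms] has_vector_derivative_complex_iff
  by (auto simp: has_real_derivative_iff_has_vector_derivative)

lemma exp_3_ln: "exp (3 * ln y) = y ^ 3" if "(y::real) > 0"
  using that powr_realpow[of y 3] by (simp add: powr_def)

text \<open>Both bounds integrate the estimate of \<open>Re L'\<close> along the radius. The first one is applied to move the base point
of an estimate towards a boundary arc; of the second one only the polynomial growth in \<open>1/(1 - x)\<close> matters.\<close>
lemma distortion_radius:
  assumes holo: "h holomorphic_on ball 0 1" and inj: "inj_on h (ball 0 1)" and x: "0 \<le> x" "x < 1"
  shows "norm (deriv h 0) \<le> norm (deriv h (of_real x)) * ((1 + x) ^ 3 / (1 - x))"
    and "norm (deriv h (of_real x)) \<le> norm (deriv h 0) * (2 / (1 - x) ^ 3)"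
proof -
  let ?B = "ball (0::complex) 1"
  obtain L where L: "L holomorphic_on ?B" "\<And>z. z \<in> ?B \<Longrightarrow> deriv h z = exp (L z)"
    "\<And>z. z \<in> ?B \<Longrightarrow> norm (of_real (1 - (norm z)\<^sup>2) * deriv L z - 2 * cnj z) \<le> 4"
    using univalent_log_deriv[OF holo inj] by blast
  define lr where "lr t = Re (L (of_real t))" for t :: real
  have dL: "(lr has_real_derivative Re (deriv L (of_real t))) (at t)" if "0 \<le> t" "t < 1" for t
    unfolding lr_def by (rule complex_real_line_derivative, rule holomorphic_derivI[OF L(1)]) (use that in auto)
  have bd: "2 * t - 4 \<le> (1 - t\<^sup>2) * Re (deriv L (of_real t))" "(1 - t\<^sup>2) * Re (deriv L (of_real t)) \<le> 2 * t + 4"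
    if t: "0 \<le> t" "t < 1" for t
  proof -
    have "norm (of_real (1 - (norm (complex_of_real t))\<^sup>2) * deriv L (of_real t) - 2 * cnj (of_real t)) \<le> 4"
      by (rule L(3)) (use t in auto)
    then have "\<bar>Re (of_real (1 - (norm (complex_of_real t))\<^sup>2) * deriv L (of_real t) - 2 * cnj (of_real t))\<bar> \<le> 4"
      using abs_Re_le_cmod order_trans by blast
    moreover have "Re (of_real (1 - (norm (complex_of_real t))\<^sup>2) * deriv L (of_real t) - 2 * cnj (of_real t)) = (1 - t\<^sup>2) * Re (deriv L (of_real t)) - 2 * t"
      using t by (simp flip: of_real_power of_real_diff add: algebra_simps)
    ultimately show "2 * t - 4 \<le> (1 - t\<^sup>2) * Re (deriv L (of_real t))" "(1 - t\<^sup>2) * Re (deriv L (of_real t)) \<le> 2 * t + 4"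
      by linarith+
  qed
  have nL: "norm (deriv h (of_real t)) = exp (lr t)" if "0 \<le> t" "t < 1" for t
    using L(2)[of "of_real t"] that by (simp add: lr_def)
  define \<phi> where "\<phi> t = lr t + 3 * ln (1 + t) - ln (1 - t)" for t :: real
  define \<psi> where "\<psi> t = lr t - ln (1 + t) + 3 * ln (1 - t)" for t :: real
  have "\<phi> 0 \<le> \<phi> x"
  proof (rule DERIV_nonneg_imp_nondecreasing[OF x(1)])
    fix t assume t: "0 \<le> t" "t \<le> x"
    then have t1: "t < 1" using x by simp
    have sq: "1 - t\<^sup>2 > 0" using t t1 by (simp add: power_less_one_iff abs_square_less_1)
    have "(\<phi> has_real_derivative Re (deriv L (of_real t)) + 3 / (1 + t) + 1 / (1 - t)) (at t)"
      unfolding \<phi>_def using t t1 by (auto intro!: derivative_eq_intros dL)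
    moreover have "Re (deriv L (of_real t)) + 3 / (1 + t) + 1 / (1 - t) \<ge> 0"
    proof -
      have "3 / (1 + t) + 1 / (1 - t) = (4 - 2 * t) / (1 - t\<^sup>2)"
        using t t1 by (simp add: field_simps power2_eq_square)
      moreover have "Re (deriv L (of_real t)) \<ge> (2 * t - 4) / (1 - t\<^sup>2)"
        using bd(1)[OF t(1) t1] sq by (simp add: field_simps)
      moreover have "(2 * t - 4) / (1 - t\<^sup>2) = - ((4 - 2 * t) / (1 - t\<^sup>2))" by (simp add: minus_divide_left)
      ultimately show ?thesis by linarith
    qed
    ultimately show "\<exists>y. (\<phi> has_real_derivative y) (at t) \<and> 0 \<le> y" by blast
  qed
  then have "exp (\<phi> 0) \<le> exp (\<phi> x)" by simp
  then show "norm (deriv h 0) \<le> norm (deriv h (of_real x)) * ((1 + x) ^ 3 / (1 - x))"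
    using x nL[of 0] nL[of x] by (simp add: \<phi>_def exp_add exp_diff exp_3_ln)
  have "\<psi> x \<le> \<psi> 0"
  proof (rule DERIV_nonpos_imp_nonincreasing[OF x(1)])
    fix t assume t: "0 \<le> t" "t \<le> x"
    then have t1: "t < 1" using x by simp
    have sq: "1 - t\<^sup>2 > 0" using t t1 by (simp add: power_less_one_iff abs_square_less_1)
    have "(\<psi> has_real_derivative Re (deriv L (of_real t)) - 1 / (1 + t) - 3 / (1 - t)) (at t)"
      unfolding \<psi>_def using t t1 by (auto intro!: derivative_eq_intros dL)
    moreover have "Re (deriv L (of_real t)) - 1 / (1 + t) - 3 / (1 - t) \<le> 0"
    proof -
      have "1 / (1 + t) + 3 / (1 - t) = (4 + 2 * t) / (1 - t\<^sup>2)"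
        using t t1 by (simp add: field_simps power2_eq_square)
      moreover have "Re (deriv L (of_real t)) \<le> (4 + 2 * t) / (1 - t\<^sup>2)"
        using bd(2)[OF t(1) t1] sq by (simp add: field_simps)
      ultimately show ?thesis by linarith
    qed
    ultimately show "\<exists>y. (\<psi> has_real_derivative y) (at t) \<and> y \<le> 0" by blast
  qed
  then have "exp (\<psi> x) \<le> exp (\<psi> 0)" by simp
  then have "norm (deriv h (of_real x)) * ((1 - x) ^ 3 / (1 + x)) \<le> norm (deriv h 0)"
    using x nL[of 0] nL[of x] by (simp add: \<psi>_def exp_add exp_diff exp_3_ln)
  then have "norm (deriv h (of_real x)) \<le> norm (deriv h 0) * ((1 + x) / (1 - x) ^ 3)"
    using x by (simp add: field_simps)
  also have "\<dots> \<le> norm (deriv h 0) * (2 / (1 - x) ^ 3)"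
    using x by (intro mult_left_mono divide_right_mono) auto
  finally show "norm (deriv h (of_real x)) \<le> norm (deriv h 0) * (2 / (1 - x) ^ 3)" .
qed

lemma distortion_upper:
  assumes holo: "h holomorphic_on ball 0 1" and inj: "inj_on h (ball 0 1)" and z: "norm z < 1"
  shows "norm (deriv h z) \<le> norm (deriv h 0) * (2 / (1 - norm z) ^ 3)"
proof -
  define u where "u = (if z = 0 then 1 else z / of_real (norm z))"
  have u: "norm u = 1" "z = u * of_real (norm z)" by (auto simp: u_def norm_divide)
  define k where "k w = h (u * w)" for w
  have ub: "u * w \<in> ball 0 1" if "w \<in> ball 0 1" for w using u that by (simp add: norm_mult)
  have ui: "inj_on (\<lambda>w. u * w) (ball 0 1)" using u by (auto simp: inj_on_def)
  have uh: "(\<lambda>w. u * w) holomorphic_on ball 0 1" by (intro holomorphic_intros)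
  note k = univalent_compose[OF holo inj uh ui ub, folded k_def]
  have dk: "deriv k w = deriv h (u * w) * u" if "w \<in> ball 0 1" for w
  proof -
    have "(h has_field_derivative deriv h (u * w)) (at (u * w))"
      by (rule holomorphic_derivI[OF holo]) (use ub[OF that] in auto)
    then have "(k has_field_derivative deriv h (u * w) * u) (at w)"
      unfolding k_def by (rule DERIV_chain2[where f = h and g = "\<lambda>w. u * w"]) (auto intro!: derivative_eq_intros)
    then show ?thesis by (rule DERIV_imp_deriv)
  qed
  have "norm (deriv k (of_real (norm z))) \<le> norm (deriv k 0) * (2 / (1 - norm z) ^ 3)"
    by (rule distortion_radius(2)[OF k]) (use z in auto)
  then show ?thesis using dk[of 0] dk[of "of_real (norm z)"] z u by (simp add: norm_mult)
qed

section \<open>The derivative at the centre and the image of a half circle\<close>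
lemma exp_16_5_bound: "exp (16 / 5 :: real) \<le> 628 / 25"
proof -
  have "exp (16 / 5 :: real) ^ 5 = exp 1 ^ 16"
    using exp_of_nat_mult[of 5 "16 / 5 :: real"] exp_of_nat_mult[of 16 "1 :: real"] by simp
  also have "\<dots> \<le> (272 / 100) ^ 16" using e_less_272 by (intro power_mono) auto
  also have "\<dots> \<le> (628 / 25) ^ 5" by (simp add: power_divide)
  finally show ?thesis by (rule power_le_imp_le_base[of _ 4, simplified]) auto
qed

lemma ln_2_lower: "ln 2 \<ge> (69 / 100 :: real)"
proof -
  have "exp (69 / 100 :: real) ^ 100 = exp 1 ^ 69"
    using exp_of_nat_mult[of 100 "69 / 100 :: real"] exp_of_nat_mult[of 69 "1 :: real"] by simp
  also have "\<dots> \<le> (272 / 100) ^ 69" using e_less_272 by (intro power_mono) auto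
  also have "\<dots> \<le> 2 ^ 100" by (simp add: power_divide)
  finally have "exp (69 / 100 :: real) \<le> 2" by (rule power_le_imp_le_base[of _ 99, simplified]) auto
  then show ?thesis by (metis ln_ge_iff zero_less_numeral)
qed

text \<open>An elementary substitute for the dilogarithm: the integral of \<open>(4/t) log((1 + t)/(1 - t))\<close> from 0 to 1 is
\<open>\<pi>\<^sup>2\<close>, and the primitive chosen here exceeds it only slightly, by the inequality of
\<open>ln_quotient_bound\<close>.\<close>
definition rotation_majorant :: "real \<Rightarrow> real" where
  "rotation_majorant t = 4 * (4 * t - t ^ 3 / 9 + (1 - t) * ln (1 - t) - (1 + t) * ln (1 + t))"

lemma DERIV_xlnx_plus:
  assumes "1 + t > (0::real)"
  shows "((\<lambda>t. (1 + t) * ln (1 + t)) has_real_derivative ln (1 + t) + 1) (at t)"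
  using assms by (auto intro!: derivative_eq_intros)

lemma DERIV_xlnx_minus:
  assumes "1 - t > (0::real)"
  shows "((\<lambda>t. (1 - t) * ln (1 - t)) has_real_derivative - ln (1 - t) - 1) (at t)"
  using assms by (auto intro!: derivative_eq_intros)

lemma rotation_majorant_deriv:
  assumes "0 \<le> t" "t < 1"
  shows "(rotation_majorant has_real_derivative 4 * (2 - t\<^sup>2 / 3 - ln (1 - t) - ln (1 + t))) (at t)"
  unfolding rotation_majorant_def using assms
  by (auto intro!: derivative_eq_intros DERIV_xlnx_plus DERIV_xlnx_minus simp: power2_eq_square)

lemma rotation_majorant_bound:
  assumes "0 \<le> t" "t < 1"
  shows "rotation_majorant t \<le> 10.0356"
proof -
  define g where "g t = 4 * t - t ^ 3 / 9 - (1 + t) * ln (1 + t)" for t :: real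
  have "g t \<le> g 1"
  proof (rule DERIV_nonneg_imp_nondecreasing[of t 1 g])
    fix s :: real assume s: "t \<le> s" "s \<le> 1"
    have "(g has_real_derivative 3 - s\<^sup>2 / 3 - ln (1 + s)) (at s)"
      unfolding g_def using s assms by (auto intro!: derivative_eq_intros DERIV_xlnx_plus simp: power2_eq_square)
    moreover have "ln (1 + s) \<le> 1" using ln_add_one_self_le_self[of s] s assms by simp
    moreover have "s\<^sup>2 \<le> 1" using s assms by (simp add: power_le_one)
    ultimately show "\<exists>y. (g has_real_derivative y) (at s) \<and> 0 \<le> y"
      by (intro exI[of _ "3 - s\<^sup>2 / 3 - ln (1 + s)"]) auto
  qed (use assms in simp)
  moreover have "(1 - t) * ln (1 - t) \<le> 0"
    using assms by (intro mult_nonneg_nonpos) auto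
  ultimately show ?thesis using ln_2_lower by (simp add: rotation_majorant_def g_def)
qed

text \<open>In power series: \<open>2/(2 n + 1) \<le> 1/n\<close> for the coefficients with \<open>n \<ge> 2\<close>, while those
with \<open>n \<le> 1\<close> agree.\<close>
lemma ln_quotient_bound:
  fixes t :: real
  assumes "0 < t" "t < 1"
  shows "ln (1 + t) - ln (1 - t) \<le> t * (2 - t\<^sup>2 / 3 - ln (1 - t) - ln (1 + t))"
proof -
  define f where "f t = t * (2 - t\<^sup>2 / 3 - ln (1 - t) - ln (1 + t)) - ln (1 + t) + ln (1 - t)" for t :: real
  have "f 0 \<le> f t"
  proof (rule DERIV_nonneg_imp_nondecreasing[of 0 t f])
    fix s :: real assume s: "0 \<le> s" "s \<le> t"
    have "(f has_real_derivative - s\<^sup>2 - ln (1 - s) - ln (1 + s)) (at s)"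
    proof -
      have d: "(f has_real_derivative (2 - s\<^sup>2 / 3 - ln (1 - s) - ln (1 + s)) + s * (- 2 * s / 3 + 1 / (1 - s) - 1 / (1 + s)) - 1 / (1 + s) - 1 / (1 - s)) (at s)"
        unfolding f_def using s assms by (auto intro!: derivative_eq_intros)
      have "s / (1 - s) - 1 / (1 - s) = -1"
        using s assms by (subst diff_divide_distrib[symmetric], subst divide_eq_eq) auto
      moreover have "s / (1 + s) + 1 / (1 + s) = 1"
        using s assms by (subst add_divide_distrib[symmetric], subst divide_eq_eq) auto
      ultimately have e: "(2 - s\<^sup>2 / 3 - ln (1 - s) - ln (1 + s)) + s * (- 2 * s / 3 + 1 / (1 - s) - 1 / (1 + s)) - 1 / (1 + s) - 1 / (1 - s) = - s\<^sup>2 - ln (1 - s) - ln (1 + s)"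
        by (simp add: algebra_simps power2_eq_square)
      show ?thesis using d unfolding e .
    qed
    moreover have "0 \<le> - s\<^sup>2 - ln (1 - s) - ln (1 + s)"
    proof -
      have "s\<^sup>2 < 1" using s assms by (simp add: power_less_one_iff abs_square_less_1)
      then have "ln (1 - s\<^sup>2) \<le> - s\<^sup>2" using ln_le_minus_one[of "1 - s\<^sup>2"] by simp
      moreover have "ln (1 - s\<^sup>2) = ln (1 - s) + ln (1 + s)"
        using s assms ln_mult[of "1 - s" "1 + s"] by (simp add: power2_eq_square algebra_simps)
      ultimately show ?thesis by simp
    qed
    ultimately show "\<exists>y. (f has_real_derivative y) (at s) \<and> 0 \<le> y" by blast
  qed (use assms in simp)
  then show ?thesis by (simp add: f_def)
qed

text \<open>Let \<open>A(t)\<close> be the integral of \<open>log |h'|\<close> over the right half of the circle of radius \<open>t\<close>. Its derivative is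
\<open>(Im L(i t) - Im L(-i t))/t\<close>, because the integrand of \<open>F'\<close> is exact, and the bound for
\<open>Re L'\<close> on the diameter limits this to \<open>-(4/t) log((1 + t)/(1 - t))\<close> from below. Integration
gives \<open>\<pi> log |h'(0)| \<le> A(r) + \<pi>\<^sup>2\<close> up to the loss in \<open>rotation_majorant\<close>. The exact constant
would be \<open>exp(\<pi>)/\<pi>\<close>, about 7.4; the bound 8 leaves room for rational arithmetic.\<close>
lemma half_circle_derivative_bound:
  assumes holo: "h holomorphic_on ball 0 1" and inj: "inj_on h (ball 0 1)" and r: "0 < r" "r < 1"
  shows "norm (deriv h 0) \<le> 8 * integral {-pi/2..pi/2} (\<lambda>\<theta>. norm (deriv h (of_real r * cis \<theta>)))"
proof -
  let ?B = "ball (0::complex) 1"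
  obtain L where L: "L holomorphic_on ?B" "\<And>z. z \<in> ?B \<Longrightarrow> deriv h z = exp (L z)"
    "\<And>z. z \<in> ?B \<Longrightarrow> norm (of_real (1 - (norm z)\<^sup>2) * deriv L z - 2 * cnj z) \<le> 4"
    using univalent_log_deriv[OF holo inj] by blast
  have dL: "(L has_field_derivative deriv L z) (at z)" if "z \<in> ?B" for z
    by (rule holomorphic_derivI[OF L(1)]) (use that in auto)
  have contL: "continuous_on ?B L" using L(1) by (rule holomorphic_on_imp_continuous_on)
  have contL': "continuous_on ?B (deriv L)"
    by (intro holomorphic_on_imp_continuous_on holomorphic_deriv L) auto
  have zc: "z * cis \<theta> \<in> ?B" if "z \<in> ?B" for z \<theta> using that by (simp add: norm_mult)
  define F where "F z = integral {-pi/2..pi/2} (\<lambda>\<theta>. L (z * cis \<theta>))" for z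
  define F' where "F' z = integral {-pi/2..pi/2} (\<lambda>\<theta>. deriv L (z * cis \<theta>) * cis \<theta>)" for z
  have contc: "continuous_on {-pi/2..pi/2} (\<lambda>\<theta>. L (z * cis \<theta>))" if "z \<in> ?B" for z
    by (intro continuous_on_compose2[OF contL] continuous_intros) (use zc that in auto)
  have dF: "(F has_field_derivative F' z) (at z)" if z: "z \<in> ?B" for z
  proof -
    have "((\<lambda>z. integral (cbox (-pi/2) (pi/2)) (\<lambda>\<theta>. L (z * cis \<theta>))) has_field_derivative
             integral (cbox (-pi/2) (pi/2)) (\<lambda>\<theta>. deriv L (z * cis \<theta>) * cis \<theta>)) (at z within ?B)"
    proof (rule leibniz_rule_field_derivative)
      fix x t assume x: "x \<in> ?B"
      show "((\<lambda>x. L (x * cis t)) has_field_derivative deriv L (x * cis t) * cis t) (at x within ?B)"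
        by (rule DERIV_chain2[where f = L and g = "\<lambda>x. x * cis t", OF dL])
           (use x zc in \<open>auto intro!: derivative_eq_intros\<close>)
    next
      fix x assume x: "x \<in> ?B"
      show "(\<lambda>\<theta>. L (x * cis \<theta>)) integrable_on cbox (-pi/2) (pi/2)"
        using contc[OF x] by (intro integrable_continuous) (simp add: cbox_interval)
    next
      show "continuous_on (?B \<times> cbox (-pi/2) (pi/2)) (\<lambda>(x, t). deriv L (x * cis t) * cis t)"
        unfolding split_beta
        by (intro continuous_intros continuous_on_compose2[OF contL']) (use zc in auto)
    qed (use z in auto)
    then show ?thesis using z unfolding F_def[abs_def] F'_def by (simp add: cbox_interval at_within_open[OF z])
  qed
  have F'eq: "F' z = (L (\<i> * z) - L (- \<i> * z)) / (\<i> * z)" if z: "z \<in> ?B" "z \<noteq> 0" for z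
  proof -
    have "((\<lambda>\<theta>. deriv L (z * cis \<theta>) * cis \<theta>) has_integral
        L (z * cis (pi/2)) / (\<i> * z) - L (z * cis (- pi/2)) / (\<i> * z)) {-pi/2..pi/2}"
    proof (rule fundamental_theorem_of_calculus)
      fix \<theta> :: real
      have "((\<lambda>\<theta>. L (z * cis \<theta>)) has_vector_derivative (z * (\<i> * cis \<theta>)) * deriv L (z * cis \<theta>)) (at \<theta>)"
      proof -
        have "((\<lambda>\<theta>. z * cis \<theta>) has_vector_derivative z * (\<i> * cis \<theta>)) (at \<theta>)"
          by (auto intro!: derivative_eq_intros has_vector_derivative_mult_right simp: has_vector_derivative_complex_iff)
        then show ?thesis
          using field_vector_diff_chain_at[of "\<lambda>\<theta>. z * cis \<theta>" _ \<theta> L] dL[OF zc[OF z(1)]]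
          by (auto simp: o_def)
      qed
      then have "((\<lambda>\<theta>. L (z * cis \<theta>) / (\<i> * z)) has_vector_derivative (z * (\<i> * cis \<theta>)) * deriv L (z * cis \<theta>) / (\<i> * z)) (at \<theta>)"
        by (rule has_vector_derivative_divide)
      moreover have "(z * (\<i> * cis \<theta>)) * deriv L (z * cis \<theta>) / (\<i> * z) = deriv L (z * cis \<theta>) * cis \<theta>"
        using z by (simp add: field_simps)
      ultimately show "((\<lambda>\<theta>. L (z * cis \<theta>) / (\<i> * z)) has_vector_derivative deriv L (z * cis \<theta>) * cis \<theta>) (at \<theta> within {-pi/2..pi/2})"
        by (simp only: has_vector_derivative_at_within)
    qed simp
    then show ?thesis
      by (simp add: F'_def integral_unique diff_divide_distrib cis_pi_half mult.commute)
  qed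
  have reL': "\<bar>Re (deriv L (\<i> * of_real y))\<bar> \<le> 4 / (1 - y\<^sup>2)" if y: "\<bar>y\<bar> < 1" for y
  proof -
    have sq: "1 - y\<^sup>2 > 0" using y by (simp add: abs_square_less_1)
    have ny: "(norm (\<i> * complex_of_real y))\<^sup>2 = y\<^sup>2" by (simp add: norm_mult)
    have "norm (of_real (1 - (norm (\<i> * complex_of_real y))\<^sup>2) * deriv L (\<i> * of_real y) - 2 * cnj (\<i> * of_real y)) \<le> 4"
      by (rule L(3)) (use y in \<open>simp add: norm_mult\<close>)
    then have "\<bar>Re (of_real (1 - (norm (\<i> * complex_of_real y))\<^sup>2) * deriv L (\<i> * of_real y) - 2 * cnj (\<i> * of_real y))\<bar> \<le> 4"
      using abs_Re_le_cmod order_trans by blast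
    moreover have "Re (of_real (1 - (norm (\<i> * complex_of_real y))\<^sup>2) * deriv L (\<i> * of_real y) - 2 * cnj (\<i> * of_real y)) = (1 - y\<^sup>2) * Re (deriv L (\<i> * of_real y))"
      unfolding ny by simp
    ultimately have "(1 - y\<^sup>2) * \<bar>Re (deriv L (\<i> * of_real y))\<bar> \<le> 4"
      using sq by (simp only: abs_mult abs_of_pos)
    then show ?thesis using sq by (simp add: field_simps)
  qed
  have imL: "- 4 * (ln (1 + t) - ln (1 - t)) \<le> Im (L (\<i> * of_real t)) - Im (L (- \<i> * of_real t))" if t: "0 \<le> t" "t < 1" for t
  proof -
    define m1 where "m1 y = Im (L (\<i> * of_real y))" for y
    have m1: "(m1 has_real_derivative Re (deriv L (\<i> * of_real y))) (at y)" if y: "\<bar>y\<bar> < 1" for y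
    proof -
      have "((\<lambda>z. - \<i> * L (\<i> * z)) has_field_derivative deriv L (\<i> * of_real y)) (at (of_real y))"
        using DERIV_chain2[where f = L and g = "\<lambda>z. \<i> * z", OF dL, of "of_real y" \<i>] y
        by (auto intro!: derivative_eq_intros simp: norm_mult mult.assoc)
      from complex_real_line_derivative[OF this] show ?thesis by (simp add: m1_def[abs_def])
    qed
    define m where "m y = m1 y - m1 (- y) + 4 * (ln (1 + y) - ln (1 - y))" for y
    have "m 0 \<le> m t"
    proof (rule DERIV_nonneg_imp_nondecreasing[of 0 t m])
      fix y assume y: "0 \<le> y" "y \<le> t"
      then have y1: "\<bar>y\<bar> < 1" "\<bar>- y\<bar> < 1" using t by auto
      have A: "((\<lambda>y. m1 (- y)) has_real_derivative Re (deriv L (\<i> * of_real (- y))) * (-1)) (at y)"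
        by (rule DERIV_chain2[where f = m1 and g = "\<lambda>y. - y", OF m1[OF y1(2)]])
           (auto intro!: derivative_eq_intros)
      have "(m has_real_derivative Re (deriv L (\<i> * of_real y)) - Re (deriv L (\<i> * of_real (- y))) * (-1) + 4 * (1 / (1 + y) + 1 / (1 - y))) (at y)"
        unfolding m_def using y t
        by (auto intro!: derivative_eq_intros m1[OF y1(1)] A)
      moreover have "4 * (1 / (1 + y) + 1 / (1 - y)) = 4 / (1 - y\<^sup>2) + 4 / (1 - y\<^sup>2)"
        using y t by (simp add: field_simps power2_eq_square)
      moreover have "0 \<le> Re (deriv L (\<i> * of_real y)) - Re (deriv L (\<i> * of_real (- y))) * (-1) + (4 / (1 - y\<^sup>2) + 4 / (1 - y\<^sup>2))"
        using reL'[OF y1(1)] reL'[OF y1(2)] unfolding abs_le_iff power2_minus by linarith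
      ultimately show "\<exists>d. (m has_real_derivative d) (at y) \<and> 0 \<le> d" by metis
    qed (use t in simp)
    then show ?thesis by (simp add: m_def m1_def)
  qed
  define A where "A t = Re (F (of_real t))" for t :: real
  have dA: "(A has_real_derivative Re (F' (of_real t))) (at t)" if "0 \<le> t" "t < 1" for t
    unfolding A_def by (rule complex_real_line_derivative, rule dF) (use that in auto)
  have "A 0 + rotation_majorant 0 \<le> A r + rotation_majorant r"
  proof (rule DERIV_nonneg_imp_nondecreasing[of 0 r "\<lambda>t. A t + rotation_majorant t"])
    fix t assume t: "0 \<le> t" "t \<le> r"
    then have t1: "t < 1" using r by simp
    have "Re (F' (of_real t)) + 4 * (2 - t\<^sup>2 / 3 - ln (1 - t) - ln (1 + t)) \<ge> 0"
    proof (cases "t = 0")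
      case True
      have "F' 0 = 2 * deriv L 0"
      proof -
        have "((\<lambda>\<theta>. cis \<theta>) has_integral - \<i> * cis (pi/2) - (- \<i> * cis (-pi/2))) {-pi/2..pi/2}"
        proof (rule fundamental_theorem_of_calculus)
          show "((\<lambda>\<theta>. - \<i> * cis \<theta>) has_vector_derivative cis \<theta>) (at \<theta> within {-pi/2..pi/2})" for \<theta>
            by (auto intro!: derivative_eq_intros simp: has_vector_derivative_complex_iff)
        qed simp
        then have "(cis has_integral 2) {-pi/2..pi/2}" by (simp add: cis_pi_half)
        then have "((\<lambda>\<theta>. deriv L (0 * cis \<theta>) * cis \<theta>) has_integral deriv L 0 * 2) {-pi/2..pi/2}"
          using has_integral_mult_right[of cis 2 _ "deriv L 0"] by simp
        then show ?thesis unfolding F'_def by (simp only: integral_unique mult.commute)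
      qed
      then show ?thesis using True reL'[of 0] by simp
    next
      case False
      then have tpos: "t > 0" using t by simp
      have "F' (of_real t) = (L (\<i> * of_real t) - L (- \<i> * of_real t)) / (\<i> * of_real t)"
        by (rule F'eq) (use tpos t1 in auto)
      then have "Re (F' (of_real t)) = (Im (L (\<i> * of_real t)) - Im (L (- \<i> * of_real t))) / t"
        using tpos by (simp add: Re_divide power2_eq_square)
      also have "\<dots> \<ge> (- 4 * (ln (1 + t) - ln (1 - t))) / t"
        using imL[OF t(1) t1] tpos by (intro divide_right_mono) auto
      finally have "Re (F' (of_real t)) \<ge> (- 4 * (ln (1 + t) - ln (1 - t))) / t" .
      moreover have "(ln (1 + t) - ln (1 - t)) / t \<le> 2 - t\<^sup>2 / 3 - ln (1 - t) - ln (1 + t)"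
        using ln_quotient_bound[OF tpos t1] tpos by (simp add: divide_le_eq mult.commute)
      moreover have "(- 4 * (ln (1 + t) - ln (1 - t))) / t = - 4 * ((ln (1 + t) - ln (1 - t)) / t)"
        by (rule times_divide_eq_right[symmetric])
      moreover have "0 \<le> X + 4 * Y" if "- 4 * Q \<le> X" "Q \<le> Y" for Q X Y :: real
        using that by linarith
      ultimately show ?thesis by metis
    qed
    then show "\<exists>y. ((\<lambda>t. A t + rotation_majorant t) has_real_derivative y) (at t) \<and> 0 \<le> y"
      using DERIV_add[OF dA[OF t(1) t1] rotation_majorant_deriv[OF t(1) t1]] by blast
  qed (use r in simp)
  moreover have "rotation_majorant 0 = 0" by (simp add: rotation_majorant_def)
  moreover have "A 0 = pi * Re (L 0)" by (simp add: A_def F_def)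
  ultimately have *: "pi * Re (L 0) \<le> A r + 10.0356"
    using rotation_majorant_bound[of r] r by simp
  have rb: "of_real r * cis \<theta> \<in> ?B" for \<theta> using r by (simp add: norm_mult)
  define g where "g \<theta> = norm (deriv h (of_real r * cis \<theta>))" for \<theta>
  have g: "g \<theta> = exp (Re (L (of_real r * cis \<theta>)))" for \<theta> by (simp add: g_def L(2)[OF rb])
  have contu: "continuous_on {-pi/2..pi/2} (\<lambda>\<theta>. Re (L (of_real r * cis \<theta>)))"
    by (intro continuous_intros contc) (use r in auto)
  have contg: "continuous_on {-pi/2..pi/2} g" unfolding g by (intro continuous_intros contu)
  define I where "I = integral {-pi/2..pi/2} g"
  have gint: "g integrable_on {-pi/2..pi/2}" by (rule integrable_continuous_real[OF contg])
  have Ipos: "I > 0"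
  proof -
    have "I \<ge> 0" unfolding I_def by (rule integral_nonneg[OF gint]) (simp add: g_def)
    moreover have "I \<noteq> 0"
    proof
      assume "I = 0"
      then have "(g has_integral 0) (cbox (-pi/2) (pi/2))" using gint by (simp add: I_def has_integral_integral cbox_interval)
      then have "g 0 = 0" using contg
        by (intro has_integral_0_cbox_imp_0[of "-pi/2" "pi/2" g]) (auto simp: g_def cbox_interval box_real linorder_not_le[THEN iffD2, OF pi_gt_zero])
      then show False by (simp add: g)
    qed
    ultimately show ?thesis by simp
  qed
  define m where "m = I / pi"
  have m: "m > 0" using Ipos by (simp add: m_def)
  have A_eq: "A r = integral {-pi/2..pi/2} (\<lambda>\<theta>. Re (L (of_real r * cis \<theta>)))"
  proof -
    have "(\<lambda>\<theta>. L (of_real r * cis \<theta>)) integrable_on {-pi/2..pi/2}"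
      by (intro integrable_continuous_real contc) (use r in auto)
    then show ?thesis unfolding A_def F_def
      using integral_linear[OF _ bounded_linear_Re, of "\<lambda>\<theta>. L (of_real r * cis \<theta>)" "{-pi/2..pi/2}"] by (simp add: o_def)
  qed
  also have "\<dots> \<le> integral {-pi/2..pi/2} (\<lambda>\<theta>. (ln m - 1) + g \<theta> / m)"
  proof (rule integral_le)
    show "(\<lambda>\<theta>. Re (L (of_real r * cis \<theta>))) integrable_on {-pi/2..pi/2}"
      by (rule integrable_continuous_real[OF contu])
    show "(\<lambda>\<theta>. (ln m - 1) + g \<theta> / m) integrable_on {-pi/2..pi/2}"
      by (intro integrable_continuous_real continuous_intros contg) (use m in auto)
    \<comment> \<open>The tangent of the logarithm at the mean \<open>m\<close>: this is Jensen's inequality.\<close>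
    show "Re (L (of_real r * cis \<theta>)) \<le> (ln m - 1) + g \<theta> / m" for \<theta>
    proof -
      have "g \<theta> > 0" by (simp add: g)
      then have "ln (g \<theta> / m) \<le> g \<theta> / m - 1" using m by (intro ln_le_minus_one) auto
      moreover have "ln (g \<theta> / m) = Re (L (of_real r * cis \<theta>)) - ln m"
        using m by (subst ln_divide_pos) (auto simp: g)
      ultimately show ?thesis by simp
    qed
  qed
  also have "\<dots> = pi * (ln m - 1) + I / m"
  proof -
    have "((\<lambda>\<theta>. (ln m - 1) + g \<theta> / m) has_integral (pi * (ln m - 1) + I / m)) {-pi/2..pi/2}"
      using has_integral_add[OF has_integral_const_real[of "ln m - 1" "-pi/2" "pi/2"] has_integral_divide[OF integrable_integral[OF gint], of m]]
      by (simp add: I_def)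
    then show ?thesis by (rule integral_unique)
  qed
  also have "I / m = pi" using Ipos by (simp add: m_def)
  finally have "A r \<le> pi * ln m" by (simp add: algebra_simps)
  with * have "pi * Re (L 0) \<le> pi * ln m + 10.0356" by simp
  \<comment> \<open>\<open>10.0356 \<le> 3.2 \<pi>\<close>, and below \<open>exp(3.2) \<le> 25.12 = 8 * 3.14\<close>\<close>
  also have "\<dots> \<le> pi * ln m + pi * (16 / 5)"
    using pi_approx(1) by simp
  finally have "pi * Re (L 0) \<le> pi * (ln m + 16 / 5)" by (simp add: algebra_simps)
  then have "Re (L 0) \<le> ln m + 16 / 5" by simp
  then have "exp (Re (L 0)) \<le> exp (ln m + 16 / 5)" by simp
  also have "\<dots> = m * exp (16 / 5)" using m by (simp add: exp_add)
  also have "\<dots> \<le> m * (628 / 25)" using m exp_16_5_bound by (intro mult_left_mono) auto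
  also have "\<dots> \<le> 8 * I"
    using Ipos pi_approx(1) by (simp add: m_def field_simps)
  finally have "exp (Re (L 0)) \<le> 8 * I" .
  then show ?thesis using L(2)[of 0] by (simp add: I_def g_def[abs_def])
qed

section \<open>Lengths of curves\<close>
text \<open>The polygon sums in the definition of the length of a curve, in a recursive form that suits induction on lists.\<close>
fun polygon_length :: "(real \<Rightarrow> complex) \<Rightarrow> real list \<Rightarrow> real" where
  "polygon_length \<gamma> (x # y # zs) = dist (\<gamma> x) (\<gamma> y) + polygon_length \<gamma> (y # zs)"
| "polygon_length \<gamma> _ = 0"

lemma polygon_length_nonneg: "polygon_length \<gamma> ts \<ge> 0"
  by (induction \<gamma> ts rule: polygon_length.induct) auto

lemma polygon_length_sum:
  "(\<Sum>i < length ts - 1. ennreal (dist (\<gamma> (ts ! i)) (\<gamma> (ts ! Suc i)))) = ennreal (polygon_length \<gamma> ts)"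
proof (induction \<gamma> ts rule: polygon_length.induct)
  case (1 \<gamma> x y zs)
  then show ?case by (simp add: sum.lessThan_Suc_shift ennreal_plus polygon_length_nonneg del: sum.lessThan_Suc)
qed auto

lemma curve_length_polygons:
  "curve_length S \<gamma> = (SUP ts \<in> {ts. sorted ts \<and> set ts \<subseteq> S}. ennreal (polygon_length \<gamma> ts))"
  unfolding curve_length_def polygon_length_sum ..

lemma polygon_le_curve_length:
  "sorted ts \<Longrightarrow> set ts \<subseteq> S \<Longrightarrow> ennreal (polygon_length \<gamma> ts) \<le> curve_length S \<gamma>"
  unfolding curve_length_polygons by (rule SUP_upper) auto

lemma curve_length_leI:
  "(\<And>ts. sorted ts \<Longrightarrow> set ts \<subseteq> S \<Longrightarrow> ennreal (polygon_length \<gamma> ts) \<le> B) \<Longrightarrow> curve_length S \<gamma> \<le> B"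
  unfolding curve_length_polygons by (rule SUP_least) auto

lemma curve_length_subset: "S \<subseteq> T \<Longrightarrow> curve_length S \<gamma> \<le> curve_length T \<gamma>"
  by (rule curve_length_leI) (auto intro: polygon_le_curve_length)

lemma polygon_length_split:
  "polygon_length \<gamma> (xs @ y # ys) = polygon_length \<gamma> (xs @ [y]) + polygon_length \<gamma> (y # ys)"
  by (induction \<gamma> xs rule: polygon_length.induct) (auto)

lemma polygon_length_append_ge:
  "polygon_length \<gamma> xs + polygon_length \<gamma> ys \<le> polygon_length \<gamma> (xs @ ys)"
proof (induction \<gamma> xs rule: polygon_length.induct)
  case ("2_2" \<gamma> v)
  then show ?case by (cases ys) auto
qed auto

lemma polygon_length_insert:
  "polygon_length \<gamma> (xs @ ys) \<le> polygon_length \<gamma> (xs @ [b]) + polygon_length \<gamma> (b # ys)"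
proof (induction \<gamma> xs rule: polygon_length.induct)
  case ("2_1" \<gamma>)
  then show ?case by (cases ys) auto
next
  case ("2_2" \<gamma> v)
  then show ?case by (cases ys) (auto simp: dist_triangle)
qed auto

lemma polygon_length_rev: "polygon_length \<gamma> (rev ts) = polygon_length \<gamma> ts"
proof (induction \<gamma> ts rule: polygon_length.induct)
  case (1 \<gamma> x y zs)
  then show ?case using polygon_length_split[of \<gamma> "rev zs" y "[x]"] by (simp add: dist_commute)
qed auto

lemma polygon_length_compose: "polygon_length (\<lambda>t. \<gamma> (\<sigma> t)) ts = polygon_length \<gamma> (map \<sigma> ts)"
  by (induction "\<lambda>t. \<gamma> (\<sigma> t)" ts rule: polygon_length.induct) auto

lemma polygon_length_cong:
  "(\<And>t. t \<in> set ts \<Longrightarrow> \<gamma>' t = \<gamma> t) \<Longrightarrow> polygon_length \<gamma>' ts = polygon_length \<gamma> ts"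
  by (induction ts rule: induct_list012) auto

lemma curve_length_mono_reparam:
  assumes "mono_on S \<sigma>" "\<sigma> ` S \<subseteq> T" "\<And>t. t \<in> S \<Longrightarrow> \<gamma>' t = \<gamma> (\<sigma> t)"
  shows "curve_length S \<gamma>' \<le> curve_length T \<gamma>"
proof (rule curve_length_leI)
  fix ts assume ts: "sorted ts" "set ts \<subseteq> S"
  have "polygon_length \<gamma>' ts = polygon_length (\<lambda>t. \<gamma> (\<sigma> t)) ts"
    by (rule polygon_length_cong) (use ts(2) assms(3) in auto)
  moreover have "sorted (map \<sigma> ts)"
    using ts by (auto simp: sorted_map intro!: sorted_wrt_mono_rel[OF _ ts(1)] mono_onD[OF assms(1)])
  moreover have "set (map \<sigma> ts) \<subseteq> T" using ts assms by auto
  ultimately show "ennreal (polygon_length \<gamma>' ts) \<le> curve_length T \<gamma>"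
    by (simp add: polygon_length_compose polygon_le_curve_length)
qed

lemma curve_length_antimono_reparam:
  assumes "antimono_on S \<sigma>" "\<sigma> ` S \<subseteq> T" "\<And>t. t \<in> S \<Longrightarrow> \<gamma>' t = \<gamma> (\<sigma> t)"
  shows "curve_length S \<gamma>' \<le> curve_length T \<gamma>"
proof (rule curve_length_leI)
  fix ts assume ts: "sorted ts" "set ts \<subseteq> S"
  have "polygon_length \<gamma>' ts = polygon_length (\<lambda>t. \<gamma> (\<sigma> t)) ts"
    by (rule polygon_length_cong) (use ts(2) assms(3) in auto)
  moreover have "sorted (rev (map \<sigma> ts))"
  proof -
    have "sorted_wrt (\<lambda>x y. \<sigma> x \<ge> \<sigma> y) ts"
      using assms(1) ts by (auto intro!: sorted_wrt_mono_rel[OF _ ts(1)] simp: monotone_on_def)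
    then show ?thesis by (simp add: sorted_wrt_rev sorted_wrt_map)
  qed
  moreover have "set (rev (map \<sigma> ts)) \<subseteq> T" using ts assms by auto
  ultimately show "ennreal (polygon_length \<gamma>' ts) \<le> curve_length T \<gamma>"
    using polygon_le_curve_length[of "rev (map \<sigma> ts)" T \<gamma>]
    by (simp add: polygon_length_compose polygon_length_rev)
qed

lemma sorted_split_filter:
  "sorted ts \<Longrightarrow> ts = filter (\<lambda>x. x \<le> b) ts @ filter (\<lambda>x. \<not> x \<le> (b::real)) ts"
proof (induction ts)
  case (Cons a ts)
  show ?case
  proof (cases "a \<le> b")
    case False
    then have "filter (\<lambda>x. x \<le> b) (a # ts) = []" "filter (\<lambda>x. \<not> x \<le> b) (a # ts) = a # ts"
      using Cons.prems by (auto simp: filter_empty_conv filter_id_conv)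
    then show ?thesis by (metis append_Nil)
  qed (use Cons in auto)
qed simp

lemma curve_length_split:
  assumes "a \<le> b" "b \<le> c"
  shows "curve_length {a..c} \<gamma> \<le> curve_length {a..b} \<gamma> + curve_length {b..c} \<gamma>"
proof (rule curve_length_leI)
  fix ts assume ts: "sorted ts" "set ts \<subseteq> {a..c}"
  let ?xs = "filter (\<lambda>x. x \<le> b) ts" and ?ys = "filter (\<lambda>x. \<not> x \<le> b) ts"
  have "polygon_length \<gamma> ts \<le> polygon_length \<gamma> (?xs @ [b]) + polygon_length \<gamma> (b # ?ys)"
    using polygon_length_insert[of \<gamma> ?xs ?ys b] sorted_split_filter[OF ts(1), of b] by simp
  then have "ennreal (polygon_length \<gamma> ts) \<le> ennreal (polygon_length \<gamma> (?xs @ [b])) + ennreal (polygon_length \<gamma> (b # ?ys))"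
    by (simp add: ennreal_plus[symmetric] polygon_length_nonneg ennreal_leI del: ennreal_plus)
  also have "\<dots> \<le> curve_length {a..b} \<gamma> + curve_length {b..c} \<gamma>"
    by (intro add_mono polygon_le_curve_length)
       (use ts assms in \<open>auto simp: sorted_append sorted_wrt_filter\<close>)
  finally show "ennreal (polygon_length \<gamma> ts) \<le> curve_length {a..b} \<gamma> + curve_length {b..c} \<gamma>" .
qed

lemma curve_length_superadditive:
  assumes "\<And>x y. x \<in> S \<Longrightarrow> y \<in> T \<Longrightarrow> x \<le> y" "S \<subseteq> U" "T \<subseteq> U"
  shows "curve_length S \<gamma> + curve_length T \<gamma> \<le> curve_length U \<gamma>"
proof -
  let ?A = "{ts. sorted ts \<and> set ts \<subseteq> S}" and ?B = "{ts. sorted ts \<and> set ts \<subseteq> T}"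
  have ne: "?A \<noteq> {}" "?B \<noteq> {}" by (auto intro: exI[of _ "[]"])
  have "curve_length S \<gamma> + ennreal (polygon_length \<gamma> vs) \<le> curve_length U \<gamma>" if vs: "vs \<in> ?B" for vs
  proof -
    have "curve_length S \<gamma> + ennreal (polygon_length \<gamma> vs) = (SUP us\<in>?A. ennreal (polygon_length \<gamma> us) + ennreal (polygon_length \<gamma> vs))"
      unfolding curve_length_polygons[of S] by (rule ennreal_SUP_add_left[OF ne(1), symmetric])
    also have "\<dots> \<le> curve_length U \<gamma>"
    proof (rule SUP_least)
      fix us assume us: "us \<in> ?A"
      have "ennreal (polygon_length \<gamma> us) + ennreal (polygon_length \<gamma> vs) \<le> ennreal (polygon_length \<gamma> (us @ vs))"
        using polygon_length_append_ge[of \<gamma> us vs]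
        by (simp add: ennreal_plus[symmetric] polygon_length_nonneg ennreal_leI del: ennreal_plus)
      also have "\<dots> \<le> curve_length U \<gamma>"
        by (rule polygon_le_curve_length) (use us vs assms(2,3) in \<open>auto simp: sorted_append intro!: assms(1)\<close>)
      finally show "ennreal (polygon_length \<gamma> us) + ennreal (polygon_length \<gamma> vs) \<le> curve_length U \<gamma>" .
    qed
    finally show ?thesis .
  qed
  then show ?thesis
    unfolding curve_length_polygons[of T] using ennreal_SUP_add_right[OF ne(2), of "curve_length S \<gamma>" "\<lambda>ts. ennreal (polygon_length \<gamma> ts)"]
    by (auto intro!: SUP_least)
qed

lemma curve_length_le_increment:
  assumes inc: "\<And>x y. x \<in> S \<Longrightarrow> y \<in> S \<Longrightarrow> x \<le> y \<Longrightarrow> dist (\<gamma> x) (\<gamma> y) \<le> G y - G x"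
    and B: "\<And>x y. x \<in> S \<Longrightarrow> y \<in> S \<Longrightarrow> x \<le> y \<Longrightarrow> G y - G x \<le> B" "B \<ge> 0"
  shows "curve_length S \<gamma> \<le> ennreal B"
proof (rule curve_length_leI)
  fix ts assume ts: "sorted ts" "set ts \<subseteq> S"
  have "ts \<noteq> [] \<Longrightarrow> polygon_length \<gamma> ts \<le> G (last ts) - G (hd ts)"
    using ts inc
  proof (induction \<gamma> ts rule: polygon_length.induct)
    case (1 \<gamma> x y zs)
    then have "polygon_length \<gamma> (y # zs) \<le> G (last (y # zs)) - G y" by simp
    moreover have "dist (\<gamma> x) (\<gamma> y) \<le> G y - G x" using 1 by auto
    ultimately show ?case by simp
  qed auto
  moreover have "G (last ts) - G (hd ts) \<le> B" if "ts \<noteq> []"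
  proof (rule B(1))
    show "hd ts \<le> last ts" using ts(1) that by (metis hd_Cons_tl last_in_set sorted_simps(2) last.simps order_refl)
  qed (use ts that in auto)
  ultimately have "polygon_length \<gamma> ts \<le> B" using B(2) by (cases "ts = []") auto
  then show "ennreal (polygon_length \<gamma> ts) \<le> ennreal B" by (rule ennreal_leI)
qed

text \<open>Up to an arbitrarily small multiple of the length of the interval, the inequality is additive in the interval, and it
holds on short intervals, where the speed is nearly constant and a single chord suffices. The Bolzano principle
joins the two observations.\<close>
lemma integral_speed_le_curve_length:
  assumes ab: "a \<le> b"
    and der: "\<And>t. a \<le> t \<Longrightarrow> t \<le> b \<Longrightarrow> (\<gamma> has_vector_derivative \<gamma>' t) (at t within {a..b})"
    and cont: "continuous_on {a..b} \<gamma>'"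
  shows "ennreal (integral {a..b} (\<lambda>t. norm (\<gamma>' t))) \<le> curve_length {a..b} \<gamma>"
proof -
  let ?n = "\<lambda>t. norm (\<gamma>' t)"
  have int: "?n integrable_on {u..v}" if "a \<le> u" "v \<le> b" for u v
    by (rule integrable_continuous_real, rule continuous_on_norm, rule continuous_on_subset[OF cont]) (use that in auto)
  have nonneg: "integral {u..v} ?n \<ge> 0" if "a \<le> u" "v \<le> b" for u v
    by (rule integral_nonneg[OF int[OF that]]) simp
  have main: "ennreal (integral {a..b} ?n) \<le> curve_length {a..b} \<gamma> + ennreal (\<epsilon> * (b - a))" if e: "\<epsilon> > 0" for \<epsilon>
  proof -
    define P where "P u v = (a \<le> u \<and> u \<le> v \<and> v \<le> b \<longrightarrow> ennreal (integral {u..v} ?n) \<le> curve_length {u..v} \<gamma> + ennreal (\<epsilon> * (v - u)))" for u v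
    have "P a b"
      using ab
    proof (induction rule: Bolzano)
      case (trans u v w)
      show ?case unfolding P_def
      proof (intro impI, elim conjE)
        assume uw: "a \<le> u" "u \<le> w" "w \<le> b"
        have "integral {u..w} ?n = integral {u..v} ?n + integral {v..w} ?n"
          by (rule Henstock_Kurzweil_Integration.integral_combine[symmetric]) (use trans uw in \<open>auto intro!: int\<close>)
        then have "ennreal (integral {u..w} ?n) = ennreal (integral {u..v} ?n) + ennreal (integral {v..w} ?n)"
          using nonneg uw trans by (simp add: ennreal_plus)
        also have "\<dots> \<le> (curve_length {u..v} \<gamma> + ennreal (\<epsilon> * (v - u))) + (curve_length {v..w} \<gamma> + ennreal (\<epsilon> * (w - v)))"
          using trans uw by (intro add_mono) (auto simp: P_def)
        also have "\<dots> = (curve_length {u..v} \<gamma> + curve_length {v..w} \<gamma>) + (ennreal (\<epsilon> * (v - u)) + ennreal (\<epsilon> * (w - v)))"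
          by (simp add: add_ac)
        also have "ennreal (\<epsilon> * (v - u)) + ennreal (\<epsilon> * (w - v)) = ennreal (\<epsilon> * (w - u))"
          using e trans by (subst ennreal_plus[symmetric]) (auto simp: algebra_simps intro!: mult_left_mono)
        also have "curve_length {u..v} \<gamma> + curve_length {v..w} \<gamma> \<le> curve_length {u..w} \<gamma>"
          by (rule curve_length_superadditive) (use trans in auto)
        finally show "ennreal (integral {u..w} ?n) \<le> curve_length {u..w} \<gamma> + ennreal (\<epsilon> * (w - u))"
          by (simp add: add_mono)
      qed
    next
      case (local x)
      obtain d where d: "d > 0" "\<And>t. t \<in> {a..b} \<Longrightarrow> dist t x < d \<Longrightarrow> dist (\<gamma>' t) (\<gamma>' x) < \<epsilon> / 2"
        using cont local e unfolding continuous_on_iff by (metis atLeastAtMost_iff half_gt_zero)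
      show ?case
      proof (intro exI[of _ d] conjI allI impI d(1))
        fix u v assume uv: "u \<le> x \<and> x \<le> v \<and> v - u < d"
        show "P u v" unfolding P_def
        proof (intro impI, elim conjE)
          assume uv': "a \<le> u" "u \<le> v" "v \<le> b"
          have near: "norm (\<gamma>' t - \<gamma>' x) \<le> \<epsilon> / 2" if "t \<in> {u..v}" for t
            proof -
            have "dist t x < d" "t \<in> {a..b}" using that uv uv' by (auto simp: dist_real_def)
            then show ?thesis using d(2)[of t] by (simp add: dist_norm)
          qed
          have "integral {u..v} ?n \<le> integral {u..v} (\<lambda>t. norm (\<gamma>' x) + \<epsilon> / 2)"
          proof (rule integral_le[OF int])
            fix t assume "t \<in> {u..v}"
            from near[OF this] show "norm (\<gamma>' t) \<le> norm (\<gamma>' x) + \<epsilon> / 2"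
              using norm_triangle_ineq2[of "\<gamma>' t" "\<gamma>' x"] by linarith
          qed (use uv' in auto)
          also have "\<dots> = (norm (\<gamma>' x) + \<epsilon> / 2) * (v - u)" using uv' by simp
          finally have 1: "integral {u..v} ?n \<le> (norm (\<gamma>' x) + \<epsilon> / 2) * (v - u)" .
          have "norm (\<gamma> v - \<gamma> u - (v - u) *\<^sub>R \<gamma>' x) \<le> norm (v - u) * (\<epsilon> / 2)"
          proof (rule vector_differentiable_bound_linearization[of "{u..v}" \<gamma> \<gamma>' u v x "\<epsilon> / 2"])
            show "(\<gamma> has_vector_derivative \<gamma>' t) (at t within {u..v})" if "t \<in> {u..v}" for t
              by (rule has_vector_derivative_within_subset[OF der]) (use that uv' in auto)
            show "closed_segment u v \<subseteq> {u..v}" using uv' by (simp add: closed_segment_eq_real_ivl)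
          qed (use near uv in auto)
          then have 2: "norm (\<gamma>' x) * (v - u) \<le> dist (\<gamma> u) (\<gamma> v) + \<epsilon> / 2 * (v - u)"
            using norm_triangle_ineq2[of "(v - u) *\<^sub>R \<gamma>' x" "\<gamma> v - \<gamma> u"] uv'
            by (simp add: dist_norm norm_minus_commute mult.commute)
          have "integral {u..v} ?n \<le> polygon_length \<gamma> [u, v] + \<epsilon> * (v - u)"
          proof -
            have "\<epsilon> * (v - u) = \<epsilon> / 2 * (v - u) + \<epsilon> / 2 * (v - u)" by simp
            then show ?thesis using 1 2 unfolding distrib_right polygon_length.simps by linarith
          qed
          then have "ennreal (integral {u..v} ?n) \<le> ennreal (polygon_length \<gamma> [u, v]) + ennreal (\<epsilon> * (v - u))"
          proof -
            have "\<epsilon> * (v - u) \<ge> 0" using e uv' by simp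
            then show ?thesis
              using \<open>integral {u..v} ?n \<le> polygon_length \<gamma> [u, v] + \<epsilon> * (v - u)\<close>
              by (simp add: ennreal_plus[symmetric] ennreal_leI del: ennreal_plus)
          qed
          also have "\<dots> \<le> curve_length {u..v} \<gamma> + ennreal (\<epsilon> * (v - u))"
            by (intro add_mono polygon_le_curve_length) (use uv' in auto)
          finally show "ennreal (integral {u..v} ?n) \<le> curve_length {u..v} \<gamma> + ennreal (\<epsilon> * (v - u))" .
        qed
      qed
    qed
    then show ?thesis using ab by (simp add: P_def)
  qed
  show ?thesis
  proof (rule ennreal_le_epsilon)
    fix e :: real assume e: "e > 0"
    define \<epsilon> where "\<epsilon> = e / (b - a + 1)"
    have "\<epsilon> > 0" using e ab by (simp add: \<epsilon>_def)
    moreover have "\<epsilon> * (b - a) \<le> e" using e ab by (simp add: \<epsilon>_def field_simps)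
    ultimately show "ennreal (integral {a..b} ?n) \<le> curve_length {a..b} \<gamma> + ennreal e"
      using main[of \<epsilon>] by (meson add_left_mono ennreal_leI order_trans)
  qed
qed

section \<open>Boundary arcs whose image has finite length\<close>
lemma dist_cis_le: "norm (cis s - cis t) \<le> \<bar>s - t\<bar>"
proof -
  have "2 * ((s - t) / 2) = s - t" by simp
  then have "cos (s - t) = 1 - 2 * (sin ((s - t) / 2))\<^sup>2"
    using cos_double_sin[of "(s - t) / 2"] by (simp only:)
  moreover have "(norm (cis s - cis t))\<^sup>2 = 2 - 2 * cos (s - t)"
    unfolding cmod_power2 cos_diff using sin_cos_squared_add[of s] sin_cos_squared_add[of t]
    by (simp add: power2_eq_square algebra_simps)
  ultimately have "(norm (cis s - cis t))\<^sup>2 = (2 * \<bar>sin ((s - t) / 2)\<bar>)\<^sup>2"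
    by (simp add: power_mult_distrib)
  then have "norm (cis s - cis t) = 2 * \<bar>sin ((s - t) / 2)\<bar>"
    by (rule power2_eq_imp_eq) auto
  also have "\<dots> \<le> \<bar>s - t\<bar>" using abs_sin_x_le_abs_x[of "(s - t) / 2"] by simp
  finally show ?thesis .
qed

lemma polygon_length_as_sum:
  "polygon_length \<gamma> ts = (\<Sum>i < length ts - 1. dist (\<gamma> (ts ! i)) (\<gamma> (ts ! Suc i)))"
  by (induction \<gamma> ts rule: polygon_length.induct) (auto simp: sum.lessThan_Suc_shift simp del: sum.lessThan_Suc)

lemma pow_times_one_minus_le:
  assumes "0 \<le> u" "u \<le> (1::real)"
  shows "(1 - u) * u ^ M \<le> 1 / (real M + 1)"
proof -
  have "(real M + 1) * u ^ M = (\<Sum>i\<le>M. u ^ M)" by simp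
  also have "\<dots> \<le> (\<Sum>i\<le>M. u ^ i)" by (intro sum_mono power_decreasing) (use assms in auto)
  finally have "(1 - u) * ((real M + 1) * u ^ M) \<le> (1 - u) * (\<Sum>i\<le>M. u ^ i)"
    using assms by (intro mult_left_mono) auto
  also have "\<dots> = 1 - u ^ Suc M" unfolding one_diff_power_eq lessThan_Suc_atMost by simp
  also have "\<dots> \<le> 1" using assms by simp
  finally show ?thesis by (simp add: field_simps)
qed

text \<open>A maximum principle for polygons. For a fixed polygon the sums
\<open>\<Psi>(z) = \<Sum> c\<^sub>i (k(z e\<^sup>i\<^sup>s) - k(z e\<^sup>i\<^sup>t))\<close> with unimodular \<open>c\<^sub>i\<close> are
holomorphic in \<open>z\<close>. For \<open>|z| = 1\<close> near 1 they are at most \<open>l\<close>, since rotated points stay on the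
given arc, and in the disc they grow polynomially, by the distortion theorem. Comparison on the circular
segment \<open>Re z > x0\<close> yields a bound at \<open>r\<close> close to 1 that does not depend on the polygon.\<close>
lemma interior_arc_length:
  assumes holo: "k holomorphic_on ball 0 1" and inj: "inj_on k (ball 0 1)"
    and \<sigma>: "pi / 2 < \<sigma>" "\<sigma> < pi"
    and cont: "continuous_on (ball 0 1 \<union> cis ` {-\<sigma><..<\<sigma>}) k"
    and len: "curve_length {-\<sigma><..<\<sigma>} (\<lambda>t. k (cis t)) \<le> ennreal l" and l0: "l \<ge> 0"
    and \<epsilon>: "\<epsilon> > 0"
  shows "\<forall>\<^sub>F r in at_left 1. curve_length {-pi/2..pi/2} (\<lambda>t. k (of_real r * cis t)) \<le> ennreal (l + \<epsilon>)"
proof -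
  define \<eta> where "\<eta> = (\<sigma> - pi / 2) / 2"
  have \<eta>: "0 < \<eta>" "\<eta> < pi / 2" "\<eta> + pi / 2 < \<sigma>" using \<sigma> by (auto simp: \<eta>_def field_simps)
  define x0 where "x0 = cos \<eta>"
  have x0: "0 < x0" "x0 < 1"
    using \<eta> cos_gt_zero_pi[of \<eta>] cos_monotone_0_pi[of 0 \<eta>] by (auto simp: x0_def)
  define C where "C = 2 * norm (deriv k 0)"
  have C0: "C \<ge> 0" by (simp add: C_def)
  have dk: "norm (deriv k z) \<le> C / (1 - norm z) ^ 3" if "norm z < 1" for z
    using distortion_upper[OF holo inj that] by (simp add: C_def mult.commute)
  \<comment> \<open>The zeros of \<open>E\<close> are the corners of the segment. On the chord \<open>E(z) = 1 - |z|\<^sup>2\<close>, so that \<open>E\<^sup>4\<close>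
absorbs the growth of order 3; on the arc \<open>|E|\<close> is largest at 1. The factor \<open>z\<^sup>M\<close>, of modulus 1 on the
arc, makes the contribution of the chord negligible.\<close>
  define E where "E z = z\<^sup>2 - 2 * of_real x0 * z + 1" for z :: complex
  define e1 where "e1 = 2 - 2 * x0"
  have e1: "e1 > 0" using x0 by (simp add: e1_def)
  define l1 where "l1 = l + \<epsilon> / 2"
  have l1: "l1 > 0" "l \<le> l1" "l1 < l + \<epsilon>" using l0 \<epsilon> by (auto simp: l1_def)
  obtain M :: nat where M: "16 * pi * C / (real M + 1) \<le> l1 * e1 ^ 4"
  proof -
    obtain M :: nat where "16 * pi * C / (l1 * e1 ^ 4) < real M" using reals_Archimedean2 by blast
    then have "16 * pi * C < l1 * e1 ^ 4 * real M" using l1 e1 by (simp add: divide_less_eq mult_ac)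
    moreover have "l1 * e1 ^ 4 > 0" using l1 e1 by simp
    ultimately have "16 * pi * C \<le> l1 * e1 ^ 4 * (real M + 1)" unfolding distrib_left by linarith
    then show ?thesis by (intro that[of M]) (simp add: divide_le_eq)
  qed
  define f where "f r = l1 * e1 ^ 4 / ((r\<^sup>2 - 2 * x0 * r + 1) ^ 4 * r ^ M)" for r :: real
  have "(f \<longlongrightarrow> l1 * e1 ^ 4 / ((1\<^sup>2 - 2 * x0 * 1 + 1) ^ 4 * 1 ^ M)) (at_left 1)"
    unfolding f_def using e1 by (intro tendsto_intros) (auto simp: e1_def)
  moreover have "l1 * e1 ^ 4 / ((1\<^sup>2 - 2 * x0 * 1 + 1) ^ 4 * 1 ^ M) = l1"
    using e1 by (simp add: e1_def)
  ultimately have "(f \<longlongrightarrow> l1) (at_left 1)" by simp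
  then have "\<forall>\<^sub>F r in at_left 1. f r < l + \<epsilon>" using l1 by (intro order_tendstoD)
  moreover have "\<forall>\<^sub>F r in at_left (1::real). r \<in> {x0<..<1}" using x0 by (intro eventually_at_left_real)
  ultimately show ?thesis
  proof eventually_elim
    case (elim r)
    then have r: "x0 < r" "r < 1" "0 < r" using x0 by auto
    show ?case
    proof (rule curve_length_leI)
      fix ts assume ts: "sorted ts" "set ts \<subseteq> {-pi/2..pi/2}"
      define n where "n = length ts - 1"
      have tsn: "ts ! i \<in> {-pi/2..pi/2}" "ts ! Suc i \<in> {-pi/2..pi/2}" if "i < n" for i
        by (rule subsetD[OF ts(2)], rule nth_mem, use that in \<open>simp add: n_def\<close>)+
      define \<gamma> where "\<gamma> z t = k (z * cis t)" for z t
      define c where "c i = cnj (sgn (\<gamma> (of_real r) (ts ! Suc i) - \<gamma> (of_real r) (ts ! i)))" for i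
      have c1: "norm (c i) \<le> 1" for i by (simp add: c_def norm_sgn)
      define \<Psi> where "\<Psi> z = (\<Sum>i<n. c i * (\<gamma> z (ts ! Suc i) - \<gamma> z (ts ! i)))" for z
      have \<Psi>poly: "norm (\<Psi> z) \<le> polygon_length (\<gamma> z) ts" for z
      proof -
        have "norm (\<Psi> z) \<le> (\<Sum>i<n. norm (c i * (\<gamma> z (ts ! Suc i) - \<gamma> z (ts ! i))))"
          unfolding \<Psi>_def by (rule norm_sum)
        also have "\<dots> \<le> (\<Sum>i<n. dist (\<gamma> z (ts ! i)) (\<gamma> z (ts ! Suc i)))"
          by (intro sum_mono) (use c1 in \<open>simp add: norm_mult dist_norm norm_minus_commute mult_left_le_one_le\<close>)
        finally show ?thesis by (simp add: polygon_length_as_sum n_def)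
      qed
      have \<Psi>r: "\<Psi> (of_real r) = of_real (polygon_length (\<gamma> (of_real r)) ts)"
      proof -
        have "c i * (\<gamma> (of_real r) (ts ! Suc i) - \<gamma> (of_real r) (ts ! i)) = of_real (dist (\<gamma> (of_real r) (ts ! i)) (\<gamma> (of_real r) (ts ! Suc i)))" for i
        proof -
          have "cnj (sgn w) * w = of_real (norm w)" for w :: complex
            by (cases "w = 0") (auto simp: sgn_eq complex_norm_square[symmetric] power2_eq_square field_simps mult.commute[of "cnj w"] simp del: of_real_power)
          then show ?thesis by (simp add: c_def dist_norm norm_minus_commute)
        qed
        then show ?thesis by (simp add: \<Psi>_def polygon_length_as_sum n_def)
      qed
      have inb: "z * cis t \<in> ball 0 1" if "norm z < 1" for z t using that by (simp add: norm_mult)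
      have near: "\<exists>a. z = cis a \<and> \<bar>a\<bar> \<le> \<eta>" if z: "norm z = 1" "x0 \<le> Re z" for z
      proof -
        have "z = cis (Arg z)" using cis_Arg[of z] z(1) by (force simp: sgn_eq)
        then have "cos (Arg z) = Re z" by (metis cis.simps(1))
        moreover have "\<bar>Arg z\<bar> \<le> pi" using mpi_less_Arg[of z] Arg_le_pi[of z] by linarith
        ultimately have "cos \<eta> \<le> cos \<bar>Arg z\<bar>" using z(2) by (simp add: x0_def)
        then have "\<bar>Arg z\<bar> \<le> \<eta>" using cos_mono_le_eq[of \<eta> "\<bar>Arg z\<bar>"] \<open>\<bar>Arg z\<bar> \<le> pi\<close> \<eta> by auto
        then show ?thesis using \<open>z = cis (Arg z)\<close> by blast
      qed
      define V where "V = ball 0 1 \<inter> {z. x0 < Re z}"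
      have clV: "closure V \<subseteq> cball 0 1 \<inter> {z. x0 \<le> Re z}"
      proof (rule closure_minimal)
        show "closed (cball 0 1 \<inter> {z. x0 \<le> Re z})"
          using closed_halfspace_Re_ge[of x0] by (intro closed_Int) auto
      qed (auto simp: V_def)
      have openV: "open V" unfolding V_def using open_halfspace_Re_gt[of x0] by (intro open_Int) auto
      have sect: "z * cis t \<in> ball 0 1 \<union> cis ` {-\<sigma><..<\<sigma>}"
        if zt: "z \<in> closure V" "t \<in> {-pi/2..pi/2}" for z t
      proof (cases "norm z = 1")
        case True
        then obtain a where a: "z = cis a" "\<bar>a\<bar> \<le> \<eta>" using near zt(1) clV by blast
        have "a + t \<in> {-\<sigma><..<\<sigma>}" using a zt(2) \<eta> by auto
        then show ?thesis using a by (auto simp: cis_mult)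
      next
        case False
        then have "norm z < 1" using zt(1) clV by auto
        then show ?thesis using inb by blast
      qed
      have \<gamma>cont: "continuous_on (closure V) (\<lambda>z. \<gamma> z t)" if t: "t \<in> {-pi/2..pi/2}" for t
        unfolding \<gamma>_def
      proof (rule continuous_on_compose2[OF cont])
        show "(\<lambda>z. z * cis t) ` closure V \<subseteq> ball 0 1 \<union> cis ` {-\<sigma><..<\<sigma>}" using sect t by blast
      qed (intro continuous_intros)
      have \<Psi>cont: "continuous_on (closure V) \<Psi>"
        unfolding \<Psi>_def by (intro continuous_intros \<gamma>cont) (use tsn in auto)
      have \<Psi>holo: "\<Psi> holomorphic_on ball 0 1"
      proof -
        have "(\<lambda>z. \<gamma> z t) holomorphic_on ball 0 1" for t
          unfolding \<gamma>_def
          by (rule holomorphic_on_compose_gen[OF _ holo, unfolded o_def])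
             (use inb in \<open>auto intro!: holomorphic_intros\<close>)
        then show ?thesis unfolding \<Psi>_def by (intro holomorphic_intros)
      qed
      have \<Psi>inner: "norm (\<Psi> z) \<le> pi * C / (1 - norm z) ^ 3" if z: "norm z < 1" for z
      proof -
        define B where "B = C / (1 - norm z) ^ 3"
        have B0: "B \<ge> 0" using C0 z by (simp add: B_def)
        have lip: "dist (\<gamma> z s) (\<gamma> z t) \<le> B * (t - s)" if "s \<le> t" for s t
        proof -
          have "norm (k (z * cis s) - k (z * cis t)) \<le> B * norm (z * cis s - z * cis t)"
          proof (rule field_differentiable_bound[where S = "cball 0 (norm z)" and f' = "deriv k"])
            fix w :: complex assume w: "w \<in> cball 0 (norm z)"
            then have w1: "w \<in> ball 0 1" using z by auto
            show "(k has_field_derivative deriv k w) (at w within cball 0 (norm z))"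
              using holomorphic_derivI[OF holo _ w1] by (simp add: has_field_derivative_at_within)
            have "norm (deriv k w) \<le> C / (1 - norm w) ^ 3" using dk w1 by simp
            also have "\<dots> \<le> B" unfolding B_def
              by (intro divide_left_mono power_mono mult_pos_pos zero_less_power) (use C0 w z in auto)
            finally show "norm (deriv k w) \<le> B" .
          qed (auto simp: norm_mult)
          also have "\<dots> \<le> B * (t - s)"
          proof (rule mult_left_mono[OF _ B0])
            have "norm (z * cis s - z * cis t) = norm z * norm (cis s - cis t)"
              by (simp add: norm_mult flip: right_diff_distrib)
            also have "\<dots> \<le> 1 * \<bar>s - t\<bar>" using z dist_cis_le by (intro mult_mono) auto
            finally show "norm (z * cis s - z * cis t) \<le> t - s" using that by simp
          qed
          finally show ?thesis by (simp add: \<gamma>_def dist_norm)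
        qed
        have "curve_length {-pi/2..pi/2} (\<gamma> z) \<le> ennreal (B * pi)"
        proof (rule curve_length_le_increment[where G = "\<lambda>t. B * t"])
          show "B * y - B * x \<le> B * pi" if "x \<in> {-pi/2..pi/2}" "y \<in> {-pi/2..pi/2}" for x y
            using that B0 by (auto simp flip: right_diff_distrib intro!: mult_left_mono)
        qed (use lip B0 in \<open>auto simp: right_diff_distrib\<close>)
        then have "ennreal (polygon_length (\<gamma> z) ts) \<le> ennreal (B * pi)"
          using polygon_le_curve_length[OF ts] order_trans by blast
        then have "polygon_length (\<gamma> z) ts \<le> B * pi" using B0 by (simp add: ennreal_le_iff)
        then show ?thesis using \<Psi>poly[of z] by (simp add: B_def mult.commute)
      qed
      have \<Psi>outer: "norm (\<Psi> z) \<le> l" if z: "norm z = 1" "x0 \<le> Re z" for z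
      proof -
        obtain a where a: "z = cis a" "\<bar>a\<bar> \<le> \<eta>" using near z by blast
        have "polygon_length (\<gamma> z) ts = polygon_length (\<lambda>t. k (cis t)) (map (\<lambda>t. a + t) ts)"
          using polygon_length_compose[of "\<lambda>t. k (cis t)" "\<lambda>t. a + t" ts] by (simp add: \<gamma>_def[abs_def] a cis_mult)
        moreover have "ennreal (polygon_length (\<lambda>t. k (cis t)) (map (\<lambda>t. a + t) ts)) \<le> curve_length {-\<sigma><..<\<sigma>} (\<lambda>t. k (cis t))"
        proof (rule polygon_le_curve_length)
          show "sorted (map (\<lambda>t. a + t) ts)" using ts(1) by (simp add: sorted_map)
          show "set (map (\<lambda>t. a + t) ts) \<subseteq> {-\<sigma><..<\<sigma>}" using ts(2) a \<eta> by (auto simp: abs_le_iff subset_iff) (force+)?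
        qed
        ultimately have "ennreal (polygon_length (\<gamma> z) ts) \<le> ennreal l" using len by simp
        then show ?thesis using \<Psi>poly[of z] l0 by (simp add: ennreal_le_iff)
      qed
      define G where "G z = z ^ M * E z ^ 4 * \<Psi> z" for z
      have "norm (G (of_real r)) \<le> l1 * e1 ^ 4"
      proof (rule maximum_modulus_frontier[of G V])
        show "G holomorphic_on interior V"
          unfolding G_def E_def
          by (intro holomorphic_intros holomorphic_on_subset[OF \<Psi>holo])
             (use interior_subset in \<open>auto simp: V_def\<close>)
        show "continuous_on (closure V) G"
          unfolding G_def E_def by (intro continuous_intros \<Psi>cont)
        show "bounded V" unfolding V_def by (simp add: bounded_Int)
        show "of_real r \<in> V" using r by (simp add: V_def)
        fix z assume z: "z \<in> frontier V"
        then have zc: "norm z \<le> 1" "x0 \<le> Re z" using clV by (auto simp: frontier_def)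
        have "z \<notin> V" using z openV by (simp add: frontier_def interior_open)
        then have or: "norm z = 1 \<or> norm z < 1 \<and> Re z = x0" using zc by (auto simp: V_def)
        show "norm (G z) \<le> l1 * e1 ^ 4"
        proof (cases "norm z = 1")
          case True
          have "E z = z * (z + cnj z - 2 * of_real x0)"
            using complex_norm_square[of z] True by (simp add: E_def power2_eq_square algebra_simps)
          also have "z + cnj z - 2 * of_real x0 = of_real (2 * (Re z - x0))" by (simp add: complex_add_cnj)
          finally have "norm (E z) = 2 * (Re z - x0)" using True zc by (simp add: norm_mult del: of_real_mult of_real_diff)
          also have "\<dots> \<le> e1" using complex_Re_le_cmod[of z] True by (simp add: e1_def)
          finally have "norm (E z) ^ 4 \<le> e1 ^ 4" by (intro power_mono) auto
          moreover have "norm (\<Psi> z) \<le> l1" using \<Psi>outer[OF True zc(2)] l1 by simp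
          ultimately have "norm (E z) ^ 4 * norm (\<Psi> z) \<le> e1 ^ 4 * l1"
            using e1 by (intro mult_mono) auto
          then show ?thesis using True by (simp add: G_def norm_mult norm_power mult.commute)
        next
          case False
          then have zz: "norm z < 1" "Re z = x0" using or by auto
          have "E z = 1 - z * cnj z"
          proof -
            have "2 * of_real x0 = z + cnj z" using zz by (simp add: complex_add_cnj)
            then show ?thesis by (simp add: E_def power2_eq_square algebra_simps)
          qed
          also have "\<dots> = of_real (1 - (norm z)\<^sup>2)" by (simp add: complex_norm_square[symmetric])
          finally have "norm (E z) = 1 - (norm z)\<^sup>2"
            using zz by (simp add: power_le_one abs_square_le_1 del: of_real_diff of_real_power)
          also have "\<dots> = (1 - norm z) * (1 + norm z)" by (simp add: power2_eq_square algebra_simps)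
          also have "\<dots> \<le> (1 - norm z) * 2" using zz by (intro mult_left_mono) auto
          finally have "norm (E z) ^ 4 \<le> ((1 - norm z) * 2) ^ 4" by (intro power_mono) auto
          then have "norm (E z) ^ 4 * norm (\<Psi> z) \<le> ((1 - norm z) * 2) ^ 4 * (pi * C / (1 - norm z) ^ 3)"
            using \<Psi>inner[OF zz(1)] by (intro mult_mono) auto
          also have "\<dots> = 16 * pi * C * (1 - norm z)"
          proof -
            have "(y * 2) ^ 4 * (P / y ^ 3) = 16 * P * y" if "y \<noteq> 0" for y P :: real
              using that by (simp add: power_mult_distrib field_simps eval_nat_numeral)
            from this[of "1 - norm z" "pi * C"] show ?thesis using zz by simp
          qed
          finally have "norm z ^ M * (norm (E z) ^ 4 * norm (\<Psi> z)) \<le> norm z ^ M * (16 * pi * C * (1 - norm z))"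
            by (intro mult_left_mono) auto
          also have "\<dots> = 16 * pi * C * ((1 - norm z) * norm z ^ M)" by (simp add: mult_ac)
          also have "\<dots> \<le> 16 * pi * C * (1 / (real M + 1))"
            using pow_times_one_minus_le[of "norm z" M] zz C0 by (intro mult_left_mono) auto
          also have "\<dots> \<le> l1 * e1 ^ 4" using M by simp
          finally show ?thesis by (simp add: G_def norm_mult norm_power mult_ac)
        qed
      qed
      moreover have "norm (G (of_real r)) = r ^ M * (r\<^sup>2 - 2 * x0 * r + 1) ^ 4 * polygon_length (\<gamma> (of_real r)) ts"
      proof -
        have Er: "E (of_real r) = of_real (r\<^sup>2 - 2 * x0 * r + 1)" by (simp add: E_def)
        have "norm (of_real (r\<^sup>2 - 2 * x0 * r + 1) ^ 4 :: complex) = (r\<^sup>2 - 2 * x0 * r + 1) ^ 4"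
          unfolding norm_power norm_of_real by (rule power_even_abs) simp
        then show ?thesis using r polygon_length_nonneg[of "\<gamma> (of_real r)" ts]
          unfolding G_def Er \<Psi>r by (simp add: norm_mult norm_power del: of_real_add of_real_diff of_real_mult)
      qed
      moreover have pos: "r\<^sup>2 - 2 * x0 * r + 1 > 0"
      proof -
        have "r\<^sup>2 - 2 * x0 * r + 1 = (r - x0)\<^sup>2 + (1 - x0\<^sup>2)" by (simp add: power2_eq_square algebra_simps)
        moreover have "x0\<^sup>2 < 1" using x0 by (simp add: abs_square_less_1)
        ultimately show ?thesis using zero_le_power2[of "r - x0"] by linarith
      qed
      ultimately have "polygon_length (\<gamma> (of_real r)) ts \<le> f r"
        using r by (simp add: f_def field_simps)
      then have "polygon_length (\<gamma> (of_real r)) ts \<le> l + \<epsilon>" using elim by simp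
      then show "ennreal (polygon_length (\<lambda>t. k (of_real r * cis t)) ts) \<le> ennreal (l + \<epsilon>)"
        by (intro ennreal_leI) (simp add: \<gamma>_def[abs_def])
    qed
  qed
qed


text \<open>The arc has to be slightly longer than the half circle, because the length on interior circles is controlled only away from
the ends of the arc.\<close>
lemma half_circle_length_bound:
  assumes holo: "k holomorphic_on ball 0 1" and inj: "inj_on k (ball 0 1)"
    and \<sigma>: "pi / 2 < \<sigma>" "\<sigma> < pi"
    and cont: "continuous_on (ball 0 1 \<union> cis ` {-\<sigma><..<\<sigma>}) k"
    and len: "curve_length {-\<sigma><..<\<sigma>} (\<lambda>t. k (cis t)) \<le> ennreal l" and l0: "l \<ge> 0"
  shows "norm (deriv k 0) \<le> 8 * l"
proof (rule field_le_epsilon)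
  fix e :: real assume e: "e > 0"
  define \<epsilon> where "\<epsilon> = e / 8"
  have \<epsilon>: "\<epsilon> > 0" using e by (simp add: \<epsilon>_def)
  have "\<forall>\<^sub>F r in at_left (1::real). r \<in> {0<..<1}" by (intro eventually_at_left_real) auto
  then have ev: "\<forall>\<^sub>F r in at_left (1::real). r * norm (deriv k 0) \<le> 8 * (l + \<epsilon>)"
    using interior_arc_length[OF assms \<epsilon>]
  proof eventually_elim
    case (elim r)
    then have r: "0 < r" "r < 1" by auto
    have rb: "of_real r * cis t \<in> ball 0 1" for t using r by (simp add: norm_mult)
    let ?g = "\<lambda>t. of_real r * (\<i> * cis t) * deriv k (of_real r * cis t)"
    have "ennreal (integral {-pi/2..pi/2} (\<lambda>t. norm (?g t))) \<le> curve_length {-pi/2..pi/2} (\<lambda>t. k (of_real r * cis t))"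
    proof (rule integral_speed_le_curve_length)
      show "((\<lambda>t. k (of_real r * cis t)) has_vector_derivative ?g t) (at t within {-pi/2..pi/2})" for t
      proof -
        have "((\<lambda>\<theta>. of_real r * cis \<theta>) has_vector_derivative of_real r * (\<i> * cis t)) (at t)"
          by (auto intro!: derivative_eq_intros has_vector_derivative_mult_right simp: has_vector_derivative_complex_iff)
        moreover have "(k has_field_derivative deriv k (of_real r * cis t)) (at (of_real r * cis t))"
          by (rule holomorphic_derivI[OF holo _ rb]) auto
        ultimately have "((\<lambda>t. k (of_real r * cis t)) has_vector_derivative ?g t) (at t)"
          using field_vector_diff_chain_at[of "\<lambda>\<theta>. of_real r * cis \<theta>" _ t k] by (auto simp: o_def)
        then show ?thesis by (rule has_vector_derivative_at_within)
      qed
      have "continuous_on (ball 0 1) (deriv k)"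
        by (intro holomorphic_on_imp_continuous_on holomorphic_deriv holo) auto
      then have "continuous_on {-pi/2..pi/2} (\<lambda>t. deriv k (of_real r * cis t))"
        by (rule continuous_on_compose2) (use rb in \<open>auto intro!: continuous_intros\<close>)
      then show "continuous_on {-pi/2..pi/2} ?g"
        by (intro continuous_intros)
    qed simp
    also have "\<dots> \<le> ennreal (l + \<epsilon>)" by (rule elim)
    finally have "integral {-pi/2..pi/2} (\<lambda>t. norm (?g t)) \<le> l + \<epsilon>"
      using ennreal_le_iff[of "l + \<epsilon>"] l0 \<epsilon> by (simp del: ennreal_plus)
    moreover have "integral {-pi/2..pi/2} (\<lambda>t. norm (?g t)) = r * integral {-pi/2..pi/2} (\<lambda>t. norm (deriv k (of_real r * cis t)))"
      using r by (simp add: norm_mult)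
    moreover have "r * norm (deriv k 0) \<le> r * (8 * integral {-pi/2..pi/2} (\<lambda>t. norm (deriv k (of_real r * cis t))))"
      using half_circle_derivative_bound[OF holo inj r] r by (intro mult_left_mono) auto
    ultimately show ?case by simp
  qed
  have "1 * norm (deriv k 0) \<le> 8 * (l + \<epsilon>)"
    by (rule tendsto_upperbound[OF _ ev]) (auto intro!: tendsto_eq_intros)
  then show "norm (deriv k 0) \<le> 8 * l + e" by (simp add: \<epsilon>_def)
qed

lemma cis_2_arctan: "cis (2 * arctan u) = (1 + \<i> * of_real u) / (1 - \<i> * of_real u)"
proof -
  have p: "1 + u\<^sup>2 > 0" by (simp add: add_pos_nonneg)
  have nz: "1 - \<i> * complex_of_real u \<noteq> 0" by (auto simp: complex_eq_iff)
  have "cis (arctan u) = (1 + \<i> * of_real u) / of_real (sqrt (1 + u\<^sup>2))"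
    by (simp add: complex_eq_iff cos_arctan sin_arctan)
  then have "cis (2 * arctan u) = ((1 + \<i> * of_real u) / of_real (sqrt (1 + u\<^sup>2)))\<^sup>2"
    by (metis Complex.DeMoivre of_nat_numeral)
  also have "\<dots> = (1 + \<i> * of_real u)\<^sup>2 / of_real (1 + u\<^sup>2)"
    using p by (simp add: power_divide flip: of_real_power)
  also have "of_real (1 + u\<^sup>2) = (1 + \<i> * of_real u) * (1 - \<i> * complex_of_real u)"
    by (simp add: algebra_simps power2_eq_square)
  finally show ?thesis using nz by (simp add: power2_eq_square) 
qed

lemma cis_tan_half:
  assumes "\<bar>\<theta>\<bar> < pi"
  shows "cis \<theta> = (1 + \<i> * of_real (tan (\<theta> / 2))) / (1 - \<i> * of_real (tan (\<theta> / 2)))"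
  using cis_2_arctan[of "tan (\<theta> / 2)"] assms by (simp add: arctan_tan)

text \<open>A hyperbolic translation along the real diameter carries the half circle to the arc; in terms of
\<open>tan(\<theta>/2)\<close> it is multiplication by \<open>\<kappa>\<close>. The distortion theorem compares the derivative at the new base
point \<open>\<rho>\<close> with that at 0. Here \<open>t > 1\<close> stands for \<open>tan(\<sigma>/2)\<close> and tends to 1.\<close>
lemma arc_length_bound:
  assumes holo: "h holomorphic_on ball 0 1" and inj: "inj_on h (ball 0 1)"
    and \<phi>: "0 < \<phi>" "\<phi> \<le> pi / 2"
    and cont: "continuous_on (ball 0 1 \<union> cis ` {-\<phi><..<\<phi>}) h"
    and len: "curve_length {-\<phi><..<\<phi>} (\<lambda>t. h (cis t)) \<le> ennreal l" and l0: "l \<ge> 0"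
  shows "norm (deriv h 0) * (tan (\<phi> / 2))\<^sup>2 \<le> 8 * l"
proof -
  define b where "b = tan (\<phi> / 2)"
  have b: "0 < b" "b \<le> 1"
  proof -
    show "0 < b" unfolding b_def using \<phi> by (intro tan_gt_zero) auto
    have "tan (\<phi> / 2) \<le> tan (pi / 4)" using \<phi> by (subst tan_mono_le_eq) auto
    then show "b \<le> 1" by (simp add: b_def tan_45)
  qed
  have main: "norm (deriv h 0) * b\<^sup>2 \<le> 8 * l * t\<^sup>2" if t: "t > 1" for t
  proof -
    define \<kappa> where "\<kappa> = b / t"
    have \<kappa>: "0 < \<kappa>" "\<kappa> < 1" using b t by (auto simp: \<kappa>_def divide_less_eq)
    define \<sigma> where "\<sigma> = 2 * arctan t"
    have \<sigma>: "pi / 2 < \<sigma>" "\<sigma> < pi"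
      using arctan_less_iff[of 1 t] t arctan_bounded[of t] by (auto simp: \<sigma>_def arctan_one)
    define \<rho> where "\<rho> = (1 - \<kappa>) / (1 + \<kappa>)"
    have \<rho>: "0 < \<rho>" "\<rho> < 1" using \<kappa> by (auto simp: \<rho>_def divide_less_eq)
    have "\<rho> * (1 + \<kappa>) = 1 - \<kappa>" using \<kappa> by (simp add: \<rho>_def)
    then have \<rho>\<kappa>: "1 - \<rho> = \<kappa> * (1 + \<rho>)" by algebra
    have n\<rho>: "norm (complex_of_real \<rho>) < 1" using \<rho> by simp
    define T where "T = disc_shift (of_real \<rho>)"
    have Tz: "T z = (z + of_real \<rho>) / (1 + of_real \<rho> * z)" for z by (simp add: T_def disc_shift_def)
    have den: "1 + of_real \<rho> * z \<noteq> 0" if "norm z \<le> 1" for z :: complex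
      using disc_shift_denominator[OF n\<rho> that] by simp
    note T = disc_shift_univalent[OF n\<rho>, folded T_def]
    define \<tau> where "\<tau> \<theta> = 2 * arctan (\<kappa> * tan (\<theta> / 2))" for \<theta>
    have Tcis: "T (cis \<theta>) = cis (\<tau> \<theta>)" if "\<bar>\<theta>\<bar> < pi" for \<theta>
    proof -
      define u where "u = tan (\<theta> / 2)"
      have nz: "1 - \<i> * complex_of_real u \<noteq> 0" by (auto simp: complex_eq_iff)
      have nz': "1 - \<i> * complex_of_real (\<kappa> * u) \<noteq> 0" by (auto simp: complex_eq_iff)
      have c: "cis \<theta> = (1 + \<i> * of_real u) / (1 - \<i> * of_real u)"
        using cis_tan_half[OF that] by (simp add: u_def)
      have A: "cis \<theta> + of_real \<rho> = of_real (1 + \<rho>) * (1 + \<i> * of_real (\<kappa> * u)) / (1 - \<i> * of_real u)"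
      proof -
        have "cis \<theta> + of_real \<rho> = (of_real (1 + \<rho>) + \<i> * of_real ((1 - \<rho>) * u)) / (1 - \<i> * of_real u)"
          unfolding c using nz by (simp add: field_simps)
        also have "(of_real (1 + \<rho>) + \<i> * of_real ((1 - \<rho>) * u)) = of_real (1 + \<rho>) * (1 + \<i> * of_real (\<kappa> * u))"
          unfolding \<rho>\<kappa> by (simp add: algebra_simps)
        finally show ?thesis .
      qed
      have B: "1 + of_real \<rho> * cis \<theta> = of_real (1 + \<rho>) * (1 - \<i> * of_real (\<kappa> * u)) / (1 - \<i> * of_real u)"
      proof -
        have "1 + of_real \<rho> * cis \<theta> = (of_real (1 + \<rho>) - \<i> * of_real ((1 - \<rho>) * u)) / (1 - \<i> * of_real u)"
          unfolding c using nz by (simp add: field_simps)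
        also have "(of_real (1 + \<rho>) - \<i> * of_real ((1 - \<rho>) * u)) = of_real (1 + \<rho>) * (1 - \<i> * of_real (\<kappa> * u))"
          unfolding \<rho>\<kappa> by (simp add: algebra_simps)
        finally show ?thesis .
      qed
      have "of_real (1 + \<rho>) \<noteq> (0::complex)" using \<rho> unfolding of_real_eq_0_iff by simp
      then have "T (cis \<theta>) = (1 + \<i> * of_real (\<kappa> * u)) / (1 - \<i> * of_real (\<kappa> * u))"
        unfolding Tz A B using nz nz' by (simp del: of_real_add of_real_mult)
      then show ?thesis by (simp add: \<tau>_def cis_2_arctan u_def)
    qed
    have tanb: "\<bar>tan (\<theta> / 2)\<bar> < t" if "\<theta> \<in> {-\<sigma><..<\<sigma>}" for \<theta>
    proof -
      have r: "- pi / 2 < \<theta> / 2" "\<theta> / 2 < pi / 2" using that \<sigma> by auto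
      have "tan (\<theta> / 2) < tan (\<sigma> / 2)" using that \<sigma> r by (intro tan_monotone) auto
      moreover have "tan (- \<sigma> / 2) < tan (\<theta> / 2)" using that \<sigma> r by (intro tan_monotone) auto
      moreover have "tan (\<sigma> / 2) = t" "tan (- \<sigma> / 2) = - t" by (auto simp: \<sigma>_def tan_arctan)
      ultimately show ?thesis by (simp add: abs_less_iff)
    qed
    have \<tau>r: "\<tau> \<theta> \<in> {-\<phi><..<\<phi>}" if "\<theta> \<in> {-\<sigma><..<\<sigma>}" for \<theta>
    proof -
      have "\<bar>\<kappa> * tan (\<theta> / 2)\<bar> < b"
      proof -
        have "\<kappa> * \<bar>tan (\<theta> / 2)\<bar> < \<kappa> * t" using tanb[OF that] \<kappa> by (intro mult_strict_left_mono) auto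
        also have "\<kappa> * t = b" using t by (simp add: \<kappa>_def)
        finally show ?thesis using \<kappa> by (simp add: abs_mult)
      qed
      then have "\<kappa> * tan (\<theta> / 2) < b" "- b < \<kappa> * tan (\<theta> / 2)" by (auto simp: abs_less_iff)
      then have "arctan (\<kappa> * tan (\<theta> / 2)) < arctan b" "arctan (- b) < arctan (\<kappa> * tan (\<theta> / 2))"
        unfolding arctan_less_iff by auto
      moreover have "arctan b = \<phi> / 2" unfolding b_def using \<phi> by (intro arctan_tan) auto
      ultimately show ?thesis by (simp add: \<tau>_def arctan_minus)
    qed
    have \<tau>mono: "mono_on {-\<sigma><..<\<sigma>} \<tau>"
    proof (rule mono_onI)
      fix r s assume rs: "r \<in> {-\<sigma><..<\<sigma>}" "s \<in> {-\<sigma><..<\<sigma>}" "r \<le> s"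
      then have "tan (r / 2) \<le> tan (s / 2)" using \<sigma> by (subst tan_mono_le_eq) auto
      then show "\<tau> r \<le> \<tau> s" using \<kappa> by (simp add: \<tau>_def arctan_le_iff)
    qed
    define k where "k z = h (T z)" for z
    have "norm (deriv k 0) \<le> 8 * l"
    proof (rule half_circle_length_bound[OF _ _ \<sigma>])
      show "k holomorphic_on ball 0 1" "inj_on k (ball 0 1)"
        unfolding k_def by (rule univalent_compose[OF holo inj T]; assumption)+
      show "continuous_on (ball 0 1 \<union> cis ` {-\<sigma><..<\<sigma>}) k"
        unfolding k_def
      proof (rule continuous_on_compose2[OF cont])
        show "continuous_on (ball 0 1 \<union> cis ` {-\<sigma><..<\<sigma>}) T"
          unfolding Tz[abs_def] by (intro continuous_intros) (use den in auto)
        show "T ` (ball 0 1 \<union> cis ` {-\<sigma><..<\<sigma>}) \<subseteq> ball 0 1 \<union> cis ` {-\<phi><..<\<phi>}"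
        proof -
          have "T (cis \<theta>) \<in> cis ` {-\<phi><..<\<phi>}" if "\<theta> \<in> {-\<sigma><..<\<sigma>}" for \<theta>
          proof -
            have "\<bar>\<theta>\<bar> < pi" using that \<sigma> by auto
            then show ?thesis using Tcis[of \<theta>] \<tau>r[OF that] by auto
          qed
          then show ?thesis using T(3) by blast
        qed
      qed
      have "curve_length {-\<sigma><..<\<sigma>} (\<lambda>t. k (cis t)) \<le> curve_length {-\<phi><..<\<phi>} (\<lambda>t. h (cis t))"
      proof (rule curve_length_mono_reparam[OF \<tau>mono])
        show "k (cis \<theta>) = h (cis (\<tau> \<theta>))" if "\<theta> \<in> {-\<sigma><..<\<sigma>}" for \<theta>
        proof -
          have "\<bar>\<theta>\<bar> < pi" using that \<sigma> by auto
          then show ?thesis using Tcis[of \<theta>] by (simp add: k_def)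
        qed
      qed (use \<tau>r in auto)
      then show "curve_length {-\<sigma><..<\<sigma>} (\<lambda>t. k (cis t)) \<le> ennreal l" using len by (rule order_trans)
    qed (rule l0)
    moreover have "deriv k 0 = deriv h (of_real \<rho>) * of_real (1 - \<rho>\<^sup>2)"
    proof -
      have dT: "(T has_field_derivative of_real (1 - \<rho>\<^sup>2)) (at 0)"
        unfolding Tz[abs_def] by (auto intro!: derivative_eq_intros simp: power2_eq_square)
      have "T 0 = of_real \<rho>" by (simp add: Tz)
      then have dh: "(h has_field_derivative deriv h (of_real \<rho>)) (at (T 0))"
        using holomorphic_derivI[OF holo, of "of_real \<rho>"] \<rho> by simp
      show ?thesis unfolding k_def
        by (rule DERIV_imp_deriv, rule DERIV_chain2[where f = h and g = T, OF dh dT])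
    qed
    moreover have r2: "1 - \<rho>\<^sup>2 > 0" using \<rho> by (simp add: abs_square_less_1)
    ultimately have hr: "norm (deriv h (of_real \<rho>)) * (1 - \<rho>\<^sup>2) \<le> 8 * l"
      by (simp add: norm_mult del: of_real_diff of_real_power)
    have "norm (deriv h 0) * \<kappa>\<^sup>2 \<le> norm (deriv h (of_real \<rho>)) * ((1 + \<rho>) ^ 3 / (1 - \<rho>)) * \<kappa>\<^sup>2"
      by (intro mult_right_mono distortion_radius(1)[OF holo inj]) (use \<rho> in auto)
    also have "(1 + \<rho>) ^ 3 / (1 - \<rho>) * \<kappa>\<^sup>2 = 1 - \<rho>\<^sup>2"
    proof -
      have "(1 + \<rho>) ^ 3 / (1 - \<rho>) * \<kappa>\<^sup>2 = (1 + \<rho>) * (\<kappa> * (1 + \<rho>))\<^sup>2 / (1 - \<rho>)"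
        by (simp add: power_mult_distrib eval_nat_numeral mult_ac)
      also have "\<dots> = (1 + \<rho>) * (1 - \<rho>)\<^sup>2 / (1 - \<rho>)" by (simp only: \<rho>\<kappa>)
      also have "\<dots> = (1 + \<rho>) * (1 - \<rho>)" using \<rho> by (simp add: power2_eq_square)
      also have "\<dots> = 1 - \<rho>\<^sup>2" by (simp add: power2_eq_square algebra_simps)
      finally show ?thesis .
    qed
    then have "norm (deriv h (of_real \<rho>)) * ((1 + \<rho>) ^ 3 / (1 - \<rho>)) * \<kappa>\<^sup>2 = norm (deriv h (of_real \<rho>)) * (1 - \<rho>\<^sup>2)"
      by (simp only: mult.assoc)
    finally have "norm (deriv h 0) * \<kappa>\<^sup>2 \<le> 8 * l" using hr by linarith
    then have "norm (deriv h 0) * \<kappa>\<^sup>2 * t\<^sup>2 \<le> 8 * l * t\<^sup>2" by (intro mult_right_mono) auto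
    then show ?thesis using t by (simp add: \<kappa>_def power_divide)
  qed
  have "norm (deriv h 0) * b\<^sup>2 \<le> 8 * l * 1\<^sup>2"
  proof (rule tendsto_lowerbound)
    show "((\<lambda>t. 8 * l * t\<^sup>2) \<longlongrightarrow> 8 * l * 1\<^sup>2) (at_right 1)" by (intro tendsto_intros)
    show "\<forall>\<^sub>F t in at_right 1. norm (deriv h 0) * b\<^sup>2 \<le> 8 * l * t\<^sup>2"
      by (rule eventually_mono[OF eventually_at_right_less]) (use main in auto)
  qed auto
  then show ?thesis by (simp add: b_def)
qed


text \<open>The arc estimate for a base point \<open>u + i v\<close> of the half plane: \<open>\<phi>\<close> is the angle at which the interval
is seen from this point, that is \<open>\<pi>\<close> times its harmonic measure.\<close>
lemma half_plane_length_bound: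
  fixes a b u v :: real
  assumes holo: "g holomorphic_on {w. Im w > 0}" and inj: "inj_on g {w. Im w > 0}"
    and ab: "a < b" and v: "v > 0"
    and cont: "continuous_on ({w. Im w > 0} \<union> of_real ` {a<..<b}) g"
    and len: "curve_length {a<..<b} (\<lambda>x. g (of_real x)) \<le> ennreal l" and l0: "l \<ge> 0"
    and \<phi>: "\<phi> = arctan ((b - u) / v) - arctan ((a - u) / v)" "\<phi> \<le> pi / 2"
  shows "v * norm (deriv g (Complex u v)) * (tan (\<phi> / 2))\<^sup>2 \<le> 4 * l"
proof -
  define A where "A = arctan ((a - u) / v)"
  define B where "B = arctan ((b - u) / v)"
  have AB: "- pi / 2 < A" "A < B" "B < pi / 2"
    using arctan_lbound arctan_ubound ab v by (auto simp: A_def B_def arctan_less_iff divide_strict_right_mono)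
  have \<phi>AB: "\<phi> = B - A" by (simp add: \<phi> A_def B_def)
  \<comment> \<open>The rotation by \<open>e\<close> makes the arc that corresponds to the interval symmetric about 1.\<close>
  define e where "e = cis (A + B)"
  define m where "m z = (1 - z) / (1 + z)" for z :: complex
  define \<psi> where "\<psi> z = of_real u + \<i> * of_real v * m (e * z)" for z
  have Rem: "Re (m z) > 0" if "norm z < 1" for z
  proof -
    have "1 + z \<noteq> 0" using that by (auto simp: add_eq_0_iff)
    have "Re (m z) = (1 - (norm z)\<^sup>2) / (norm (1 + z))\<^sup>2"
      unfolding m_def Re_divide cmod_power2 by (simp add: power2_eq_square algebra_simps)
    moreover have "(norm z)\<^sup>2 < 1" using that by (simp add: abs_square_less_1)
    ultimately show ?thesis using \<open>1 + z \<noteq> 0\<close> by simp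
  qed
  have ne: "norm (e * z) = norm z" for z by (simp add: e_def norm_mult)
  have nz1: "1 + e * z \<noteq> 0" if "norm z < 1" for z
    using ne[of z] that by (auto simp: add_eq_0_iff2) (metis norm_minus_cancel norm_one order_less_irrefl)
  have \<psi>Im: "Im (\<psi> z) > 0" if "z \<in> ball 0 1" for z
    using Rem[of "e * z"] that v by (simp add: \<psi>_def ne)
  have \<psi>cis: "\<psi> (cis \<theta>) = of_real (u + v * tan ((A + B + \<theta>) / 2))" 
    and nz2: "1 + e * cis \<theta> \<noteq> 0" if "\<theta> \<in> {-\<phi><..<\<phi>}" for \<theta>
  proof -
    define t where "t = tan ((A + B + \<theta>) / 2)"
    have rng: "\<bar>A + B + \<theta>\<bar> < pi" using that AB by (auto simp: \<phi>AB abs_less_iff)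
    have nz: "1 - \<i> * complex_of_real t \<noteq> 0" by (auto simp: complex_eq_iff)
    have c: "e * cis \<theta> = (1 + \<i> * of_real t) / (1 - \<i> * of_real t)"
      using cis_tan_half[OF rng] by (simp add: e_def cis_mult t_def)
    have p: "1 + e * cis \<theta> = 2 / (1 - \<i> * of_real t)" unfolding c using nz by (simp add: field_simps)
    then show "1 + e * cis \<theta> \<noteq> 0" using nz by simp
    have q: "1 - e * cis \<theta> = - 2 * \<i> * of_real t / (1 - \<i> * of_real t)" unfolding c using nz by (simp add: field_simps)
    have "m (e * cis \<theta>) = - \<i> * of_real t" unfolding m_def p q using nz by simp
    then show "\<psi> (cis \<theta>) = of_real (u + v * tan ((A + B + \<theta>) / 2))"
    proof -
      have "\<i> * of_real v * (- \<i> * of_real t) = complex_of_real (v * t)" by (simp add: complex_eq_iff)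
      then show ?thesis using \<open>m (e * cis \<theta>) = - \<i> * of_real t\<close> by (simp add: \<psi>_def flip: t_def)
    qed
  qed
  define x where "x \<theta> = u + v * tan ((A + B + \<theta>) / 2)" for \<theta>
  have xr: "x \<theta> \<in> {a<..<b}" if "\<theta> \<in> {-\<phi><..<\<phi>}" for \<theta>
  proof -
    have "A < (A + B + \<theta>) / 2" "(A + B + \<theta>) / 2 < B" using that by (auto simp: \<phi>AB)
    then have "tan A < tan ((A + B + \<theta>) / 2)" "tan ((A + B + \<theta>) / 2) < tan B"
      using AB by (auto intro!: tan_monotone)
    then have "(a - u) / v < tan ((A + B + \<theta>) / 2)" "tan ((A + B + \<theta>) / 2) < (b - u) / v"
      by (simp_all add: A_def B_def tan_arctan)
    then show ?thesis using v by (simp add: x_def divide_less_eq less_divide_eq mult.commute)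
  qed
  have xmono: "mono_on {-\<phi><..<\<phi>} x"
  proof (rule mono_onI)
    fix r s assume rs: "r \<in> {-\<phi><..<\<phi>}" "s \<in> {-\<phi><..<\<phi>}" "r \<le> s"
    then have "tan ((A + B + r) / 2) \<le> tan ((A + B + s) / 2)"
      using AB by (subst tan_mono_le_eq) (auto simp: \<phi>AB)
    then show "x r \<le> x s" using v by (simp add: x_def)
  qed
  define h where "h z = g (\<psi> z)" for z
  have \<psi>h: "\<psi> holomorphic_on ball 0 1"
    unfolding \<psi>_def m_def by (intro holomorphic_intros) (use nz1 in auto)
  have "norm (deriv h 0) * (tan (\<phi> / 2))\<^sup>2 \<le> 8 * l"
  proof (rule arc_length_bound[OF _ _ _ \<phi>(2)])
    show "h holomorphic_on ball 0 1"
      unfolding h_def by (rule holomorphic_on_compose_gen[OF \<psi>h holo, unfolded o_def]) (use \<psi>Im in auto)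
    show "inj_on h (ball 0 1)"
    proof (rule inj_onI)
      fix z w :: complex assume z: "z \<in> ball 0 1" and w: "w \<in> ball 0 1" and eq: "h z = h w"
      have "\<psi> z = \<psi> w" using inj_onD[OF inj _ ] \<psi>Im[OF z] \<psi>Im[OF w] eq by (auto simp: h_def)
      then have "m (e * z) = m (e * w)" using v by (simp add: \<psi>_def)
      then have "(1 - e * z) * (1 + e * w) = (1 - e * w) * (1 + e * z)"
        using nz1[of z] nz1[of w] z w by (simp add: m_def frac_eq_eq)
      then have "e * z = e * w" by algebra
      moreover have "e \<noteq> 0" by (simp add: e_def)
      ultimately show "z = w" by simp
    qed
    show "0 < \<phi>" using AB by (simp add: \<phi>AB)
    show "continuous_on (ball 0 1 \<union> cis ` {-\<phi><..<\<phi>}) h"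
      unfolding h_def
    proof (rule continuous_on_compose2[OF cont])
      show "continuous_on (ball 0 1 \<union> cis ` {-\<phi><..<\<phi>}) \<psi>"
        unfolding \<psi>_def m_def by (intro continuous_intros) (use nz1 nz2 in auto)
      show "\<psi> ` (ball 0 1 \<union> cis ` {-\<phi><..<\<phi>}) \<subseteq> {w. Im w > 0} \<union> of_real ` {a<..<b}"
      proof -
        have "\<psi> (cis \<theta>) \<in> of_real ` {a<..<b}" if "\<theta> \<in> {-\<phi><..<\<phi>}" for \<theta>
          using \<psi>cis[OF that] xr[OF that] by (auto simp: x_def simp del: of_real_add of_real_mult)
        then show ?thesis using \<psi>Im by blast
      qed
    qed
    have "curve_length {-\<phi><..<\<phi>} (\<lambda>t. h (cis t)) \<le> curve_length {a<..<b} (\<lambda>x. g (of_real x))"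
      by (rule curve_length_mono_reparam[OF xmono])
         (use xr \<psi>cis in \<open>auto simp: h_def x_def simp del: of_real_add of_real_mult\<close>)
    then show "curve_length {-\<phi><..<\<phi>} (\<lambda>t. h (cis t)) \<le> ennreal l" using len by (rule order_trans)
  qed (rule l0)
  moreover have "norm (deriv h 0) = 2 * v * norm (deriv g (Complex u v))"
  proof -
    have \<psi>0: "\<psi> 0 = Complex u v" by (simp add: \<psi>_def m_def complex_eq_iff)
    have d\<psi>: "(\<psi> has_field_derivative \<i> * of_real v * (- 2 * e)) (at 0)"
      unfolding \<psi>_def m_def by (auto intro!: derivative_eq_intros)
    have "open {w. Im w > 0}" by (rule open_halfspace_Im_gt)
    then have dg: "(g has_field_derivative deriv g (Complex u v)) (at (\<psi> 0))"
      unfolding \<psi>0 using holomorphic_derivI[OF holo, of "Complex u v"] v by simp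
    have "deriv h 0 = deriv g (Complex u v) * (\<i> * of_real v * (- 2 * e))"
      unfolding h_def by (rule DERIV_imp_deriv, rule DERIV_chain2[where f = g and g = \<psi>, OF dg d\<psi>])
    then show ?thesis using v by (simp add: norm_mult e_def)
  qed
  ultimately show ?thesis by simp
qed

section \<open>The lens and its conformal map onto the half plane\<close>
text \<open>The rotation by \<open>-i\<close> sends 0, 1, \<open>\<infinity>\<close> to \<open>i\<close>, -1, \<open>-i\<close>: the positive real axis becomes the left
half circle and the positive imaginary axis becomes the diameter.\<close>
definition cayley :: "complex \<Rightarrow> complex" where
  "cayley z = - \<i> * (z - \<i>) / (z + \<i>)"

text \<open>A Joukowski map. The circle \<open>|z + c|\<^sup>2 = c\<^sup>2 - 1\<close> meets the unit circle orthogonally, and the map folds it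
onto the real axis.\<close>
definition lens_map :: "real \<Rightarrow> complex \<Rightarrow> complex" where
  "lens_map c z = z + of_real c + of_real (c\<^sup>2 - 1) / (z + of_real c)"

text \<open>The product of two square roots, instead of the root of the product, selects the solution of the quadratic equation outside
the circle, both in the half plane and on the boundary interval beyond \<open>2 \<surd>(c\<^sup>2 - 1)\<close>.\<close>
definition lens_inv :: "real \<Rightarrow> complex \<Rightarrow> complex" where
  "lens_inv c w = (w + csqrt (w - of_real (2 * sqrt (c\<^sup>2 - 1))) * csqrt (w + of_real (2 * sqrt (c\<^sup>2 - 1)))) / 2 - of_real c"

text \<open>The image, under the inverse Cayley transformation, of the unit disc without \<open>\<Delta>\<close>, where \<open>c = 1/\<alpha>\<close>.\<close>
definition lens :: "real \<Rightarrow> complex set" where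
  "lens c = {z. Im z > 0 \<and> c\<^sup>2 - 1 < (norm (z + of_real c))\<^sup>2}"

lemma cayley_inj: "z + \<i> \<noteq> 0 \<Longrightarrow> w + \<i> \<noteq> 0 \<Longrightarrow> cayley z = cayley w \<Longrightarrow> z = w"
  by (simp add: cayley_def frac_eq_eq) (simp add: algebra_simps)

lemma cayley_holomorphic: "(\<And>z. z \<in> S \<Longrightarrow> z + \<i> \<noteq> 0) \<Longrightarrow> cayley holomorphic_on S"
  unfolding cayley_def by (intro holomorphic_intros) auto

lemma cayley_imaginary: "y > 0 \<Longrightarrow> cayley (\<i> * of_real y) = \<i> * of_real ((1 - y) / (1 + y))"
proof -
  assume y: "y > 0"
  have "\<i> * complex_of_real y + \<i> = \<i> * of_real (1 + y)" "\<i> * complex_of_real y - \<i> = - \<i> * of_real (1 - y)"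
    by (simp_all add: algebra_simps)
  moreover have "of_real (1 + y) \<noteq> (0::complex)" using y unfolding of_real_eq_0_iff by simp
  ultimately show ?thesis by (simp add: cayley_def divide_simps del: of_real_add of_real_diff)
qed

lemma cayley_real: "cayley (of_real x) = cis (pi / 2 + 2 * arctan x)"
proof -
  have 1: "- \<i> * (complex_of_real x - \<i>) = \<i> * (\<i> * (1 + \<i> * of_real x))"
    and 2: "complex_of_real x + \<i> = \<i> * (1 - \<i> * of_real x)"
    by (simp_all add: complex_eq_iff)
  have "cayley (of_real x) = \<i> * ((1 + \<i> * of_real x) / (1 - \<i> * of_real x))"
    unfolding cayley_def 1 2
    by (simp only: mult_divide_mult_cancel_left[OF complex_i_not_zero] times_divide_eq_right)
  then show ?thesis by (simp add: cis_mult[symmetric] cis_2_arctan)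
qed

lemma cayley_lens:
  assumes z: "z \<in> lens c"
  shows "cayley z \<in> ball 0 1" "c\<^sup>2 - 1 < (norm (cayley z - of_real c))\<^sup>2"
proof -
  define x y where "x = Re z" and "y = Im z"
  have zxy: "z = Complex x y" by (simp add: x_def y_def)
  have y: "y > 0" using z by (simp add: lens_def y_def)
  have l: "x\<^sup>2 + y\<^sup>2 + 1 + 2 * c * x > 0"
    using z unfolding lens_def cmod_power2 zxy by (simp add: power2_eq_square algebra_simps)
  define d where "d = x\<^sup>2 + (y + 1)\<^sup>2"
  have d: "d > 0" using y by (simp add: d_def add_nonneg_pos)
  have "z + \<i> \<noteq> 0" using y by (auto simp: zxy complex_eq_iff)
  have cz: "cayley z = Complex (- 2 * x / d) ((1 - x\<^sup>2 - y\<^sup>2) / d)"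
    unfolding cayley_def zxy d_def
    by (simp add: complex_eq_iff Re_divide Im_divide power2_eq_square algebra_simps)
  have n: "(norm (cayley z))\<^sup>2 = 1 - 4 * y / d"
  proof -
    have "(norm (cayley z))\<^sup>2 = (4 * x\<^sup>2 + (1 - x\<^sup>2 - y\<^sup>2)\<^sup>2) / d\<^sup>2"
      unfolding cmod_power2 cz by (simp add: power_divide power_mult_distrib add_divide_distrib)
    also have "4 * x\<^sup>2 + (1 - x\<^sup>2 - y\<^sup>2)\<^sup>2 = d * (d - 4 * y)"
      by (simp add: d_def power2_eq_square algebra_simps)
    finally show ?thesis using d by (simp add: power2_eq_square diff_divide_distrib)
  qed
  have "(norm (cayley z))\<^sup>2 < 1\<^sup>2" unfolding n using y d by simp
  then show "cayley z \<in> ball 0 1" using power2_less_imp_less[of "norm (cayley z)" 1] by simp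
  have "(norm (cayley z - of_real c))\<^sup>2 = (norm (cayley z))\<^sup>2 - 2 * c * Re (cayley z) + c\<^sup>2"
    unfolding cmod_power2 by (simp add: power2_eq_square algebra_simps)
  also have "\<dots> = c\<^sup>2 - 1 + 2 * (x\<^sup>2 + y\<^sup>2 + 1 + 2 * c * x) / d"
  proof -
    have "2 * (x\<^sup>2 + y\<^sup>2 + 1 + 2 * c * x) = 2 * d - 4 * y + 4 * c * x"
      by (simp add: d_def power2_eq_square algebra_simps)
    then have "2 * (x\<^sup>2 + y\<^sup>2 + 1 + 2 * c * x) / d = (2 * d - 4 * y + 4 * c * x) / d"
      by (simp only:)
    also have "\<dots> = 2 - 4 * y / d + 4 * c * x / d"
      using d by (simp add: add_divide_distrib diff_divide_distrib)
    finally have "2 * (x\<^sup>2 + y\<^sup>2 + 1 + 2 * c * x) / d = 2 - 4 * y / d + 4 * c * x / d" .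
    moreover have "Re (cayley z) = - 2 * x / d" by (simp add: cz)
    ultimately show ?thesis unfolding n by simp
  qed
  finally show "c\<^sup>2 - 1 < (norm (cayley z - of_real c))\<^sup>2" using l d by simp
qed

lemma lens_map_Im: "Im (lens_map c z) = Im z * (1 - (c\<^sup>2 - 1) / (norm (z + of_real c))\<^sup>2)"
  unfolding lens_map_def cmod_power2 by (simp add: Im_divide algebra_simps) (simp add: add_divide_distrib[symmetric])

lemma lens_map_upper: "z \<in> lens c \<Longrightarrow> c > 1 \<Longrightarrow> Im (lens_map c z) > 0"
  unfolding lens_map_Im lens_def by (auto intro!: mult_pos_pos simp: divide_less_eq)

lemma lens_plus_nonzero: "z \<in> lens c \<Longrightarrow> z + of_real c \<noteq> 0"
  by (auto simp: lens_def complex_eq_iff)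

lemma csqrt_first_quadrant:
  assumes "Im w > 0"
  shows "Re (csqrt w) > 0" "Im (csqrt w) > 0"
proof -
  have "2 * Re (csqrt w) * Im (csqrt w) > 0"
    using assms power2_csqrt[of w] by (metis Im_power2)
  then show "Re (csqrt w) > 0" "Im (csqrt w) > 0"
    using Re_csqrt[of w] by (auto simp: zero_less_mult_iff)
qed

lemma lens_inv_root:
  assumes c: "c > 1"
  defines "Z w \<equiv> lens_inv c w + of_real c"
  shows "(Z w)\<^sup>2 - w * Z w + of_real (c\<^sup>2 - 1) = 0"
proof -
  define r where "r = sqrt (c\<^sup>2 - 1)"
  have r2: "r\<^sup>2 = c\<^sup>2 - 1" using c by (simp add: r_def one_le_power)
  define s where "s = csqrt (w - of_real (2 * r)) * csqrt (w + of_real (2 * r))"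
  have s2: "s\<^sup>2 = w\<^sup>2 - 4 * of_real (r\<^sup>2)"
    unfolding s_def power_mult_distrib power2_csqrt by (simp add: power2_eq_square algebra_simps)
  have Zw: "Z w = (w + s) / 2" by (simp add: Z_def lens_inv_def s_def r_def)
  have "(Z w)\<^sup>2 - w * Z w = (s\<^sup>2 - w\<^sup>2) / 4"
    unfolding Zw by (simp add: power2_eq_square field_simps)
  then show ?thesis unfolding s2 r2[symmetric] by simp
qed

lemma lens_inv_upper:
  assumes c: "c > 1" and w: "Im w > 0"
  shows "lens_inv c w \<in> lens c" "lens_map c (lens_inv c w) = w"
proof -
  define r where "r = sqrt (c\<^sup>2 - 1)"
  define Z where "Z = lens_inv c w + of_real c"
  have ImZ: "Im Z > 0"
  proof -
    have "Im (csqrt (w - of_real (2 * r)) * csqrt (w + of_real (2 * r))) > 0"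
      using csqrt_first_quadrant[of "w - of_real (2 * r)"] csqrt_first_quadrant[of "w + of_real (2 * r)"] w
      by (simp add: add_pos_pos)
    then show ?thesis using w by (simp add: Z_def lens_inv_def r_def)
  qed
  then have Z0: "Z \<noteq> 0" by auto
  have "Z\<^sup>2 - w * Z + of_real (c\<^sup>2 - 1) = 0" unfolding Z_def by (rule lens_inv_root[OF c])
  then have "w * Z = Z\<^sup>2 + of_real (c\<^sup>2 - 1)" by algebra
  then have wZ: "w = Z + of_real (c\<^sup>2 - 1) / Z" using Z0 by (simp add: field_simps power2_eq_square)
  then show J: "lens_map c (lens_inv c w) = w" by (simp add: lens_map_def Z_def)
  have "Im (lens_inv c w) > 0" using ImZ by (simp add: Z_def)
  moreover have "0 < Im (lens_inv c w) * (1 - (c\<^sup>2 - 1) / (norm Z)\<^sup>2)"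
    using w J lens_map_Im[of c "lens_inv c w"] by (simp add: Z_def)
  ultimately have "(c\<^sup>2 - 1) / (norm Z)\<^sup>2 < 1" by (simp add: zero_less_mult_iff)
  then have "c\<^sup>2 - 1 < (norm Z)\<^sup>2" using Z0 by (simp add: divide_less_eq)
  then show "lens_inv c w \<in> lens c" using \<open>Im (lens_inv c w) > 0\<close> by (simp add: lens_def Z_def)
qed

text \<open>The product of the two solutions of the quadratic equation is \<open>c\<^sup>2 - 1 > 0\<close>, so that only one of them lies in the
upper half plane.\<close>
lemma lens_inv_map:
  assumes c: "c > 1" and z: "z \<in> lens c"
  shows "lens_inv c (lens_map c z) = z"
proof -
  define w where "w = lens_map c z"
  define Z where "Z = lens_inv c w + of_real c"
  define Y where "Y = z + of_real c"
  have w: "Im w > 0" unfolding w_def by (rule lens_map_upper[OF z c])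
  have Y0: "Y \<noteq> 0" using lens_plus_nonzero[OF z] by (simp add: Y_def)
  have "w = Y + of_real (c\<^sup>2 - 1) / Y" by (simp add: w_def lens_map_def Y_def)
  then have "w * Y = Y\<^sup>2 + of_real (c\<^sup>2 - 1)" using Y0 by (simp add: field_simps power2_eq_square)
  moreover have "Z\<^sup>2 - w * Z + of_real (c\<^sup>2 - 1) = 0" unfolding Z_def by (rule lens_inv_root[OF c])
  ultimately have "(Z - Y) * (Z * Y - of_real (c\<^sup>2 - 1)) = 0" by algebra
  moreover have "Z * Y - of_real (c\<^sup>2 - 1) \<noteq> 0"
  proof
    assume "Z * Y - of_real (c\<^sup>2 - 1) = 0"
    then have "Z = of_real (c\<^sup>2 - 1) / Y" using Y0 by (simp add: field_simps)
    then have "Im Z = - ((c\<^sup>2 - 1) * Im Y / (norm Y)\<^sup>2)" by (simp add: Im_divide cmod_power2)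
    also have "\<dots> < 0"
    proof -
      have "c\<^sup>2 > 1" using c by simp
      moreover have "Im Y > 0" using z by (simp add: Y_def lens_def)
      ultimately show ?thesis using Y0 by simp
    qed
    finally have "Im Z < 0" .
    moreover have "Im Z > 0" using lens_inv_upper(1)[OF c w] by (simp add: Z_def lens_def)
    ultimately show False by simp
  qed
  ultimately have "Z = Y" by simp
  then show ?thesis by (simp add: Z_def Y_def w_def)
qed

definition lens_real :: "real \<Rightarrow> real \<Rightarrow> real" where
  "lens_real c x = x + c + (c\<^sup>2 - 1) / (x + c)"

lemma lens_real_lower:
  assumes c: "c > 1" and x: "x > 0"
  shows "lens_real c x > 2 * sqrt (c\<^sup>2 - 1)"
    and "lens_inv c (of_real (lens_real c x)) = of_real x"
proof -
  define r where "r = sqrt (c\<^sup>2 - 1)"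
  have c2: "c\<^sup>2 > 1" using c by simp
  have r2: "c\<^sup>2 - 1 = r\<^sup>2" using c2 by (simp add: r_def)
  have r0: "r \<ge> 0" using c2 by (simp add: r_def)
  have "r < c" by (rule power2_less_imp_less) (use c r2 in auto)
  define Z where "Z = x + c"
  have Z: "Z > r" "Z > 0" using \<open>r < c\<close> x c by (auto simp: Z_def)
  have w: "lens_real c x = Z + r\<^sup>2 / Z" by (simp add: lens_real_def Z_def r2)
  have m: "lens_real c x - 2 * r = (Z - r)\<^sup>2 / Z" and p: "lens_real c x + 2 * r = (Z + r)\<^sup>2 / Z"
    unfolding w using Z by (simp_all add: field_simps power2_eq_square)
  have "(Z - r)\<^sup>2 / Z > 0" using Z by simp
  then show "lens_real c x > 2 * sqrt (c\<^sup>2 - 1)" using m by (simp add: r_def)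
  have sm: "csqrt (of_real (lens_real c x) - of_real (2 * r)) = of_real ((Z - r) / sqrt Z)"
  proof -
    have "csqrt (of_real (lens_real c x) - of_real (2 * r)) = csqrt (of_real ((Z - r)\<^sup>2 / Z))"
      unfolding of_real_diff[symmetric] m ..
    also have "\<dots> = of_real (sqrt ((Z - r)\<^sup>2 / Z))" by (rule csqrt_of_real) (use Z in auto)
    also have "sqrt ((Z - r)\<^sup>2 / Z) = (Z - r) / sqrt Z" using Z by (simp add: real_sqrt_divide)
    finally show ?thesis .
  qed
  have sp: "csqrt (of_real (lens_real c x) + of_real (2 * r)) = of_real ((Z + r) / sqrt Z)"
  proof -
    have "csqrt (of_real (lens_real c x) + of_real (2 * r)) = csqrt (of_real ((Z + r)\<^sup>2 / Z))"
      unfolding of_real_add[symmetric] p ..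
    also have "\<dots> = of_real (sqrt ((Z + r)\<^sup>2 / Z))" by (rule csqrt_of_real) (use Z in auto)
    also have "sqrt ((Z + r)\<^sup>2 / Z) = (Z + r) / sqrt Z" using Z r0 by (simp add: real_sqrt_divide)
    finally show ?thesis .
  qed
  have "lens_inv c (of_real (lens_real c x)) = of_real ((lens_real c x + (Z - r) / sqrt Z * ((Z + r) / sqrt Z)) / 2 - c)"
    unfolding lens_inv_def r_def[symmetric] sm sp
    by (simp only: of_real_add of_real_mult of_real_diff of_real_divide of_real_numeral)
  also have "(Z - r) / sqrt Z * ((Z + r) / sqrt Z) = (Z\<^sup>2 - r\<^sup>2) / Z"
    using Z by (simp add: power2_eq_square algebra_simps)
  also have "(lens_real c x + (Z\<^sup>2 - r\<^sup>2) / Z) / 2 - c = x"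
    unfolding w using Z by (simp add: Z_def[symmetric] field_simps power2_eq_square) (simp add: Z_def algebra_simps)
  finally show "lens_inv c (of_real (lens_real c x)) = of_real x" .
qed

lemma lens_real_strict_mono:
  assumes c: "c > 1" and x: "0 < x" "x < y"
  shows "lens_real c x < lens_real c y"
proof -
  have "lens_real c y - lens_real c x = (y - x) * (1 - (c\<^sup>2 - 1) / ((x + c) * (y + c)))"
  proof -
    define k where "k = c\<^sup>2 - 1"
    have "k / (y + c) - k / (x + c) = (k * (x + c) - k * (y + c)) / ((y + c) * (x + c))"
      by (rule diff_frac_eq) (use c x in auto)
    also have "k * (x + c) - k * (y + c) = - ((y - x) * k)" by (simp add: algebra_simps)
    also have "- ((y - x) * k) / ((y + c) * (x + c)) = - ((y - x) * (k / ((x + c) * (y + c))))"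
      by (simp add: mult.commute)
    finally show ?thesis unfolding lens_real_def k_def[symmetric] by (simp add: right_diff_distrib)
  qed
  moreover have "(c\<^sup>2 - 1) / ((x + c) * (y + c)) < 1"
  proof -
    have "c * c < (x + c) * (y + c)" using c x by (intro mult_strict_mono) auto
    then show ?thesis using c x by (simp add: divide_less_eq power2_eq_square)
  qed
  ultimately have "lens_real c y - lens_real c x > 0" using x by simp
  then show ?thesis by simp
qed

lemma lens_real_surj:
  assumes c: "c > 1" and x: "0 < x1" "x1 < x2" and w: "w \<in> {lens_real c x1<..<lens_real c x2}"
  obtains x where "x \<in> {x1<..<x2}" "w = lens_real c x"
proof -
  have "continuous_on {x1..x2} (lens_real c)"
    unfolding lens_real_def using c x by (intro continuous_intros) auto
  then have "\<exists>x\<ge>x1. x \<le> x2 \<and> lens_real c x = w"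
    using w x by (intro IVT') auto
  then obtain x where "x1 \<le> x" "x \<le> x2" "lens_real c x = w" by blast
  then show ?thesis using w that[of x] by (metis greaterThanLessThan_iff less_irrefl order_le_less)
qed

lemma lens_inv_holomorphic: "c > 1 \<Longrightarrow> lens_inv c holomorphic_on {w. Im w > 0}"
  unfolding lens_inv_def
  by (intro holomorphic_intros) (auto simp: complex_nonpos_Reals_iff)

lemma lens_inv_continuous:
  assumes c: "c > 1"
  shows "continuous_on ({w. Im w > 0} \<union> of_real ` {2 * sqrt (c\<^sup>2 - 1)<..}) (lens_inv c)"
proof -
  define R where "R = 2 * sqrt (c\<^sup>2 - 1)"
  have R: "R \<ge> 0" using c by (simp add: R_def one_le_power)
  show ?thesis
    unfolding lens_inv_def R_def[symmetric]
    by (intro continuous_intros continuous_on_compose2[OF continuous_on_csqrt])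
       (use R in \<open>auto simp: complex_nonpos_Reals_iff\<close>)
qed

text \<open>The left factor is the modulus of the derivative of the map at \<open>i y\<close>. The quotient of the hyperbolic densities of the lens and of the
half plane is \<open>\<surd>((1 - y\<^sup>2)\<^sup>2 + 4 c\<^sup>2 y\<^sup>2) / (1 + y\<^sup>2)\<close>, which is largest at
\<open>y = 1\<close>, with value \<open>c\<close>.\<close>
lemma lens_map_speed:
  assumes c: "c > 1" and y: "y > 0"
  shows "y * norm (1 - of_real (c\<^sup>2 - 1) / (\<i> * of_real y + of_real c)\<^sup>2) \<le> c * Im (lens_map c (\<i> * of_real y))"
proof -
  define d where "d = c\<^sup>2 + y\<^sup>2"
  have d: "d > 0" using c by (simp add: d_def add_pos_nonneg)
  define Y where "Y = \<i> * of_real y + complex_of_real c"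
  have nY: "(norm Y)\<^sup>2 = d" by (simp add: Y_def cmod_power2 d_def)
  have Y0: "Y \<noteq> 0" using nY d by auto
  have "1 - of_real (c\<^sup>2 - 1) / Y\<^sup>2 = (Y\<^sup>2 - of_real (c\<^sup>2 - 1)) / Y\<^sup>2" using Y0 by (simp add: diff_divide_distrib)
  then have 1: "norm (1 - of_real (c\<^sup>2 - 1) / Y\<^sup>2) = norm (Y\<^sup>2 - of_real (c\<^sup>2 - 1)) / d"
    by (simp add: norm_divide norm_power nY)
  have "Y\<^sup>2 - of_real (c\<^sup>2 - 1) = Complex (1 - y\<^sup>2) (2 * c * y)"
    by (simp add: Y_def complex_eq_iff power2_eq_square algebra_simps)
  then have "(norm (Y\<^sup>2 - of_real (c\<^sup>2 - 1)))\<^sup>2 = (1 - y\<^sup>2)\<^sup>2 + (2 * c * y)\<^sup>2"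
    by (simp only: cmod_power2 complex.sel)
  also have "\<dots> \<le> (c * (1 + y\<^sup>2))\<^sup>2"
  proof -
    have "(c * (1 + y\<^sup>2))\<^sup>2 - ((1 - y\<^sup>2)\<^sup>2 + (2 * c * y)\<^sup>2) = (c\<^sup>2 - 1) * (1 - y\<^sup>2)\<^sup>2"
      by (simp add: power2_eq_square algebra_simps)
    moreover have "(c\<^sup>2 - 1) * (1 - y\<^sup>2)\<^sup>2 \<ge> 0" using c by (intro mult_nonneg_nonneg) (auto simp: one_le_power)
    ultimately show ?thesis by linarith
  qed
  finally have 2: "norm (Y\<^sup>2 - of_real (c\<^sup>2 - 1)) \<le> c * (1 + y\<^sup>2)"
    by (rule power2_le_imp_le) (use c in auto)
  have 3: "Im (lens_map c (\<i> * of_real y)) = y * (1 + y\<^sup>2) / d"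
  proof -
    have "1 - (c\<^sup>2 - 1) / d = (d - (c\<^sup>2 - 1)) / d" using d by (simp add: diff_divide_distrib)
    also have "d - (c\<^sup>2 - 1) = 1 + y\<^sup>2" by (simp add: d_def)
    finally show ?thesis unfolding lens_map_Im Y_def[symmetric] nY by simp
  qed
  have "y * (norm (Y\<^sup>2 - of_real (c\<^sup>2 - 1)) / d) \<le> y * (c * (1 + y\<^sup>2) / d)"
    using 2 y d by (intro mult_left_mono divide_right_mono) auto
  then show ?thesis unfolding 3 Y_def[symmetric] 1 by (simp add: mult_ac)
qed

section \<open>The angle at which a boundary interval of the lens is seen\<close>
lemma arccot_eq_arctan:
  assumes x: "x > 0"
  shows "arccot x = arctan (1 / x)"
  unfolding arccot_def
proof (rule the_equality)
  show "0 < arctan (1 / x) \<and> arctan (1 / x) < pi / 2 \<and> cot (arctan (1 / x)) = x"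
    using x arctan_ubound[of "1 / x"] by (simp add: cot_altdef tan_arctan)
next
  fix y assume y: "0 < y \<and> y < pi / 2 \<and> cot y = x"
  then have "tan y = 1 / x" by (auto simp: cot_altdef field_simps)
  then show "y = arctan (1 / x)" using y arctan_unique[of y "1 / x"] by auto
qed

lemma tan_double_ge:
  assumes "0 < s" "s < pi / 4"
  shows "2 * tan s \<le> tan (2 * s)"
proof -
  have t: "0 < tan s" "tan s < 1"
    using assms tan_monotone[of s "pi/4"] by (auto simp: tan_45 intro: tan_gt_zero)
  have "(tan s)\<^sup>2 < 1" using t by (simp add: abs_square_less_1)
  have "cos s \<noteq> 0" "cos (2 * s) \<noteq> 0"
    using assms cos_gt_zero[of s] cos_gt_zero[of "2 * s"] by auto
  then have "tan (2 * s) = 2 * tan s / (1 - (tan s)\<^sup>2)" by (rule tan_double)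
  moreover have "2 * tan s / 1 \<le> 2 * tan s / (1 - (tan s)\<^sup>2)"
    using t \<open>(tan s)\<^sup>2 < 1\<close> by (intro divide_left_mono) auto
  ultimately show ?thesis by simp
qed

text \<open>The hypotheses describe an angle \<open>arctan B - arctan A\<close> whose cotangent is positive and at most \<open>X\<close>.\<close>
lemma arctan_difference_ge_arccot:
  assumes AB: "A < B" and pos: "1 + A * B > 0" and X: "(1 + A * B) / (B - A) \<le> X"
  shows "arctan B - arctan A \<le> pi / 2" "arccot X \<le> arctan B - arctan A" "0 < arccot X" "arccot X < pi / 2"
proof -
  define \<phi> where "\<phi> = arctan B - arctan A"
  define s where "s = sqrt (1 + B\<^sup>2) * sqrt (1 + A\<^sup>2)"
  have s: "s > 0" by (simp add: s_def add_pos_nonneg)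
  have c: "cos \<phi> = (1 + A * B) / s"
    by (simp add: \<phi>_def s_def cos_diff cos_arctan sin_arctan add_divide_distrib mult.commute)
  have sn: "sin \<phi> = (B - A) / s"
    by (simp add: \<phi>_def s_def sin_diff cos_arctan sin_arctan diff_divide_distrib)
  have \<phi>: "0 < \<phi>" "\<phi> < pi"
    using AB arctan_lbound[of A] arctan_ubound[of B] by (auto simp: \<phi>_def arctan_less_iff)
  have "cos \<phi> > 0" using c s pos by simp
  have \<phi>2: "\<phi> < pi / 2"
  proof (rule ccontr)
    assume "\<not> \<phi> < pi / 2"
    then have "cos \<phi> \<le> cos (pi / 2)" using \<phi> by (subst cos_mono_le_eq) auto
    then show False using \<open>cos \<phi> > 0\<close> by simp
  qed
  have X0: "X > 0"
  proof -
    have "(1 + A * B) / (B - A) > 0" using pos AB by simp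
    then show ?thesis using X by linarith
  qed
  have "1 / X \<le> tan \<phi>"
  proof -
    have "tan \<phi> = (B - A) / (1 + A * B)" unfolding tan_def c sn using s by simp
    moreover have "1 / X \<le> (B - A) / (1 + A * B)"
      using X X0 pos AB by (simp add: field_simps)
    ultimately show ?thesis by simp
  qed
  then have "arctan (1 / X) \<le> arctan (tan \<phi>)" by (simp add: arctan_le_iff)
  also have "arctan (tan \<phi>) = \<phi>" using \<phi> \<phi>2 by (intro arctan_tan) auto
  finally show "arccot X \<le> arctan B - arctan A" using X0 by (simp add: arccot_eq_arctan \<phi>_def)
  show "arctan B - arctan A \<le> pi / 2" using \<phi>2 by (simp add: \<phi>_def)
  show "0 < arccot X" "arccot X < pi / 2" using X0 arctan_ubound[of "1 / X"] by (auto simp: arccot_eq_arctan)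
qed

text \<open>The argument of the inverse cotangent in \<open>N\<^sub>p(q)\<close>, written in terms of \<open>c = 1/\<alpha>\<close>.\<close>
definition angle_bound :: "real \<Rightarrow> real \<Rightarrow> real" where
  "angle_bound c q = (q + 1) / (q - 1) + (c\<^sup>2 - 1) * (1 + q\<^sup>2) / ((q - 1) * (2 * sqrt q + (1 + q) * c))"

text \<open>The cotangent of the angle at which the image of the interval from \<open>x1\<close> to \<open>x2\<close> is seen from the image of \<open>i y\<close>. The
first summand on the right is the value for the full half plane, where no disc is removed.\<close>
lemma lens_cotangent_identity:
  fixes c y x1 x2 :: real
  assumes c: "c > 1" and x: "0 < x1" "x1 < x2" and y: "y > 0"
  defines "u \<equiv> Re (lens_map c (\<i> * of_real y))" and "v \<equiv> Im (lens_map c (\<i> * of_real y))"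
    and "a \<equiv> lens_real c x1" and "b \<equiv> lens_real c x2"
    and "P \<equiv> x1 * x2" and "K \<equiv> 1 + c * (x1 + x2) + x1 * x2"
  shows "(v\<^sup>2 + (a - u) * (b - u)) / (v * (b - a)) =
      (P + y\<^sup>2) / (y * (x2 - x1)) + (c\<^sup>2 - 1) * ((P + y\<^sup>2)\<^sup>2 + y\<^sup>2 * (x2 - x1)\<^sup>2) / (y * (1 + y\<^sup>2) * (x2 - x1) * K)"
proof -
  define d where "d = c\<^sup>2 + y\<^sup>2"
  have d: "d > 0" using c by (simp add: d_def add_pos_nonneg)
  define r where "r = c\<^sup>2 - 1"
  define s1 where "s1 = x1 + c"
  define s2 where "s2 = x2 + c"
  have s: "s1 > 0" "s2 > 0" using c x by (auto simp: s1_def s2_def)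
  have y2: "1 + y\<^sup>2 > 0" by (simp add: add_pos_nonneg)
  have K: "K > 0" using c x by (simp add: K_def add_pos_pos)
  have u: "u = c + r * c / d"
    unfolding u_def lens_map_def by (simp add: Re_divide d_def r_def)
  have v: "v = y * (1 + y\<^sup>2) / d"
  proof -
    have "v = y - r * y / d" unfolding v_def lens_map_def by (simp add: Im_divide d_def r_def)
    also have "\<dots> = (y * d - r * y) / d" using d by (simp add: diff_divide_distrib)
    also have "y * d - r * y = y * (1 + y\<^sup>2)" by (simp add: d_def r_def algebra_simps)
    finally show ?thesis .
  qed
  have common: "x + r / t - r * c / d = (x * t * d + r * (d - c * t)) / (t * d)" if "t > 0" for x t :: real
    using that d by (simp add: field_simps)
  have a: "a - u = (x1 * s1 * d + r * (d - c * s1)) / (s1 * d)"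
    using common[OF s(1), of x1] by (simp add: a_def lens_real_def u s1_def r_def)
  have b: "b - u = (x2 * s2 * d + r * (d - c * s2)) / (s2 * d)"
    using common[OF s(2), of x2] by (simp add: b_def lens_real_def u s2_def r_def)
  have ba: "b - a = (x2 - x1) * K / (s1 * s2)"
  proof -
    have "b - a = (x2 - x1) + (r / s2 - r / s1)" by (simp add: a_def b_def lens_real_def s1_def s2_def r_def)
    also have "r / s2 - r / s1 = (r * s1 - r * s2) / (s2 * s1)" using s by (intro diff_frac_eq) auto
    also have "(x2 - x1) + (r * s1 - r * s2) / (s2 * s1) = ((x2 - x1) * (s1 * s2) + (r * s1 - r * s2)) / (s1 * s2)"
      using s by (simp add: add_divide_distrib mult.commute)
    also have "(x2 - x1) * (s1 * s2) + (r * s1 - r * s2) = (x2 - x1) * K"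
      by (simp add: s1_def s2_def r_def K_def power2_eq_square algebra_simps)
    finally show ?thesis .
  qed
  define N where "N = (P + y\<^sup>2) * (K * (1 + y\<^sup>2) + r * (P + y\<^sup>2)) + r * y\<^sup>2 * (x2 - x1)\<^sup>2"
  have num: "v\<^sup>2 + (a - u) * (b - u) = N / (s1 * s2 * d)"
  proof -
    have "v\<^sup>2 + (a - u) * (b - u) = ((y * (1 + y\<^sup>2))\<^sup>2 * (s1 * s2) + (x1 * s1 * d + r * (d - c * s1)) * (x2 * s2 * d + r * (d - c * s2))) / (s1 * s2 * d * d)"
    proof -
      have "(w / d)\<^sup>2 + m / (s1 * d) * (n / (s2 * d)) = (w\<^sup>2 * (s1 * s2) + m * n) / (s1 * s2 * d * d)" for w m n
        using s d by (simp add: field_simps power2_eq_square)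
      then show ?thesis unfolding v a b .
    qed
    also have "(y * (1 + y\<^sup>2))\<^sup>2 * (s1 * s2) + (x1 * s1 * d + r * (d - c * s1)) * (x2 * s2 * d + r * (d - c * s2)) = N * d"
      unfolding N_def s1_def s2_def d_def r_def P_def K_def by algebra
    finally show ?thesis using d by simp
  qed
  have den: "v * (b - a) = y * (1 + y\<^sup>2) * (x2 - x1) * K / (s1 * s2 * d)"
    unfolding v ba by (simp add: mult_ac)
  have "(v\<^sup>2 + (a - u) * (b - u)) / (v * (b - a)) = N / (y * (1 + y\<^sup>2) * (x2 - x1) * K)"
    unfolding num den using s d by simp
  also have "\<dots> = (P + y\<^sup>2) * (K * (1 + y\<^sup>2)) / (y * (1 + y\<^sup>2) * (x2 - x1) * K) + r * ((P + y\<^sup>2)\<^sup>2 + y\<^sup>2 * (x2 - x1)\<^sup>2) / (y * (1 + y\<^sup>2) * (x2 - x1) * K)"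
    unfolding add_divide_distrib[symmetric] N_def by (simp add: power2_eq_square algebra_simps)
  also have "(P + y\<^sup>2) * (K * (1 + y\<^sup>2)) / (y * (1 + y\<^sup>2) * (x2 - x1) * K) = (P + y\<^sup>2) / (y * (x2 - x1))"
  proof -
    have "(P + y\<^sup>2) * (K * (1 + y\<^sup>2)) / (y * (1 + y\<^sup>2) * (x2 - x1) * K) = ((P + y\<^sup>2) * (K * (1 + y\<^sup>2))) / ((y * (x2 - x1)) * (K * (1 + y\<^sup>2)))"
      by (simp only: mult_ac)
    then show ?thesis using K y2 by simp
  qed
  finally show ?thesis by (simp only: r_def)
qed

text \<open>For \<open>y\<close> in the interval, \<open>y + P/y\<close> is at most its value at the endpoints. The remaining dependence on the
position \<open>x1\<close> of the interval is removed by the two inequalities \<open>2 y \<le> 1 + y\<^sup>2\<close> and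
\<open>2 \<surd>q x1 \<le> 1 + q x1\<^sup>2\<close> between arithmetic and geometric means.\<close>
lemma lens_cotangent_bound:
  fixes c y x1 q :: real
  assumes c: "c > 1" and x: "0 < x1" and q: "1 < q" and y: "x1 \<le> y" "y \<le> q * x1"
  defines "P \<equiv> x1 * (q * x1)" and "K \<equiv> 1 + c * (x1 + q * x1) + x1 * (q * x1)" and "d \<equiv> q * x1 - x1"
  shows "(P + y\<^sup>2) / (y * d) + (c\<^sup>2 - 1) * ((P + y\<^sup>2)\<^sup>2 + y\<^sup>2 * d\<^sup>2) / (y * (1 + y\<^sup>2) * d * K) \<le> angle_bound c q"
proof -
  define S where "S = (1 + q) * x1"
  have y0: "y > 0" using x y by linarith
  have dq: "d = (q - 1) * x1" by (simp add: d_def algebra_simps)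
  have d0: "d > 0" using x q by (simp add: dq)
  have c2: "c\<^sup>2 - 1 > 0" using c by simp
  have y2: "1 + y\<^sup>2 > 0" by (simp add: add_pos_nonneg)
  have P0: "P > 0" using x q by (simp add: P_def)
  have K0: "K > 0" unfolding K_def using c x q by (intro add_pos_pos mult_pos_pos) auto
  have PS: "P + y\<^sup>2 \<le> S * y"
  proof -
    have "(y - x1) * (q * x1 - y) \<ge> 0" using y by simp
    then show ?thesis by (simp add: P_def S_def power2_eq_square algebra_simps)
  qed
  have 1: "(P + y\<^sup>2) / (y * d) \<le> (q + 1) / (q - 1)"
  proof -
    have "(P + y\<^sup>2) / (y * d) \<le> (S * y) / (y * d)" using PS y0 d0 by (intro divide_right_mono) auto
    also have "\<dots> = S / d" using y0 by simp
    also have "\<dots> = (q + 1) / (q - 1)" using x by (simp add: S_def dq)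
    finally show ?thesis .
  qed
  have sq: "(P + y\<^sup>2)\<^sup>2 + y\<^sup>2 * d\<^sup>2 \<le> y\<^sup>2 * (2 * x1\<^sup>2 * (1 + q\<^sup>2))"
  proof -
    have "(P + y\<^sup>2)\<^sup>2 \<le> (S * y)\<^sup>2" using PS P0 by (intro power_mono) auto
    moreover have "(S * y)\<^sup>2 + y\<^sup>2 * d\<^sup>2 = y\<^sup>2 * (2 * x1\<^sup>2 * (1 + q\<^sup>2))"
      by (simp add: S_def dq power2_eq_square algebra_simps)
    ultimately show ?thesis by linarith
  qed
  have KK: "x1 * (2 * sqrt q + (1 + q) * c) \<le> K"
  proof -
    have "(sqrt q * x1 - 1)\<^sup>2 \<ge> 0" by simp
    then have "2 * sqrt q * x1 \<le> 1 + (sqrt q)\<^sup>2 * x1\<^sup>2" by (simp add: power2_eq_square algebra_simps)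
    then have "2 * sqrt q * x1 \<le> 1 + q * x1\<^sup>2" using q by simp
    then show ?thesis by (simp add: K_def power2_eq_square algebra_simps)
  qed
  have 2: "((P + y\<^sup>2)\<^sup>2 + y\<^sup>2 * d\<^sup>2) / (y * (1 + y\<^sup>2) * d * K) \<le> (1 + q\<^sup>2) / ((q - 1) * (2 * sqrt q + (1 + q) * c))"
  proof -
    have "((P + y\<^sup>2)\<^sup>2 + y\<^sup>2 * d\<^sup>2) / (y * (1 + y\<^sup>2) * d * K) \<le> y\<^sup>2 * (2 * x1\<^sup>2 * (1 + q\<^sup>2)) / (y * (1 + y\<^sup>2) * d * K)"
      using sq y0 y2 d0 K0 by (intro divide_right_mono) auto
    also have "\<dots> = (2 * y / (1 + y\<^sup>2)) * (x1\<^sup>2 * (1 + q\<^sup>2) / (d * K))"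
      using y0 by (simp add: power2_eq_square)
    also have "\<dots> \<le> 1 * (x1\<^sup>2 * (1 + q\<^sup>2) / (d * K))"
    proof (rule mult_right_mono)
      have "(y - 1)\<^sup>2 \<ge> 0" by simp
      then have "2 * y \<le> 1 + y\<^sup>2" by (simp add: power2_eq_square algebra_simps)
      then show "2 * y / (1 + y\<^sup>2) \<le> 1" using y2 by (simp add: divide_le_eq)
      show "0 \<le> x1\<^sup>2 * (1 + q\<^sup>2) / (d * K)" using d0 K0 by simp
    qed
    also have "\<dots> \<le> x1\<^sup>2 * (1 + q\<^sup>2) / (d * (x1 * (2 * sqrt q + (1 + q) * c)))"
      unfolding mult_1
    proof (rule divide_left_mono)
      show "d * (x1 * (2 * sqrt q + (1 + q) * c)) \<le> d * K" using KK d0 by (intro mult_left_mono) auto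
      have "0 < d * (x1 * (2 * sqrt q + (1 + q) * c))" using d0 x q c by (intro mult_pos_pos add_pos_pos) auto
      then show "0 < (d * K) * (d * (x1 * (2 * sqrt q + (1 + q) * c)))" using d0 K0 by simp
    qed simp
    also have "\<dots> = (1 + q\<^sup>2) / ((q - 1) * (2 * sqrt q + (1 + q) * c))"
      using x by (simp add: dq power2_eq_square)
    finally show ?thesis .
  qed
  have "(c\<^sup>2 - 1) * ((P + y\<^sup>2)\<^sup>2 + y\<^sup>2 * d\<^sup>2) / (y * (1 + y\<^sup>2) * d * K) \<le> (c\<^sup>2 - 1) * (1 + q\<^sup>2) / ((q - 1) * (2 * sqrt q + (1 + q) * c))"
    using mult_left_mono[OF 2, of "c\<^sup>2 - 1"] c2 by simp
  then show ?thesis using 1 unfolding angle_bound_def by linarith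
qed

section \<open>The upper bound\<close>
lemma alpha_inverse:
  assumes "0 < p" "p < 1"
  shows "inverse (alpha p) = (1 + p\<^sup>2) / (2 * p)" "inverse (alpha p) > 1"
    "(inverse (alpha p))\<^sup>2 - 1 = (1 - p\<^sup>2)\<^sup>2 / (4 * p\<^sup>2)"
proof -
  show 1: "inverse (alpha p) = (1 + p\<^sup>2) / (2 * p)" by (simp add: alpha_def inverse_eq_divide)
  have "(1 - p)\<^sup>2 > 0" using assms by simp
  then have "2 * p < 1 + p\<^sup>2" by (simp add: power2_eq_square algebra_simps)
  then show "inverse (alpha p) > 1" unfolding 1 using assms by simp
  have "(1 + p\<^sup>2)\<^sup>2 = (1 - p\<^sup>2)\<^sup>2 + 4 * p\<^sup>2" by (simp add: power2_eq_square algebra_simps)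
  then show "(inverse (alpha p))\<^sup>2 - 1 = (1 - p\<^sup>2)\<^sup>2 / (4 * p\<^sup>2)"
  proof -
    have "((1 + p\<^sup>2) / (2 * p))\<^sup>2 = ((1 - p\<^sup>2)\<^sup>2 + 4 * p\<^sup>2) / (4 * p\<^sup>2)"
      unfolding power_divide \<open>(1 + p\<^sup>2)\<^sup>2 = (1 - p\<^sup>2)\<^sup>2 + 4 * p\<^sup>2\<close> by (simp add: power_mult_distrib)
    also have "\<dots> = (1 - p\<^sup>2)\<^sup>2 / (4 * p\<^sup>2) + 1" using assms by (simp add: add_divide_distrib)
    finally show ?thesis unfolding 1 by simp
  qed
qed

lemma N_bound_angle:
  assumes p: "0 < p" "p < 1" and q: "q > 1"
  defines "c \<equiv> inverse (alpha p)"
  shows "N_bound p q = c * ln q * (cot (1 / 4 * arccot (angle_bound c q)))\<^sup>2"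
proof -
  have c: "c = (1 + p\<^sup>2) / (2 * p)" and c2: "c\<^sup>2 - 1 = (1 - p\<^sup>2)\<^sup>2 / (4 * p\<^sup>2)"
    unfolding c_def using alpha_inverse[OF p] by auto
  define W where "W = 4 * p * sqrt q + (1 + q) * (1 + p\<^sup>2)"
  have W: "W > 0" unfolding W_def using p q by (intro add_pos_pos mult_pos_pos) (auto simp: add_pos_nonneg)
  have e: "2 * sqrt q + (1 + q) * c = W / (2 * p)"
  proof -
    have "W / (2 * p) = 2 * sqrt q + (1 + q) * ((1 + p\<^sup>2) / (2 * p))"
      unfolding W_def add_divide_distrib[of "4 * p * sqrt q" "(1 + q) * (1 + p\<^sup>2)"] using p by simp
    then show ?thesis by (simp only: c)
  qed
  have "(c\<^sup>2 - 1) * (1 + q\<^sup>2) / ((q - 1) * (2 * sqrt q + (1 + q) * c)) = (1 - p\<^sup>2)\<^sup>2 * (1 + q\<^sup>2) / (2 * p * (q - 1) * W)"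
    unfolding e c2 using p q W by (simp add: field_simps power2_eq_square)
  then have "angle_bound c q = (q + 1) / (q - 1) + (1 - p\<^sup>2)\<^sup>2 * (1 + q\<^sup>2) / (2 * p * (q - 1) * W)"
    by (simp only: angle_bound_def)
  then show ?thesis unfolding N_bound_def W_def[symmetric] by (simp add: c)
qed

lemma cayley_real_left_arc: "x > 0 \<Longrightarrow> cayley (of_real x) \<in> left_arc"
proof -
  assume x: "x > 0"
  have "sin (2 * arctan x) > 0" using x arctan_ubound[of x] by (intro sin_gt_zero) auto
  then show ?thesis by (simp add: cayley_real left_arc_def cos_add)
qed

lemma lens_open: "open (lens c)"
proof -
  have "lens c = {z. Im z > 0} \<inter> {z. c\<^sup>2 - 1 < (norm (z + of_real c))\<^sup>2}" by (auto simp: lens_def)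
  moreover have "open {z. c\<^sup>2 - 1 < (norm (z + complex_of_real c))\<^sup>2}"
    by (intro open_Collect_less continuous_intros)
  ultimately show ?thesis using open_halfspace_Im_gt[of 0] by auto
qed

lemma imaginary_axis_in_lens: "y > 0 \<Longrightarrow> \<i> * of_real y \<in> lens c"
  by (auto simp: lens_def cmod_power2 intro: less_le_trans[of _ 0])

text \<open>The half-plane estimate applied to \<open>f\<close> in the coordinate of the conformal map of the lens, at the image of
\<open>i y\<close>.\<close>
lemma imaginary_axis_speed_bound:
  assumes p: "0 < p" "p < 1" and f: "f \<in> M_tilde_class p"
    and x: "0 < x1" and q: "1 < q" and y: "x1 \<le> y" "y \<le> q * x1"
    and len: "curve_length {x1<..<q * x1} (\<lambda>x. f (cayley (of_real x))) \<le> ennreal l" and l0: "l \<ge> 0"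
  defines "c \<equiv> inverse (alpha p)"
  obtains D where "((\<lambda>z. f (cayley z)) has_field_derivative D) (at (\<i> * of_real y))"
    and "y * norm D \<le> c * (cot (1 / 4 * arccot (angle_bound c q)))\<^sup>2 * l"
proof -
  define x2 where "x2 = q * x1"
  have c: "c > 1" unfolding c_def by (rule alpha_inverse(2)[OF p])
  have x2: "x1 < x2" using x q by (simp add: x2_def)
  have y0: "y > 0" using x y by linarith
  have fh: "f holomorphic_on ball 0 1 - Delta_closed p" and fi: "inj_on f (ball 0 1 - Delta_closed p)"
    and fc: "continuous_on (ball 0 1 - Delta_closed p \<union> left_arc) f"
    using f by (auto simp: M_tilde_class_def)
  have cay: "cayley z \<in> ball 0 1 - Delta_closed p" if "z \<in> lens c" for z
  proof -
    have "sqrt (c\<^sup>2 - 1) < norm (cayley z - of_real c)"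
      using cayley_lens(2)[OF that] real_sqrt_less_mono by fastforce
    then have "cayley z \<notin> Delta_closed p"
      by (simp add: Delta_closed_def c_def[symmetric] dist_norm norm_minus_commute)
    then show ?thesis using cayley_lens(1)[OF that] by auto
  qed
  have nz: "z + \<i> \<noteq> 0" if "Im z \<ge> 0" for z using that by (auto simp: complex_eq_iff)
  define F where "F z = f (cayley z)" for z
  have cayi: "inj_on cayley (lens c)"
    by (rule inj_onI) (use cayley_inj nz in \<open>auto simp: lens_def\<close>)
  have cayh: "cayley holomorphic_on lens c"
    by (rule cayley_holomorphic) (use nz in \<open>auto simp: lens_def\<close>)
  note F = univalent_compose[OF fh fi cayh cayi cay, folded F_def]
  have Fc: "continuous_on (lens c \<union> of_real ` {0<..}) F"
    unfolding F_def
  proof (rule continuous_on_compose2[OF fc])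
    have "cayley holomorphic_on {z. Im z > -1}"
      by (rule cayley_holomorphic) (auto simp: complex_eq_iff)
    then show "continuous_on (lens c \<union> of_real ` {0<..}) cayley"
      by (rule holomorphic_on_imp_continuous_on[THEN continuous_on_subset]) (auto simp: lens_def)
    show "cayley ` (lens c \<union> of_real ` {0<..}) \<subseteq> ball 0 1 - Delta_closed p \<union> left_arc"
      using cay cayley_real_left_arc by blast
  qed
  define g where "g w = F (lens_inv c w)" for w
  have Li: "inj_on (lens_inv c) {w. 0 < Im w}"
    by (rule inj_on_inverseI[where g = "lens_map c"]) (use lens_inv_upper(2)[OF c] in auto)
  have Lb: "lens_inv c w \<in> lens c" if "w \<in> {w. 0 < Im w}" for w
    using lens_inv_upper(1)[OF c] that by simp
  note g = univalent_compose[OF F lens_inv_holomorphic[OF c] Li Lb, folded g_def]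
  have gh: "g holomorphic_on {w. 0 < Im w}" by (rule g(1))
  have gi: "inj_on g {w. 0 < Im w}" by (rule g(2))
  define a where "a = lens_real c x1"
  define b where "b = lens_real c x2"
  have ab: "a < b" unfolding a_def b_def by (rule lens_real_strict_mono[OF c x x2])
  have pre: "\<exists>t\<in>{x1<..<x2}. w = lens_real c t \<and> lens_inv c (of_real w) = of_real t" if "w \<in> {a<..<b}" for w
  proof -
    have "w \<in> {lens_real c x1<..<lens_real c x2}" using that by (simp add: a_def b_def)
    then obtain t where t: "t \<in> {x1<..<x2}" "w = lens_real c t"
      by (rule lens_real_surj[OF c x x2])
    then show ?thesis using lens_real_lower(2)[OF c, of t] x by auto
  qed
  define u where "u = Re (lens_map c (\<i> * of_real y))"
  define v where "v = Im (lens_map c (\<i> * of_real y))"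
  have iy: "\<i> * of_real y \<in> lens c" by (rule imaginary_axis_in_lens[OF y0])
  have v: "v > 0" unfolding v_def by (rule lens_map_upper[OF iy c])
  have w0: "lens_map c (\<i> * of_real y) = Complex u v" by (simp add: u_def v_def)
  define A where "A = (a - u) / v"
  define B where "B = (b - u) / v"
  have AB: "A < B" using ab v by (simp add: A_def B_def divide_strict_right_mono)
  have quot: "(1 + A * B) / (B - A) = (v\<^sup>2 + (a - u) * (b - u)) / (v * (b - a))"
  proof -
    have "1 + A * B = (v\<^sup>2 + (a - u) * (b - u)) / v\<^sup>2" using v by (simp add: A_def B_def add_divide_distrib power2_eq_square)
    moreover have "B - A = (b - a) / v" by (simp add: A_def B_def diff_divide_distrib)
    ultimately show ?thesis using v by (simp add: power2_eq_square)
  qed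
  define P where "P = x1 * x2"
  define K where "K = 1 + c * (x1 + x2) + x1 * x2"
  have K0: "K > 0" unfolding K_def using c x x2 by (intro add_pos_pos mult_pos_pos) auto
  have P0: "P > 0" unfolding P_def using x x2 by simp
  have id: "(1 + A * B) / (B - A) = (P + y\<^sup>2) / (y * (x2 - x1)) + (c\<^sup>2 - 1) * ((P + y\<^sup>2)\<^sup>2 + y\<^sup>2 * (x2 - x1)\<^sup>2) / (y * (1 + y\<^sup>2) * (x2 - x1) * K)"
    unfolding quot unfolding u_def v_def a_def b_def P_def K_def by (rule lens_cotangent_identity[OF c x x2 y0])
  have "(1 + A * B) / (B - A) > 0"
    unfolding id
  proof (rule add_pos_nonneg)
    show "0 < (P + y\<^sup>2) / (y * (x2 - x1))" using P0 y0 x2 by (intro divide_pos_pos add_pos_nonneg) auto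
    have "c\<^sup>2 - 1 \<ge> 0" using c by (simp add: one_le_power)
    then show "0 \<le> (c\<^sup>2 - 1) * ((P + y\<^sup>2)\<^sup>2 + y\<^sup>2 * (x2 - x1)\<^sup>2) / (y * (1 + y\<^sup>2) * (x2 - x1) * K)"
      using y0 x2 K0 by (intro divide_nonneg_nonneg mult_nonneg_nonneg add_nonneg_nonneg) auto
  qed
  then have pos: "1 + A * B > 0" using AB by (simp add: zero_less_divide_iff)
  have X: "(1 + A * B) / (B - A) \<le> angle_bound c q"
    unfolding id unfolding P_def K_def x2_def by (rule lens_cotangent_bound[OF c x q y])
  define \<phi> where "\<phi> = arctan B - arctan A"
  define \<theta> where "\<theta> = arccot (angle_bound c q)"
  have \<phi>: "\<phi> \<le> pi / 2" and \<theta>: "\<theta> \<le> \<phi>" "0 < \<theta>" "\<theta> < pi / 2"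
    unfolding \<phi>_def \<theta>_def using arctan_difference_ge_arccot[OF AB pos X] by auto
  have g': "v * norm (deriv g (Complex u v)) * (tan (\<phi> / 2))\<^sup>2 \<le> 4 * l"
  proof (rule half_plane_length_bound[OF _ _ ab v _ _ l0])
    show "g holomorphic_on {w. 0 < Im w}" "inj_on g {w. 0 < Im w}" by - (rule gh, rule gi)
    show "continuous_on ({w. 0 < Im w} \<union> of_real ` {a<..<b}) g"
      unfolding g_def
    proof (rule continuous_on_compose2[OF Fc])
      show "continuous_on ({w. 0 < Im w} \<union> of_real ` {a<..<b}) (lens_inv c)"
      proof (rule continuous_on_subset[OF lens_inv_continuous[OF c]])
        have "2 * sqrt (c\<^sup>2 - 1) < a" unfolding a_def by (rule lens_real_lower(1)[OF c x])
        then show "{w. 0 < Im w} \<union> of_real ` {a<..<b} \<subseteq> {w. 0 < Im w} \<union> of_real ` {2 * sqrt (c\<^sup>2 - 1)<..}" by force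
      qed
      show "lens_inv c ` ({w. 0 < Im w} \<union> of_real ` {a<..<b}) \<subseteq> lens c \<union> of_real ` {0<..}"
      proof
        fix z assume "z \<in> lens_inv c ` ({w. 0 < Im w} \<union> of_real ` {a<..<b})"
        then consider w where "z = lens_inv c w" "0 < Im w" | w where "z = lens_inv c (of_real w)" "w \<in> {a<..<b}" by auto
        then show "z \<in> lens c \<union> of_real ` {0<..}"
        proof cases
          case 1
          then show ?thesis using lens_inv_upper(1)[OF c] by simp
        next
          case 2
          then obtain t where "t \<in> {x1<..<x2}" "z = of_real t" using pre[OF 2(2)] by auto
          then show ?thesis using x by auto
        qed
      qed
    qed
    define \<sigma> where "\<sigma> w = Re (lens_inv c (of_real w))" for w :: real
    have "curve_length {a<..<b} (\<lambda>w. g (of_real w)) \<le> curve_length {x1<..<x2} (\<lambda>x. F (of_real x))"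
    proof (rule curve_length_mono_reparam)
      show "mono_on {a<..<b} \<sigma>"
      proof (rule mono_onI)
        fix w w' assume w: "w \<in> {a<..<b}" and w': "w' \<in> {a<..<b}" and le: "w \<le> w'"
        obtain t where t: "t \<in> {x1<..<x2}" "w = lens_real c t" "lens_inv c (of_real w) = of_real t" using pre[OF w] by auto
        obtain t' where t': "t' \<in> {x1<..<x2}" "w' = lens_real c t'" "lens_inv c (of_real w') = of_real t'" using pre[OF w'] by auto
        have "t \<le> t'"
        proof (rule ccontr)
          assume "\<not> t \<le> t'"
          then have "lens_real c t' < lens_real c t" using lens_real_strict_mono[OF c, of t' t] t' x by auto
          then show False using le t t' by simp
        qed
        then show "\<sigma> w \<le> \<sigma> w'" using t t' by (simp add: \<sigma>_def)
      qed
      show "\<sigma> ` {a<..<b} \<subseteq> {x1<..<x2}" using pre by (force simp: \<sigma>_def)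
      show "g (of_real w) = F (of_real (\<sigma> w))" if "w \<in> {a<..<b}" for w
        using pre[OF that] by (auto simp: g_def \<sigma>_def)
    qed
    then show "curve_length {a<..<b} (\<lambda>w. g (of_real w)) \<le> ennreal l"
      using len unfolding F_def x2_def by (rule order_trans)
    show "\<phi> = arctan ((b - u) / v) - arctan ((a - u) / v)" by (simp add: \<phi>_def A_def B_def)
  qed (rule \<phi>)
  define \<tau> where "\<tau> = tan (1 / 4 * \<theta>)"
  have \<tau>: "\<tau> > 0" unfolding \<tau>_def using \<theta> by (intro tan_gt_zero) auto
  \<comment> \<open>This step replaces \<open>8 cot\<^sup>2(\<phi>/2)\<close> by \<open>2 cot\<^sup>2(\<phi>/4)\<close>.\<close>
  have "2 * \<tau> \<le> tan (2 * (1 / 4 * \<theta>))" unfolding \<tau>_def using \<theta> by (intro tan_double_ge) auto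
  also have "\<dots> \<le> tan (\<phi> / 2)" using \<theta> \<phi> by (subst tan_mono_le_eq) auto
  finally have "(2 * \<tau>)\<^sup>2 \<le> (tan (\<phi> / 2))\<^sup>2" using \<tau> by (intro power_mono) auto
  then have "v * norm (deriv g (Complex u v)) * (2 * \<tau>)\<^sup>2 \<le> v * norm (deriv g (Complex u v)) * (tan (\<phi> / 2))\<^sup>2"
    using v by (intro mult_left_mono) auto
  then have "v * norm (deriv g (Complex u v)) * \<tau>\<^sup>2 \<le> l" using g' by (simp add: power_mult_distrib)
  then have g'': "v * norm (deriv g (Complex u v)) \<le> (cot (1 / 4 * \<theta>))\<^sup>2 * l"
  proof -
    have ct: "cot (1 / 4 * \<theta>) = inverse \<tau>" unfolding \<tau>_def by (rule cot_altdef)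
    show ?thesis
      using \<open>v * norm (deriv g (Complex u v)) * \<tau>\<^sup>2 \<le> l\<close> \<tau> unfolding ct by (simp add: power_inverse field_simps)
  qed
  define J' where "J' = 1 - of_real (c\<^sup>2 - 1) / (\<i> * of_real y + of_real c)\<^sup>2"
  have dJ: "(lens_map c has_field_derivative J') (at (\<i> * of_real y))"
    unfolding lens_map_def J'_def using lens_plus_nonzero[OF iy]
    by (auto intro!: derivative_eq_intros simp: power2_eq_square minus_divide_left)
  have dg: "(g has_field_derivative deriv g (Complex u v)) (at (lens_map c (\<i> * of_real y)))"
    unfolding w0 by (rule holomorphic_derivI[OF gh open_halfspace_Im_gt]) (use v in auto)
  have "((\<lambda>z. g (lens_map c z)) has_field_derivative deriv g (Complex u v) * J') (at (\<i> * of_real y))"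
    by (rule DERIV_chain2[where f = g and g = "lens_map c", OF dg dJ])
  then have "(F has_field_derivative deriv g (Complex u v) * J') (at (\<i> * of_real y))"
    by (rule has_field_derivative_transform_within_open[OF _ lens_open iy])
       (simp add: g_def lens_inv_map[OF c])
  moreover have "y * norm (deriv g (Complex u v) * J') \<le> c * (cot (1 / 4 * \<theta>))\<^sup>2 * l"
  proof -
    have "y * norm J' \<le> c * v" unfolding J'_def v_def by (rule lens_map_speed[OF c y0])
    then have "norm (deriv g (Complex u v)) * (y * norm J') \<le> norm (deriv g (Complex u v)) * (c * v)"
      by (intro mult_left_mono) auto
    also have "\<dots> = c * (v * norm (deriv g (Complex u v)))" by (simp add: mult_ac)
    also have "\<dots> \<le> c * ((cot (1 / 4 * \<theta>))\<^sup>2 * l)" using g'' c by (intro mult_left_mono) auto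
    finally show ?thesis by (simp add: norm_mult mult_ac)
  qed
  ultimately show ?thesis using that unfolding F_def[abs_def] \<theta>_def by blast
qed


text \<open>In the logarithmic coordinate \<open>s\<close> the pieces have length \<open>ln q\<close>, and on each of them the curve on the imaginary axis is
Lipschitz with a constant proportional to the length of the boundary piece. Lengths of adjacent boundary pieces
add up to at most the total length.\<close>
lemma cayley_curve_pieces:
  assumes p: "0 < p" "p < 1" and f: "f \<in> M_tilde_class p" and q: "1 < q"
    and fin: "curve_length UNIV (\<lambda>s. f (cayley (of_real (exp s)))) < \<infinity>"
  shows "curve_length UNIV (\<lambda>s. f (cayley (\<i> * of_real (exp s))))
          \<le> ennreal (N_bound p q) * curve_length UNIV (\<lambda>s. f (cayley (of_real (exp s))))"
proof -
  define c where "c = inverse (alpha p)"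
  define Fd where "Fd s = f (cayley (\<i> * of_real (exp s)))" for s
  define Fa where "Fa s = f (cayley (of_real (exp s)))" for s
  define h where "h = ln q"
  have h: "h > 0" using q by (simp add: h_def)
  define k where "k = c * (cot (1 / 4 * arccot (angle_bound c q)))\<^sup>2"
  have c1: "c > 1" unfolding c_def by (rule alpha_inverse(2)[OF p])
  have k0: "k \<ge> 0" using c1 by (simp add: k_def)
  have N: "N_bound p q = k * h"
    unfolding N_bound_angle[OF p q] k_def h_def c_def by (simp only: mult_ac)
  have fin': "curve_length S Fa < \<infinity>" for S
    using fin curve_length_subset[of S UNIV Fa] unfolding Fa_def[abs_def] by (meson order_le_less_trans subset_UNIV)
  have piece: "curve_length {A..A + h} Fd \<le> ennreal (N_bound p q) * curve_length {A..A + h} Fa" for A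
  proof -
    define l where "l = enn2real (curve_length {A..A + h} Fa)"
    have l: "curve_length {A..A + h} Fa = ennreal l" and l0: "l \<ge> 0"
      using fin'[of "{A..A + h}"] by (auto simp: l_def less_top)
    define x1 where "x1 = exp A"
    have x1: "x1 > 0" by (simp add: x1_def)
    have qx: "q * x1 = exp (A + h)" using q by (simp add: x1_def h_def exp_add)
    have len: "curve_length {x1<..<q * x1} (\<lambda>x. f (cayley (of_real x))) \<le> ennreal l"
      unfolding l[symmetric]
    proof (rule curve_length_mono_reparam)
      show "mono_on {x1<..<q * x1} ln" by (rule mono_onI) (use x1 in auto)
      have "A < ln x \<and> ln x < A + h" if "x1 < x" "x < q * x1" for x
        using that x1 unfolding qx by (metis exp_gt_zero ln_exp ln_less_cancel_iff order_less_trans x1_def)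
      then show "ln ` {x1<..<q * x1} \<subseteq> {A..A + h}" by force
      show "f (cayley (of_real x)) = Fa (ln x)" if "x \<in> {x1<..<q * x1}" for x
        using that x1 by (simp add: Fa_def)
    qed
    have der: "\<exists>D. (Fd has_vector_derivative D) (at s) \<and> norm D \<le> k * l" if s: "s \<in> {A..A + h}" for s
    proof -
      have "x1 \<le> exp s" "exp s \<le> q * x1" using s unfolding qx by (auto simp: x1_def)
      then obtain D where D: "((\<lambda>z. f (cayley z)) has_field_derivative D) (at (\<i> * of_real (exp s)))"
        "exp s * norm D \<le> k * l"
        using imaginary_axis_speed_bound[OF p f x1 q _ _ len l0] unfolding k_def c_def by blast
      have "((\<lambda>s. \<i> * of_real (exp s)) has_vector_derivative \<i> * of_real (exp s)) (at s)"
        by (auto intro!: derivative_eq_intros simp: has_vector_derivative_complex_iff)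
      from field_vector_diff_chain_at[OF this D(1)]
      have "(Fd has_vector_derivative \<i> * of_real (exp s) * D) (at s)"
        by (simp add: Fd_def[abs_def] o_def)
      moreover have "norm (\<i> * of_real (exp s) * D) \<le> k * l" using D(2) by (simp add: norm_mult)
      ultimately show ?thesis by blast
    qed
    then obtain D where D: "\<And>s. s \<in> {A..A + h} \<Longrightarrow> (Fd has_vector_derivative D s) (at s)"
      "\<And>s. s \<in> {A..A + h} \<Longrightarrow> norm (D s) \<le> k * l" by metis
    have lip: "dist (Fd s) (Fd t) \<le> k * l * t - k * l * s" if "s \<in> {A..A + h}" "t \<in> {A..A + h}" "s \<le> t" for s t
    proof -
      have "norm (Fd t - Fd s) \<le> k * l * norm (t - s)"
      proof (rule differentiable_bound[where S = "{A..A + h}" and f' = "\<lambda>s r. r *\<^sub>R D s"])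
        show "(Fd has_derivative (\<lambda>r. r *\<^sub>R D s)) (at s within {A..A + h})" if "s \<in> {A..A + h}" for s
          using D(1)[OF that] has_vector_derivative_at_within has_vector_derivative_def by blast
        show "onorm (\<lambda>r. r *\<^sub>R D s) \<le> k * l" if "s \<in> {A..A + h}" for s
          using D(2)[OF that] k0 l0 by (intro onorm_bound) (auto simp: mult.commute mult_left_mono)
      qed (use that in auto)
      then show ?thesis using that by (simp add: dist_norm norm_minus_commute right_diff_distrib)
    qed
    have "curve_length {A..A + h} Fd \<le> ennreal (k * l * h)"
    proof (rule curve_length_le_increment[where G = "\<lambda>s. k * l * s"])
      show "k * l * y - k * l * x \<le> k * l * h" if "x \<in> {A..A + h}" "y \<in> {A..A + h}" for x y
      proof -
        have "k * l * (y - x) \<le> k * l * h" using that k0 l0 by (intro mult_left_mono) auto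
        then show ?thesis by (simp add: right_diff_distrib)
      qed
    qed (use lip k0 l0 h in auto)
    also have "k * l * h = N_bound p q * l" unfolding N by (simp only: mult_ac)
    also have "ennreal (N_bound p q * l) = ennreal (N_bound p q) * curve_length {A..A + h} Fa"
      unfolding l using l0 k0 h by (intro ennreal_mult) (auto simp: N)
    finally show ?thesis .
  qed
  have pieces: "curve_length {A..A + real n * h} Fd \<le> ennreal (N_bound p q) * curve_length {A..A + real n * h} Fa" for A n
  proof (induction n)
    case 0
    have "curve_length {A..A} Fd \<le> ennreal 0"
      by (rule curve_length_le_increment[where G = "\<lambda>_. 0"]) auto
    then show ?case by simp
  next
    case (Suc n)
    define B where "B = A + real n * h"
    have AB: "A \<le> B" using h by (simp add: B_def)
    have e: "A + real (Suc n) * h = B + h" by (simp add: B_def algebra_simps)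
    have "curve_length {A..B + h} Fd \<le> curve_length {A..B} Fd + curve_length {B..B + h} Fd"
      by (rule curve_length_split) (use AB h in auto)
    also have "\<dots> \<le> ennreal (N_bound p q) * curve_length {A..B} Fa + ennreal (N_bound p q) * curve_length {B..B + h} Fa"
      using Suc.IH piece[of B] unfolding B_def by (rule add_mono)
    also have "\<dots> = ennreal (N_bound p q) * (curve_length {A..B} Fa + curve_length {B..B + h} Fa)"
      by (simp add: distrib_left)
    also have "\<dots> \<le> ennreal (N_bound p q) * curve_length {A..B + h} Fa"
      by (intro mult_left_mono curve_length_superadditive) (use AB h in auto)
    finally show ?case unfolding e .
  qed
  have "curve_length UNIV Fd \<le> ennreal (N_bound p q) * curve_length UNIV Fa"
  proof (rule curve_length_leI)
    fix ts :: "real list" assume ts: "sorted ts" "set ts \<subseteq> UNIV"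
    obtain M where M: "\<And>t. t \<in> set ts \<Longrightarrow> \<bar>t\<bar> \<le> M"
      using finite_imp_bounded[of "set ts"] by (auto simp: bounded_iff)
    obtain n :: nat where "M / h < real n" using reals_Archimedean2 by blast
    then have n: "M \<le> real n * h" using h by (simp add: divide_less_eq)
    define A where "A = - (real n * h)"
    have e: "A + real (2 * n) * h = real n * h" by (simp add: A_def)
    have "t \<in> {A..real n * h}" if "t \<in> set ts" for t
      using M[OF that] n by (auto simp: A_def abs_le_iff)
    then have "set ts \<subseteq> {A..A + real (2 * n) * h}" unfolding e by blast
    then have "ennreal (polygon_length Fd ts) \<le> curve_length {A..A + real (2 * n) * h} Fd"
      by (rule polygon_le_curve_length[OF ts(1)])
    also have "\<dots> \<le> ennreal (N_bound p q) * curve_length {A..A + real (2 * n) * h} Fa" by (rule pieces)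
    also have "\<dots> \<le> ennreal (N_bound p q) * curve_length UNIV Fa"
      by (intro mult_left_mono curve_length_subset) auto
    finally show "ennreal (polygon_length Fd ts) \<le> ennreal (N_bound p q) * curve_length UNIV Fa" .
  qed
  then show ?thesis by (simp only: Fd_def[abs_def] Fa_def[abs_def])
qed

lemma A_tilde_upper_bound:
  assumes p: "0 < p" "p < 1" and q: "1 < q"
  shows "A_tilde_const p \<le> ennreal (N_bound p q)"
  unfolding A_tilde_const_def
proof (rule SUP_least)
  fix f assume "f \<in> M0_tilde_class p"
  then have f: "f \<in> M_tilde_class p" and fin: "arc_image_length f < \<infinity>" by (auto simp: M0_tilde_class_def)
  define Fd where "Fd s = f (cayley (\<i> * of_real (exp s)))" for s
  define Fa where "Fa s = f (cayley (of_real (exp s)))" for s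
  have arc: "curve_length UNIV Fa \<le> arc_image_length f"
    unfolding arc_image_length_def
  proof (rule curve_length_mono_reparam[where \<sigma> = "\<lambda>s. pi / 2 + 2 * arctan (exp s)"])
    show "mono_on UNIV (\<lambda>s. pi / 2 + 2 * arctan (exp s))"
      by (rule mono_onI) (simp add: arctan_le_iff)
    have "2 * arctan (exp s) < pi" for s :: real using arctan_ubound[of "exp s"] by simp
    then show "range (\<lambda>s. pi / 2 + 2 * arctan (exp s)) \<subseteq> {pi / 2<..<3 * pi / 2}"
      by (auto simp: field_simps)
  qed (simp add: Fa_def cayley_real)
  have diam: "diameter_image_length f \<le> curve_length UNIV Fd"
    unfolding diameter_image_length_def
  proof (rule curve_length_antimono_reparam[where \<sigma> = "\<lambda>v. ln ((1 - v) / (1 + v))"])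
    have "ln ((1 - y) / (1 + y)) \<le> ln ((1 - x) / (1 + x))"
      if xy: "x \<in> {-1<..<1}" "y \<in> {-1<..<1}" "x \<le> y" for x y :: real
    proof -
      have "(1 - y) / (1 + y) \<le> (1 - x) / (1 + x)" using xy by (intro frac_le) auto
      then show ?thesis using xy by simp
    qed
    then show "antimono_on {-1<..<1} (\<lambda>v::real. ln ((1 - v) / (1 + v)))"
      by (simp add: monotone_on_def)
    show "f (\<i> * of_real v) = Fd (ln ((1 - v) / (1 + v)))" if v: "v \<in> {-1<..<1}" for v
    proof -
      define y where "y = (1 - v) / (1 + v)"
      have y: "y > 0" using v by (simp add: y_def)
      have "(1 - y) / (1 + y) = v"
      proof -
        have "1 - y = 2 * v / (1 + v)" "1 + y = 2 / (1 + v)" using v by (simp_all add: y_def field_simps)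
        then show ?thesis using v by simp
      qed
      then have "cayley (\<i> * of_real y) = \<i> * of_real v" using cayley_imaginary[OF y] by simp
      then show ?thesis using y by (simp add: Fd_def y_def)
    qed
  qed auto
  have "curve_length UNIV Fa < \<infinity>" using arc fin by (rule order_le_less_trans)
  then have "curve_length UNIV Fd \<le> ennreal (N_bound p q) * curve_length UNIV Fa"
    using cayley_curve_pieces[OF p f q] by (simp only: Fd_def[abs_def] Fa_def[abs_def])
  also have "\<dots> \<le> ennreal (N_bound p q) * arc_image_length f" by (intro mult_left_mono arc) auto
  finally have le: "diameter_image_length f \<le> ennreal (N_bound p q) * arc_image_length f"
    using diam by (rule order_trans[rotated])
  show "diameter_image_length f / arc_image_length f \<le> ennreal (N_bound p q)"
  proof (cases "arc_image_length f = 0")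
    case True
    then show ?thesis using le by simp
  next
    case False
    then show ?thesis using le by (intro divide_le_posI_ennreal) (auto simp: zero_less_iff_neq_zero mult.commute)
  qed
qed

section \<open>The lower bound\<close>
lemma M0_subset_M0_tilde:
  assumes p: "0 < p" "p < 1"
  shows "M0_class p \<subseteq> M0_tilde_class p"
proof -
  have "of_real p \<in> Delta_closed p"
  proof -
    define c where "c = inverse (alpha p)"
    have c: "c = (1 + p\<^sup>2) / (2 * p)" by (simp add: c_def alpha_def inverse_eq_divide)
    have cp: "c - p = (1 - p\<^sup>2) / (2 * p)" using p by (simp add: c field_simps power2_eq_square)
    have "p\<^sup>2 < 1" using p by (simp add: abs_square_less_1)
    then have "c - p \<ge> 0" unfolding cp using p by simp
    have "c\<^sup>2 - 1 = (c - p)\<^sup>2"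
    proof -
      have "2 * p * c = 1 + p\<^sup>2" using p by (simp add: c)
      then show ?thesis by (simp add: power2_eq_square algebra_simps)
    qed
    then have "sqrt (c\<^sup>2 - 1) = c - p" using \<open>c - p \<ge> 0\<close> by simp
    moreover have "dist (complex_of_real c) (of_real p) = c - p"
      using \<open>c - p \<ge> 0\<close> by (simp add: dist_of_real dist_real_def)
    ultimately show ?thesis by (simp add: Delta_closed_def c_def)
  qed
  then have sub: "ball 0 1 - Delta_closed p \<subseteq> ball 0 1 - {complex_of_real p}" by auto
  have "f \<in> M_tilde_class p" if "f \<in> M_class p" for f
  proof -
    have "f holomorphic_on ball 0 1 - {of_real p}" "inj_on f (ball 0 1 - {of_real p})"
      "continuous_on (ball 0 1 - {of_real p} \<union> left_arc) f"
      using that by (auto simp: M_class_def)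
    then show ?thesis unfolding M_tilde_class_def
      using sub by (auto intro: holomorphic_on_subset inj_on_subset continuous_on_subset)
  qed
  then show ?thesis by (auto simp: M0_class_def M0_tilde_class_def)
qed

text \<open>Numerator and denominator divided by \<open>z\<close> are \<open>2 + J\<close> and \<open>p J - (1 + p\<^sup>2)\<close> with
\<open>J = z + 1/z\<close>: a Moebius transformation of the Joukowski function.\<close>
definition slit_map :: "real \<Rightarrow> complex \<Rightarrow> complex" where
  "slit_map p z = (1 + z)\<^sup>2 / ((of_real p - z) * (1 - of_real p * z))"

lemma slit_map_deriv:
  assumes "z \<noteq> of_real p" "1 - of_real p * z \<noteq> 0"
  shows "(slit_map p has_field_derivative (1 + of_real p)\<^sup>2 * (1 - z\<^sup>2) / ((of_real p - z) * (1 - of_real p * z))\<^sup>2) (at z)"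
proof -
  define P where "P = complex_of_real p"
  have nz: "P - z \<noteq> 0" "1 - P * z \<noteq> 0" using assms by (auto simp: P_def)
  have "(slit_map p has_field_derivative
     (2 * (1 + z) * ((P - z) * (1 - P * z)) - (1 + z)\<^sup>2 * (- (1 - P * z) + (P - z) * (- P))) / ((P - z) * (1 - P * z))\<^sup>2) (at z)"
    unfolding slit_map_def[abs_def] P_def[symmetric] using nz
    by (auto intro!: derivative_eq_intros simp: power2_eq_square)
  also have "2 * (1 + z) * ((P - z) * (1 - P * z)) - (1 + z)\<^sup>2 * (- (1 - P * z) + (P - z) * (- P)) = (1 + P)\<^sup>2 * (1 - z\<^sup>2)"
    by algebra
  finally show ?thesis by (simp only: P_def)
qed

lemma slit_map_in_M_class:
  assumes p: "0 < p" "p < 1"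
  shows "slit_map p \<in> M_class p"
proof -
  define P where "P = complex_of_real p"
  have nP: "norm P = p" "0 < p" "p < 1" using p by (auto simp: P_def)
  have den: "1 - P * z \<noteq> 0" if "norm z \<le> 1" for z
  proof
    assume "1 - P * z = 0"
    then have "P * z = 1" by simp
    then have "p * norm z = 1" by (metis nP(1) norm_mult norm_one)
    moreover have "p * norm z \<le> p * 1" using p that by (intro mult_left_mono) auto
    ultimately show False using p by simp
  qed
  have s: "slit_map p = (\<lambda>z. (1 + z)\<^sup>2 / ((P - z) * (1 - P * z)))" by (simp add: slit_map_def P_def fun_eq_iff)
  have holo: "slit_map p holomorphic_on ball 0 1 - {P}"
    unfolding s by (intro holomorphic_intros) (use den in auto)
  define g where "g z = - (1 + z)\<^sup>2 / (1 - P * z)" for z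
  have gh: "g holomorphic_on ball 0 1" unfolding g_def by (intro holomorphic_intros) (use den in auto)
  have gP: "g P \<noteq> 0"
  proof -
    have "1 + P \<noteq> 0" using p by (auto simp: P_def complex_eq_iff)
    then show ?thesis using den[of P] nP by (simp add: g_def)
  qed
  have fg: "slit_map p z = g z / (z - P)" if "z \<in> ball 0 1" "z \<noteq> P" for z
  proof -
    have "(P - z) * (1 - P * z) = - ((z - P) * (1 - P * z))" by algebra
    then show ?thesis unfolding s g_def by (simp add: mult.commute)
  qed
  have zo: "zorder (slit_map p) P = -1"
  proof (rule zorder_eqI[OF open_ball _ gh gP])
    show "P \<in> ball 0 1" using nP by simp
    show "slit_map p w = g w * (w - P) powi (-1)" if "w \<in> ball 0 1" "w \<noteq> P" for w
      using fg[OF that] by (simp add: power_int_minus field_simps)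
  qed
  have pole: "is_pole (slit_map p) P"
  proof -
    have "is_pole (\<lambda>z. g z / (z - P)) P"
    proof (rule is_pole_divide)
      show "isCont g P" using gh nP holomorphic_on_imp_continuous_on[OF gh] by (simp add: continuous_on_eq_continuous_at)
      show "filterlim (\<lambda>z. z - P) (at 0) (at P)"
        by (intro filterlim_atI tendsto_eq_intros) (auto simp: eventually_at_filter)
    qed (rule gP)
    moreover have "\<forall>\<^sub>F z in at P. g z / (z - P) = slit_map p z"
      using eventually_at_in_open'[of "ball 0 1 - {P}" P] 
      by (intro eventually_mono[OF eventually_at_in_open[of "ball 0 1" P]]) (use fg nP in auto)
    ultimately show ?thesis by (subst (asm) is_pole_cong) auto
  qed
  have inj: "inj_on (slit_map p) (ball 0 1 - {P})"
  proof (rule inj_onI)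
    fix z w assume z: "z \<in> ball 0 1 - {P}" and w: "w \<in> ball 0 1 - {P}" and e: "slit_map p z = slit_map p w"
    have nz: "(P - z) * (1 - P * z) \<noteq> 0" "(P - w) * (1 - P * w) \<noteq> 0" using z w den by auto
    have "(1 + z)\<^sup>2 * ((P - w) * (1 - P * w)) = (1 + w)\<^sup>2 * ((P - z) * (1 - P * z))"
      using e nz unfolding s by (simp add: frac_eq_eq)
    then have "(1 + P)\<^sup>2 * ((z - w) * (1 - z * w)) = 0" by algebra
    moreover have "1 + P \<noteq> 0" using p by (auto simp: P_def complex_eq_iff)
    moreover have "1 - z * w \<noteq> 0"
    proof
      assume "1 - z * w = 0"
      then have "norm (z * w) = 1" by simp
      moreover have "norm (z * w) < 1" using z w norm_mult_less[of z 1 w 1] by simp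
      ultimately show False by simp
    qed
    ultimately show "z = w" by simp
  qed
  have cont: "continuous_on (ball 0 1 - {P} \<union> left_arc) (slit_map p)"
    unfolding s
    by (intro continuous_intros) (use den nP in \<open>auto simp: left_arc_def\<close>)
  show ?thesis using holo inj cont pole zo by (simp add: M_class_def P_def)
qed

lemma slit_map_cis:
  "slit_map p (cis t) = - of_real ((2 + 2 * cos t) / (1 + p\<^sup>2 - 2 * p * cos t))"
proof -
  have e: "cis t * cis (- t) = 1" by (simp add: cis_mult)
  have c: "complex_of_real (2 * cos t) = cis t + cis (- t)" by (simp add: complex_eq_iff)
  have c': "complex_of_real (2 * p * cos t) = of_real p * (cis t + cis (- t))"
    unfolding c[symmetric] by simp
  have 1: "(1 + cis t)\<^sup>2 = cis t * of_real (2 + 2 * cos t)"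
    unfolding of_real_add c using e by simp algebra
  have 2: "(of_real p - cis t) * (1 - of_real p * cis t) = - cis t * of_real (1 + p\<^sup>2 - 2 * p * cos t)"
    unfolding of_real_diff c' using e by simp algebra
  show ?thesis unfolding slit_map_def 1 2 by simp
qed

text \<open>The values on the arc are real and depend monotonically on \<open>cos t\<close>, which decreases up to \<open>t = \<pi>\<close> and increases
afterwards: the image is a segment of length \<open>2/(1 + p\<^sup>2)\<close> run through twice.\<close>
lemma slit_map_arc_length:
  assumes p: "0 < p" "p < 1"
  shows "arc_image_length (slit_map p) \<le> ennreal (4 / (1 + p\<^sup>2))"
proof -
  define g where "g x = (2 + 2 * x) / (1 + p\<^sup>2 - 2 * p * x)" for x :: real
  have den: "1 + p\<^sup>2 - 2 * p * x > 0" if "x \<le> 0" for x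
  proof -
    have "2 * p * x \<le> 0" using p that by (simp add: mult_nonneg_nonpos)
    then show ?thesis using zero_le_power2[of p] by linarith
  qed
  have gmono: "g x \<le> g y" if "-1 \<le> x" "x \<le> y" "y \<le> 0" for x y
    unfolding g_def
  proof (rule frac_le)
    show "1 + p\<^sup>2 - 2 * p * y \<le> 1 + p\<^sup>2 - 2 * p * x" using p that by (simp add: mult_left_mono)
  qed (use that den in auto)
  have g01: "g (-1) = 0" "g 0 = 2 / (1 + p\<^sup>2)" by (simp_all add: g_def)
  have dist: "dist (slit_map p (cis s)) (slit_map p (cis t)) = \<bar>g (cos s) - g (cos t)\<bar>" for s t
  proof -
    have "dist (slit_map p (cis s)) (slit_map p (cis t)) = norm (complex_of_real (g (cos t) - g (cos s)))"
      unfolding slit_map_cis g_def[symmetric] dist_norm by simp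
    then show ?thesis by (simp only: norm_of_real abs_minus_commute)
  qed
  have cosneg: "cos s \<le> 0" if "s \<in> {pi/2..3*pi/2}" for s
  proof -
    have "cos (s - pi) \<ge> 0" using that by (intro cos_ge_zero) auto
    then show ?thesis by simp
  qed
  have grange: "0 \<le> g (cos s)" "g (cos s) \<le> 2 / (1 + p\<^sup>2)" if "s \<in> {pi/2..3*pi/2}" for s
    using gmono[of "-1" "cos s"] gmono[of "cos s" 0] cosneg[OF that] g01 cos_ge_minus_one by auto
  let ?\<gamma> = "\<lambda>t. slit_map p (cis t)"
  have nn: "2 / (1 + p\<^sup>2) \<ge> 0" by (simp add: add_nonneg_nonneg)
  have "curve_length {pi/2..pi} ?\<gamma> \<le> ennreal (2 / (1 + p\<^sup>2))"
  proof (rule curve_length_le_increment[where G = "\<lambda>t. - g (cos t)"])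
    fix x y assume xy: "x \<in> {pi/2..pi}" "y \<in> {pi/2..pi}" "x \<le> y"
    have "cos y \<le> cos x" using xy by (subst cos_mono_le_eq) auto
    then have "g (cos y) \<le> g (cos x)" using xy cosneg[of x] by (intro gmono) auto
    then show "dist (?\<gamma> x) (?\<gamma> y) \<le> - g (cos y) - - g (cos x)" unfolding dist by simp
    show "- g (cos y) - - g (cos x) \<le> 2 / (1 + p\<^sup>2)"
      using grange[of x] grange[of y] xy by simp
  qed (rule nn)
  moreover have "curve_length {pi..3*pi/2} ?\<gamma> \<le> ennreal (2 / (1 + p\<^sup>2))"
  proof (rule curve_length_le_increment[where G = "\<lambda>t. g (cos t)"])
    fix x y assume xy: "x \<in> {pi..3*pi/2}" "y \<in> {pi..3*pi/2}" "x \<le> y"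
    have "cos (y - pi) \<le> cos (x - pi)" using xy by (subst cos_mono_le_eq) auto
    then have "cos x \<le> cos y" by simp
    then have "g (cos x) \<le> g (cos y)" using xy cosneg[of y] by (intro gmono) auto
    then show "dist (?\<gamma> x) (?\<gamma> y) \<le> g (cos y) - g (cos x)" unfolding dist by simp
    show "g (cos y) - g (cos x) \<le> 2 / (1 + p\<^sup>2)"
      using grange[of x] grange[of y] xy by simp
  qed (rule nn)
  moreover have "curve_length {pi/2..3*pi/2} ?\<gamma> \<le> curve_length {pi/2..pi} ?\<gamma> + curve_length {pi..3*pi/2} ?\<gamma>"
    by (rule curve_length_split) auto
  moreover have "arc_image_length (slit_map p) \<le> curve_length {pi/2..3*pi/2} ?\<gamma>"
    unfolding arc_image_length_def by (rule curve_length_subset) auto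
  ultimately have "arc_image_length (slit_map p) \<le> ennreal (2 / (1 + p\<^sup>2)) + ennreal (2 / (1 + p\<^sup>2))"
    by (meson add_mono order_trans)
  also have "\<dots> = ennreal (4 / (1 + p\<^sup>2))" using nn by (subst ennreal_plus[symmetric]) auto
  finally show ?thesis .
qed

text \<open>The image is a circle without one point; the speed has the primitive \<open>H\<close>, and
\<open>arctan(1/p) + arctan p = \<pi>/2\<close> evaluates it at the ends of the diameter.\<close>
lemma slit_map_diameter_length:
  assumes p: "0 < p" "p < 1"
  shows "ennreal ((1 + p)\<^sup>2 * pi / (p * (1 + p\<^sup>2))) \<le> diameter_image_length (slit_map p)"
proof -
  let ?\<gamma> = "\<lambda>v. slit_map p (\<i> * of_real v)"
  define D where "D z = (1 + of_real p)\<^sup>2 * (1 - z\<^sup>2) / ((of_real p - z) * (1 - of_real p * z))\<^sup>2" for z :: complex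
  define k where "k = (1 + p)\<^sup>2 / (p * (1 + p\<^sup>2))"
  define H where "H v = k * (arctan (v / p) + arctan (p * v))" for v
  have pos: "p\<^sup>2 + v\<^sup>2 > 0" "1 + p\<^sup>2 * v\<^sup>2 > 0" "1 + p\<^sup>2 > 0" for v :: real
    using p by (auto simp: add_pos_nonneg)
  have nz: "\<i> * complex_of_real v \<noteq> of_real p" "1 - complex_of_real p * (\<i> * of_real v) \<noteq> 0" for v
    using p by (auto simp: complex_eq_iff)
  have der: "(?\<gamma> has_vector_derivative \<i> * D (\<i> * of_real v)) (at v)" for v
  proof -
    have "((\<lambda>v. \<i> * of_real v) has_vector_derivative \<i>) (at v)"
      by (auto intro!: derivative_eq_intros simp: has_vector_derivative_complex_iff)
    from field_vector_diff_chain_at[OF this slit_map_deriv[OF nz]]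
    show ?thesis by (simp add: o_def D_def)
  qed
  have speed: "norm (\<i> * D (\<i> * of_real v)) = (1 + p)\<^sup>2 * (1 + v\<^sup>2) / ((p\<^sup>2 + v\<^sup>2) * (1 + p\<^sup>2 * v\<^sup>2))" for v
  proof -
    have a: "norm (1 + complex_of_real p) = 1 + p"
    proof -
      have "1 + complex_of_real p = of_real (1 + p)" by simp
      moreover have "1 + p \<ge> 0" using p by simp
      ultimately show ?thesis by (simp only: norm_of_real abs_of_nonneg)
    qed
    have b: "norm (1 - (\<i> * complex_of_real v)\<^sup>2) = 1 + v\<^sup>2"
    proof -
      have "1 - (\<i> * complex_of_real v)\<^sup>2 = of_real (1 + v\<^sup>2)" by (simp add: power_mult_distrib)
      moreover have "1 + v\<^sup>2 \<ge> 0" by (simp add: add_nonneg_nonneg)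
      ultimately show ?thesis by (simp only: norm_of_real abs_of_nonneg)
    qed
    have c: "(norm (complex_of_real p - \<i> * of_real v))\<^sup>2 = p\<^sup>2 + v\<^sup>2" by (simp add: cmod_power2)
    have d: "(norm (1 - complex_of_real p * (\<i> * of_real v)))\<^sup>2 = 1 + p\<^sup>2 * v\<^sup>2" by (simp add: cmod_power2 power_mult_distrib)
    show ?thesis unfolding D_def norm_mult norm_divide norm_power a b unfolding power_mult_distrib c d by simp
  qed
  have dH: "(H has_real_derivative norm (\<i> * D (\<i> * of_real v))) (at v)" for v
  proof -
    have "(H has_real_derivative k * (1 / p / (1 + (v / p)\<^sup>2) + p / (1 + (p * v)\<^sup>2))) (at v)"
      unfolding H_def using p by (auto intro!: derivative_eq_intros simp: field_simps add_pos_nonneg)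
    moreover have "k * (1 / p / (1 + (v / p)\<^sup>2) + p / (1 + (p * v)\<^sup>2)) = norm (\<i> * D (\<i> * of_real v))"
    proof -
      have 1: "1 / p / (1 + (v / p)\<^sup>2) = p / (p\<^sup>2 + v\<^sup>2)"
      proof -
        have "1 + (v / p)\<^sup>2 = (p\<^sup>2 + v\<^sup>2) / p\<^sup>2" using p by (simp add: power_divide add_divide_distrib)
        then show ?thesis using p by (simp add: power2_eq_square)
      qed
      have "p / (p\<^sup>2 + v\<^sup>2) + p / (1 + p\<^sup>2 * v\<^sup>2) = (p * (1 + p\<^sup>2 * v\<^sup>2) + p * (p\<^sup>2 + v\<^sup>2)) / ((p\<^sup>2 + v\<^sup>2) * (1 + p\<^sup>2 * v\<^sup>2))"
        using pos(1,2)[of v] by (subst add_frac_eq) auto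
      also have "p * (1 + p\<^sup>2 * v\<^sup>2) + p * (p\<^sup>2 + v\<^sup>2) = p * (1 + p\<^sup>2) * (1 + v\<^sup>2)" by (simp add: algebra_simps)
      finally have "k * (1 / p / (1 + (v / p)\<^sup>2) + p / (1 + (p * v)\<^sup>2)) = k * (p * (1 + p\<^sup>2) * (1 + v\<^sup>2) / ((p\<^sup>2 + v\<^sup>2) * (1 + p\<^sup>2 * v\<^sup>2)))"
        unfolding 1 by (simp only: power_mult_distrib)
      also have "\<dots> = (1 + p)\<^sup>2 * (1 + v\<^sup>2) / ((p\<^sup>2 + v\<^sup>2) * (1 + p\<^sup>2 * v\<^sup>2))"
        using p pos(3) unfolding k_def by simp
      finally show ?thesis unfolding speed .
    qed
    ultimately show ?thesis by simp
  qed
  have part: "ennreal (H r - H (- r)) \<le> diameter_image_length (slit_map p)" if r: "0 < r" "r < 1" for r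
  proof -
    have "((\<lambda>v. norm (\<i> * D (\<i> * of_real v))) has_integral H r - H (- r)) {-r..r}"
      using r dH by (intro fundamental_theorem_of_calculus) (auto simp: has_real_derivative_iff_has_vector_derivative[symmetric] intro: has_field_derivative_at_within)
    then have "ennreal (H r - H (- r)) = ennreal (integral {-r..r} (\<lambda>v. norm (\<i> * D (\<i> * of_real v))))"
      by (simp add: integral_unique)
    also have "\<dots> \<le> curve_length {-r..r} ?\<gamma>"
    proof (rule integral_speed_le_curve_length)
      show "(?\<gamma> has_vector_derivative \<i> * D (\<i> * of_real t)) (at t within {-r..r})" for t
        by (rule has_vector_derivative_at_within[OF der])
      show "continuous_on {-r..r} (\<lambda>v. \<i> * D (\<i> * of_real v))"
        unfolding D_def by (intro continuous_intros) (use nz in auto)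
    qed (use r in simp)
    also have "\<dots> \<le> diameter_image_length (slit_map p)"
      unfolding diameter_image_length_def by (rule curve_length_subset) (use r in auto)
    finally show ?thesis .
  qed
  have lim: "((\<lambda>r. ennreal (H r - H (- r))) \<longlongrightarrow> ennreal (H 1 - H (- 1))) (at_left 1)"
  proof (intro tendsto_ennrealI tendsto_intros)
    have c: "isCont H v" for v using dH by (rule DERIV_isCont)
    show "(H \<longlongrightarrow> H 1) (at_left 1)"
      by (rule isCont_tendsto_compose[OF c]) (rule tendsto_ident_at)
    show "((\<lambda>r. H (- r)) \<longlongrightarrow> H (- 1)) (at_left 1)"
      by (rule isCont_tendsto_compose[OF c]) (intro tendsto_intros)
  qed
  have "ennreal (H 1 - H (- 1)) \<le> diameter_image_length (slit_map p)"
    by (rule tendsto_upperbound[OF lim eventually_mono[OF eventually_at_left_real[of 0 1]]]) (use part in auto)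
  moreover have "H 1 - H (- 1) = (1 + p)\<^sup>2 * pi / (p * (1 + p\<^sup>2))"
  proof -
    have "arctan (1 / p) = pi / 2 - arctan p" using arctan_inverse[of p] p by (simp add: inverse_eq_divide)
    then show ?thesis by (simp add: H_def arctan_minus k_def)
  qed
  ultimately show ?thesis by simp
qed

lemma A_lower_bound:
  assumes p: "0 < p" "p < 1"
  shows "ennreal ((1 + p)\<^sup>2 * pi / (4 * p)) \<le> A_const p"
proof -
  have M: "slit_map p \<in> M0_class p"
    using slit_map_in_M_class[OF p] slit_map_arc_length[OF p]
    by (auto simp: M0_class_def intro: order_le_less_trans)
  have pp: "1 + p\<^sup>2 > 0" by (simp add: add_pos_nonneg)
  have "(1 + p)\<^sup>2 * pi / (p * (1 + p\<^sup>2)) / (4 / (1 + p\<^sup>2)) = (1 + p)\<^sup>2 * pi / (4 * p)"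
  proof -
    have "X / (p * s) / (4 / s) = X / (4 * p)" if "s > 0" for X s :: real using that p by simp
    from this[OF pp] show ?thesis .
  qed
  then have "ennreal ((1 + p)\<^sup>2 * pi / (4 * p)) = ennreal ((1 + p)\<^sup>2 * pi / (p * (1 + p\<^sup>2)) / (4 / (1 + p\<^sup>2)))"
    by (simp only:)
  also have "\<dots> = ennreal ((1 + p)\<^sup>2 * pi / (p * (1 + p\<^sup>2))) / ennreal (4 / (1 + p\<^sup>2))"
    by (rule divide_ennreal[symmetric]) (use p pp in auto)
  also have "\<dots> \<le> diameter_image_length (slit_map p) / arc_image_length (slit_map p)"
  proof -
    have "inverse (ennreal (4 / (1 + p\<^sup>2))) \<le> inverse (arc_image_length (slit_map p))"
    proof -
      define a where "a = enn2real (arc_image_length (slit_map p))"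
      have "arc_image_length (slit_map p) < top"
        using slit_map_arc_length[OF p] by (rule order_le_less_trans) simp
      then have a: "arc_image_length (slit_map p) = ennreal a" "a \<ge> 0" by (auto simp: a_def)
      have "a \<le> 4 / (1 + p\<^sup>2)"
        using slit_map_arc_length[OF p] pp unfolding a(1) by (subst (asm) ennreal_le_iff) auto
      then show ?thesis
      proof (cases "a = 0")
        case False
        then have "a > 0" using a(2) by simp
        then show ?thesis unfolding a(1) using \<open>a \<le> 4 / (1 + p\<^sup>2)\<close> pp
          by (auto simp: inverse_ennreal intro!: ennreal_leI le_imp_inverse_le simp del: inverse_divide)
      qed (simp add: a)
    qed
    then show ?thesis unfolding divide_ennreal_def
      by (intro mult_mono slit_map_diameter_length[OF p]) auto
  qed
  also have "\<dots> \<le> A_const p" unfolding A_const_def by (rule SUP_upper[OF M])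
  finally show ?thesis .
qed

lemma A_le_A_tilde: "0 < p \<Longrightarrow> p < 1 \<Longrightarrow> A_const p \<le> A_tilde_const p"
  unfolding A_const_def A_tilde_const_def by (rule SUP_subset_mono[OF M0_subset_M0_tilde]) auto

theorem theorem2:
  fixes p :: real
  assumes "0 < p" and "p < 1"
  shows "ennreal ((1 + p)\<^sup>2 * pi / (4 * p)) \<le> A_const p
       \<and> A_const p \<le> A_tilde_const p
       \<and> A_tilde_const p \<le> (INF q \<in> {1<..}. ennreal (N_bound p q))"
  using A_lower_bound[OF assms] A_le_A_tilde[OF assms] A_tilde_upper_bound[OF assms]
  by (auto intro!: INF_greatest)

end
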